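(* Let $\mu$ be a regular isotropic log-concave target on $\mathbb R^n$ with moment potential $\psi$, let $U$ have law $e^{-\psi(u)}\,du$, and put $Y=\nabla\psi(U)\sim\mu$ and $H=\nabla^2\psi(U)$. Let $\mathsf S_n$ be the space of real symmetric $n\times n$ matrices, and for $A,B\in\mathsf S_n$ define the symmetric bilinear forms $$\Gamma_{\rm tr}(A,B)=\operatorname{Cov}\bigl(\operatorname{Tr}(AH),\operatorname{Tr}(BH)\bigr),\qquad \Gamma_{\rm quad}(A,B)=\operatorname{Cov}\bigl(Y^{\mathsf T}AY,\,Y^{\mathsf T}BY\bigr),$$ $$\mathsf T(A,B)=\mathbb E\,(AY)^{\mathsf T}H(BY),\qquad \mathsf U(A,B)=\mathbb E\operatorname{Tr}(AHBH).$$ Then $$\Gamma_{\rm tr}(A,B)=\Gamma_{\rm quad}(A,B)-3\,\mathsf T(A,B)+\mathsf U(A,B)\qquad\text{for every }A,B\in\mathsf S_n.$$ Moreover, the bilinear form $\mathsf D:=4\mathsf T-\Gamma_{\rm quad}$ is positive-semidefinite (i.e. $\mathsf D(A,A)\ge0$ for all $A\in\mathsf S_n$), and $$\Gamma_{\rm tr}=\tfrac14\Gamma_{\rm quad}+\mathsf U-\tfrac34\mathsf D.$$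
   Context: A random vector $Y\in\mathbb R^n$ is isotropic if $\mathbb E Y=0$ and $\mathbb E(YY^{\mathsf T})=I_n$; a probability measure is isotropic if a random vector with that law is. Regular isotropic log-concave target and moment potential (the regular moment-map model): a regular isotropic log-concave target on $\mathbb R^n$ is an isotropic probability measure $d\mu(y)=e^{-V(y)}\mathbf 1_K(y)\,dy$, where $K\subset\mathbb R^n$ is bounded, open and convex and $V$ is smooth and convex on a neighborhood of $\overline K$. By the moment-measure theorem there is a smooth strictly convex $\psi:\mathbb R^n\to\mathbb R$ (the moment potential), unique up to translation, with $\int e^{-\psi}=1$, such that if $U$ has law $d\nu(u)=e^{-\psi(u)}\,du$ then $\nabla\psi(U)\sim\mu$; moreover $\nabla\psi:\mathbb R^n\to K$ is a diffeomorphism. *)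

theory Defs
  imports "HOL-Probability.Probability"
begin

text \<open>Smoothness is \<open>C\<^sup>\<infinity>\<close>, meant for open sets \<open>S\<close>: all iterated directional derivatives
  exist in the Frechet sense and are continuous on \<open>S\<close>.\<close>

primrec Ck_on :: "nat \<Rightarrow> ('a::real_normed_vector \<Rightarrow> 'b::real_normed_vector) \<Rightarrow> 'a set \<Rightarrow> bool" where
  "Ck_on 0 = (\<lambda>f S. continuous_on S f)"
| "Ck_on (Suc k) = (\<lambda>f S. (\<forall>x\<in>S. f differentiable (at x)) \<and>
     (\<forall>v. Ck_on k (\<lambda>x. frechet_derivative f (at x) v) S))"

definition smooth_on :: "('a::real_normed_vector \<Rightarrow> 'b::real_normed_vector) \<Rightarrow> 'a set \<Rightarrow> bool" where
  "smooth_on f S \<longleftrightarrow> (\<forall>k. Ck_on k f S)"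

definition diffeomorphism :: "'a::real_normed_vector set \<Rightarrow> 'b::real_normed_vector set \<Rightarrow> ('a \<Rightarrow> 'b) \<Rightarrow> bool" where
  "diffeomorphism S T f \<longleftrightarrow>
     (\<exists>g. homeomorphism S T f g \<and> smooth_on f S \<and> smooth_on g T)"

definition strictly_convex_on :: "'a::real_vector set \<Rightarrow> ('a \<Rightarrow> real) \<Rightarrow> bool" where
  "strictly_convex_on S f \<longleftrightarrow> convex S \<and>
     (\<forall>x\<in>S. \<forall>y\<in>S. x \<noteq> y \<longrightarrow> (\<forall>u>0. \<forall>v>0. u + v = 1 \<longrightarrow>
        f (u *\<^sub>R x + v *\<^sub>R y) < u * f x + v * f y))"

definition grad :: "(real ^ 'n \<Rightarrow> real) \<Rightarrow> real ^ 'n \<Rightarrow> real ^ 'n" where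
  "grad f x = (\<chi> i. frechet_derivative f (at x) (axis i 1))"

definition hessian :: "(real ^ 'n \<Rightarrow> real) \<Rightarrow> real ^ 'n \<Rightarrow> real ^ 'n ^ 'n" where
  "hessian f x = jacobian (grad f) (at x)"

text \<open>The second condition is the matrix identity \<open>E(Y Y\<^sup>T) = I\<close>. It already forces finite second
  moments, since the Bochner integral of a non-integrable function is \<open>0\<close>.\<close>

definition isotropic :: "(real ^ 'n) measure \<Rightarrow> bool" where
  "isotropic \<mu> \<longleftrightarrow> prob_space \<mu> \<and> sets \<mu> = sets borel \<and>
     (\<integral>y. y \<partial>\<mu>) = 0 \<and>
     (\<integral>y. (\<chi> i j. y $ i * y $ j) \<partial>\<mu>) = (mat 1 :: real ^ 'n ^ 'n)"

text \<open>The neighbourhood of \<open>closure K\<close> may be taken convex (as \<open>convex_on\<close> requires), because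
  \<open>closure K\<close> is compact and convex.\<close>

definition regular_isotropic_log_concave_target ::
    "(real ^ 'n) set \<Rightarrow> (real ^ 'n \<Rightarrow> real) \<Rightarrow> (real ^ 'n) measure \<Rightarrow> bool" where
  "regular_isotropic_log_concave_target K V \<mu> \<longleftrightarrow>
     bounded K \<and> open K \<and> convex K \<and>
     (\<exists>N. open N \<and> closure K \<subseteq> N \<and> smooth_on V N \<and> convex_on N V) \<and>
     \<mu> = density lborel (\<lambda>y. ennreal (exp (- V y) * indicator K y)) \<and>
     isotropic \<mu>"

text \<open>The potential provided by the moment-measure theorem, with all the properties it provides;
  the last one follows from the others under the regularity assumptions on \<open>\<mu>\<close>.\<close>

definition moment_potential ::
    "(real ^ 'n) set \<Rightarrow> (real ^ 'n) measure \<Rightarrow> (real ^ 'n \<Rightarrow> real) \<Rightarrow> bool" where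
  "moment_potential K \<mu> \<psi> \<longleftrightarrow>
     smooth_on \<psi> UNIV \<and> strictly_convex_on UNIV \<psi> \<and>
     (\<integral>u. exp (- \<psi> u) \<partial>lborel) = 1 \<and>
     distr (density lborel (\<lambda>u. ennreal (exp (- \<psi> u)))) borel (grad \<psi>) = \<mu> \<and>
     diffeomorphism UNIV K (grad \<psi>)"

definition sym_matrices :: "(real ^ 'n ^ 'n) set" where
  "sym_matrices = {A. transpose A = A}"

definition covariance :: "'w measure \<Rightarrow> ('w \<Rightarrow> real) \<Rightarrow> ('w \<Rightarrow> real) \<Rightarrow> real" where
  "covariance M X Z = (\<integral>w. (X w - (\<integral>w. X w \<partial>M)) * (Z w - (\<integral>w. Z w \<partial>M)) \<partial>M)"

definition Gamma_tr ::
    "'w measure \<Rightarrow> ('w \<Rightarrow> real ^ 'n ^ 'n) \<Rightarrow> real ^ 'n ^ 'n \<Rightarrow> real ^ 'n ^ 'n \<Rightarrow> real" where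
  "Gamma_tr M H A B = covariance M (\<lambda>w. trace (A ** H w)) (\<lambda>w. trace (B ** H w))"

definition Gamma_quad ::
    "'w measure \<Rightarrow> ('w \<Rightarrow> real ^ 'n) \<Rightarrow> real ^ 'n ^ 'n \<Rightarrow> real ^ 'n ^ 'n \<Rightarrow> real" where
  "Gamma_quad M Y A B = covariance M (\<lambda>w. Y w \<bullet> (A *v Y w)) (\<lambda>w. Y w \<bullet> (B *v Y w))"

definition T_form ::
    "'w measure \<Rightarrow> ('w \<Rightarrow> real ^ 'n) \<Rightarrow> ('w \<Rightarrow> real ^ 'n ^ 'n) \<Rightarrow>
      real ^ 'n ^ 'n \<Rightarrow> real ^ 'n ^ 'n \<Rightarrow> real" where
  "T_form M Y H A B = (\<integral>w. (A *v Y w) \<bullet> (H w *v (B *v Y w)) \<partial>M)"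

definition U_form ::
    "'w measure \<Rightarrow> ('w \<Rightarrow> real ^ 'n ^ 'n) \<Rightarrow> real ^ 'n ^ 'n \<Rightarrow> real ^ 'n ^ 'n \<Rightarrow> real" where
  "U_form M H A B = (\<integral>w. trace (A ** H w ** B ** H w) \<partial>M)"

definition D_form ::
    "'w measure \<Rightarrow> ('w \<Rightarrow> real ^ 'n) \<Rightarrow> ('w \<Rightarrow> real ^ 'n ^ 'n) \<Rightarrow>
      real ^ 'n ^ 'n \<Rightarrow> real ^ 'n ^ 'n \<Rightarrow> real" where
  "D_form M Y H A B = 4 * T_form M Y H A B - Gamma_quad M Y A B"

text \<open>Finiteness of all expectations entering the four forms, so that the (total) integrals above
  have their usual meaning.\<close>

definition forms_well_defined ::
    "'w measure \<Rightarrow> ('w \<Rightarrow> real ^ 'n) \<Rightarrow> ('w \<Rightarrow> real ^ 'n ^ 'n) \<Rightarrow>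
      real ^ 'n ^ 'n \<Rightarrow> real ^ 'n ^ 'n \<Rightarrow> bool" where
  "forms_well_defined M Y H A B \<longleftrightarrow>
     integrable M (\<lambda>w. trace (A ** H w)) \<and> integrable M (\<lambda>w. trace (B ** H w)) \<and>
     integrable M (\<lambda>w. trace (A ** H w) * trace (B ** H w)) \<and>
     integrable M (\<lambda>w. Y w \<bullet> (A *v Y w)) \<and> integrable M (\<lambda>w. Y w \<bullet> (B *v Y w)) \<and>
     integrable M (\<lambda>w. (Y w \<bullet> (A *v Y w)) * (Y w \<bullet> (B *v Y w))) \<and>
     integrable M (\<lambda>w. (A *v Y w) \<bullet> (H w *v (B *v Y w))) \<and>
     integrable M (\<lambda>w. trace (A ** H w ** B ** H w))"

end

theory Submission
  imports Defs
begin

text \<open>Write \<open>H = \<nabla>\<^sup>2\<psi>\<close>. The covariance identity is integration by parts against \<open>e\<^sup>-\<^sup>\<psi>\<close>: the third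
  derivatives cancel in the divergence of \<open>e\<^sup>-\<^sup>\<psi> (\<psi>\<^sub>i \<psi>\<^sub>k\<^sub>l e\<^sub>j - \<psi>\<^sub>i \<psi>\<^sub>j\<^sub>k e\<^sub>l)\<close>, which turns
  \<open>E \<psi>\<^sub>i\<^sub>j \<psi>\<^sub>k\<^sub>l\<close> into \<open>E \<psi>\<^sub>i\<^sub>l \<psi>\<^sub>j\<^sub>k\<close> and terms with a single factor \<open>H\<close>; a second integration by parts
  handles the latter. The nonnegativity of \<open>D\<close> is the Brascamp-Lieb inequality
  \<open>Var q(\<nabla>\<psi>) \<le> E \<nabla>q \<bullet> H \<nabla>q\<close> for quadratic \<open>q\<close>, obtained from the second-order expansion of the
  Prekopa-Leindler inequality.

  Both parts need that \<open>H\<close> is square integrable, which is where the log-concavity of the target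
  enters. The second difference \<open>Q\<close> of \<open>\<psi>\<close> in a direction is a bounded subsolution of the
  diffusion operator of the Riemannian metric \<open>H\<close>, by the Monge-Ampere equation and the convexity
  of \<open>V\<close>. Energy estimates for \<open>Q\<close>, uniform in the step, bound the third moment of the difference
  quotient, and Fatou's lemma passes to the limit. The cutoff errors in the energy estimates, and in
  the Brascamp-Lieb inequality, vanish because the metric is parabolic: the energy of a Euclidean
  cutoff at radius \<open>N\<close> is an integral of the cofactor matrix of \<open>H\<close>, hence of order \<open>1/N\<close> since
  \<open>det (H + I/N)\<close> integrates to the volume of the image of a map that is bounded on the ball of
  radius \<open>N\<close>.\<close>

section \<open>Symmetric matrices\<close>

text \<open>The obstacle is at infinity. Since the gradient of \<psi> is bounded,
  \<open>\<theta> \<bullet> (H x *v \<theta>)\<close> has a finite integral along every line in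
  direction \<theta>. So \<open>H\<close> has no positive lower bound, and the dual norm
  \<open>costar\<close>, built from its inverse, is unbounded. A cutoff that is flat in the
  Euclidean sense need not be flat in the metric; only its total energy is controlled, and whatever
  multiplies its gradient must be bounded. This is why the estimates use finite differences of
  \<psi>, bounded for each fixed step, in place of second derivatives. With differences the
  Monge-Ampere equation enters through the concavity of ln det and is never differentiated.

  The estimates close because E Q^3 is at most a constant times \<epsilon>^2 E Q^2. As E Q^3 is
  finite for bounded Q, half of it can be absorbed, and the third moment of Q / \<epsilon>^2 is
  bounded independently of \<epsilon>.

  Third derivatives are never shown to be integrable, so the divergence theorem asks only for
  integrable fields and an integrable total divergence.\<close>

lemma quadratic_nonpos_imp_zero:
  fixes a c :: real
  assumes "a \<ge> 0" "\<And>t. 2 * t * a + t\<^sup>2 * c \<le> 0"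
  shows "a = 0"
proof (rule ccontr)
  assume "a \<noteq> 0"
  with assms have a: "a > 0" by simp
  \<comment> \<open>So small that the quadratic term cannot outweigh the linear one; the summand 1
    covers \<open>c = 0\<close>.\<close>
  define t where "t = a / (\<bar>c\<bar> + 1)"
  have t: "t > 0" using a by (simp add: t_def)
  have "2 * a + t * c > 0"
  proof -
    have "t * \<bar>c\<bar> \<le> a" using a by (simp add: t_def field_simps)
    moreover have "- (t * \<bar>c\<bar>) \<le> t * c" using t by (simp add: abs_if)
    ultimately show ?thesis using a by linarith
  qed
  then have "0 < t * (2 * a + t * c)" using t by simp
  then show False using assms(2)[of t] by (simp add: algebra_simps power2_eq_square)
qed

lemma symmetric_matrix_entry:
  fixes A :: "'a^'n^'n"
  assumes "transpose A = A"
  shows "A $ i $ j = A $ j $ i"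
proof -
  have "transpose A $ i $ j = A $ i $ j" using assms by simp
  then show ?thesis by (simp add: transpose_def)
qed

lemma symmetric_matrix_inner:
  fixes A :: "real^'n^'n"
  assumes "transpose A = A"
  shows "(A *v x) \<bullet> y = x \<bullet> (A *v y)"
  using assms by (metis dot_lmul_matrix transpose_matrix_vector)

text \<open>A maximiser \<open>v\<close> of the quadratic form on the unit sphere of
  \<open>S\<close> is an eigenvector: moving from \<open>v\<close> along its residual
  \<open>w\<close> keeps the form below \<open>l\<close> times the squared norm, so the first
  variation, a multiple of \<open>w \<bullet> w\<close>, vanishes. Working inside an invariant
  subspace allows the search to go on in the orthogonal complement of eigenvectors already
  found.\<close>

lemma symmetric_matrix_eigenvector_in_subspace:
  fixes A :: "real^'n^'n"
  assumes sym: "transpose A = A" and S: "subspace S" and nz: "S \<noteq> {0}"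
    and inv: "\<And>x. x \<in> S \<Longrightarrow> A *v x \<in> S"
  obtains v l where "v \<in> S" "norm v = 1" "A *v v = l *\<^sub>R v"
proof -
  let ?C = "sphere 0 1 \<inter> S"
  have comp: "compact ?C" using S by (intro compact_Int_closed) (auto intro: closed_subspace)
  obtain x where x: "x \<in> S" "x \<noteq> 0" using nz S subspace_0 by blast
  have "(1 / norm x) *\<^sub>R x \<in> ?C" using x S by (auto intro: subspace_scale)
  then have ne: "?C \<noteq> {}" by blast
  have "continuous_on ?C (\<lambda>x. x \<bullet> (A *v x))" by (intro continuous_intros linear_continuous_on) simp
  from continuous_attains_sup[OF comp ne this] obtain v where
    v: "v \<in> ?C" and mx: "\<And>y. y \<in> ?C \<Longrightarrow> y \<bullet> (A *v y) \<le> v \<bullet> (A *v v)" by blast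
  define l where "l = v \<bullet> (A *v v)"
  have vS: "v \<in> S" and nv: "norm v = 1" using v by auto
  have vv: "v \<bullet> v = 1" using nv by (simp add: norm_eq_1)
  have bnd: "x \<bullet> (A *v x) \<le> l * (x \<bullet> x)" if "x \<in> S" for x
  proof (cases "x = 0")
    case False
    define u where "u = (1 / norm x) *\<^sub>R x"
    have "u \<in> ?C" using that False S by (auto simp: u_def intro: subspace_scale)
    then have "u \<bullet> (A *v u) \<le> l" using mx l_def by simp
    moreover have "u \<bullet> (A *v u) = (x \<bullet> (A *v x)) / (x \<bullet> x)"
      using False by (simp add: u_def matrix_vector_mult_scaleR power2_norm_eq_inner[symmetric] power2_eq_square)
    ultimately show ?thesis using False by (simp add: divide_le_eq)
  qed simp
  define w where "w = A *v v - l *\<^sub>R v"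
  have wS: "w \<in> S" using inv[OF vS] vS S by (auto simp: w_def intro: subspace_diff subspace_scale)
  have "w \<bullet> w = 0"
  proof (rule quadratic_nonpos_imp_zero[where c = "w \<bullet> (A *v w) - l * (w \<bullet> w)"])
    fix t :: real
    have "v + t *\<^sub>R w \<in> S" using vS wS S by (auto intro: subspace_add subspace_scale)
    from bnd[OF this]
    have "l + t * (v \<bullet> (A *v w)) + t * (w \<bullet> (A *v v)) + t * t * (w \<bullet> (A *v w))
       \<le> l * (1 + 2 * t * (v \<bullet> w) + t * t * (w \<bullet> w))"
      by (simp add: matrix_vector_right_distrib matrix_vector_mult_scaleR inner_add_left inner_add_right
          l_def[symmetric] vv algebra_simps inner_commute[of w v])
    moreover have "v \<bullet> (A *v w) = w \<bullet> (A *v v)"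
      using symmetric_matrix_inner[OF sym, of v w] by (simp add: inner_commute)
    moreover have "w \<bullet> (A *v v) = w \<bullet> w + l * (v \<bullet> w)"
    proof -
      have "A *v v = w + l *\<^sub>R v" by (simp add: w_def)
      then have "w \<bullet> (A *v v) = w \<bullet> (w + l *\<^sub>R v)" by simp
      then show ?thesis by (simp only: inner_add_right inner_scaleR_right inner_commute[of w v])
    qed
    ultimately show "2 * t * (w \<bullet> w) + t\<^sup>2 * (w \<bullet> (A *v w) - l * (w \<bullet> w)) \<le> 0"
      by (simp add: algebra_simps power2_eq_square)
  qed simp
  then have "A *v v = l *\<^sub>R v" by (simp add: w_def)
  with vS nv that show ?thesis by blast
qed

lemma nat_max_exists:
  fixes P :: "nat \<Rightarrow> bool"
  assumes "P k0" "\<And>j. P j \<Longrightarrow> j \<le> b"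
  shows "\<exists>k. P k \<and> (\<forall>j. P j \<longrightarrow> j \<le> k)"
  using assms by (metis GreatestI_nat Greatest_le_nat)

text \<open>A largest orthonormal set of eigenvectors spans: its orthogonal complement is invariant
  because \<open>A\<close> is symmetric, and a nonzero complement would supply one more
  eigenvector.\<close>

lemma symmetric_matrix_eigenbasis:
  fixes A :: "real^'n^'n"
  assumes sym: "transpose A = A"
  obtains B where "pairwise orthogonal B" "\<And>v. v \<in> B \<Longrightarrow> norm v = 1 \<and> (\<exists>l. A *v v = l *\<^sub>R v)"
    "finite B" "card B = CARD('n)"
proof -
  define good where "good B \<longleftrightarrow> finite B \<and> pairwise orthogonal B \<and>
      (\<forall>v\<in>B. norm v = 1 \<and> (\<exists>l. A *v v = l *\<^sub>R v))" for B
  have ind: "independent B" if "good B" for B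
    using that by (intro pairwise_orthogonal_independent) (auto simp: good_def)
  have "\<exists>k. (\<exists>B. good B \<and> card B = k) \<and> (\<forall>j. (\<exists>B. good B \<and> card B = j) \<longrightarrow> j \<le> k)"
  proof (rule nat_max_exists)
    show "\<exists>B. good B \<and> card B = 0" by (rule exI[of _ "{}"]) (simp add: good_def)
    fix j assume "\<exists>B. good B \<and> card B = j"
    then obtain B where "good B" "card B = j" by blast
    with ind[of B] independent_bound[of B] show "j \<le> DIM(real^'n)" by simp
  qed
  then obtain B where B: "good B" and mx: "\<And>B'. good B' \<Longrightarrow> card B' \<le> card B" by blast
  have spanB: "span B = UNIV"
  proof (rule ccontr)
    assume ns: "span B \<noteq> UNIV"
    define S where "S = {x. \<forall>b\<in>B. b \<bullet> x = 0}"
    have sS: "subspace S" by (auto simp: S_def subspace_def inner_add_right)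
    have "span B \<subset> span UNIV" using ns by (auto simp: span_UNIV)
    from orthogonal_to_subspace_exists_gen[OF this]
    obtain x where "x \<noteq> 0" "\<And>y. y \<in> span B \<Longrightarrow> orthogonal x y" by blast
    then have "x \<in> S" "x \<noteq> 0" by (auto simp: S_def orthogonal_def inner_commute span_base)
    then have "S \<noteq> {0}" by blast
    moreover have "A *v x \<in> S" if "x \<in> S" for x
    proof -
      { fix b assume b: "b \<in> B"
        then obtain l where "A *v b = l *\<^sub>R b" using B by (auto simp: good_def)
        then have "b \<bullet> (A *v x) = 0"
          using that b symmetric_matrix_inner[OF sym, of b x] by (simp add: S_def) }
      then show ?thesis by (simp add: S_def)
    qed
    ultimately obtain v l where v: "v \<in> S" "norm v = 1" "A *v v = l *\<^sub>R v"
      using symmetric_matrix_eigenvector_in_subspace[OF sym sS] by metis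
    have nvB: "v \<notin> B" using v by (auto simp: S_def)
    have "good (insert v B)"
      using B v by (auto simp: good_def pairwise_insert orthogonal_def S_def inner_commute)
    from mx[OF this] nvB B show False by (simp add: good_def)
  qed
  have "card B = dim (span B)" using ind[OF B] by (simp add: dim_span_eq_card_independent dim_eq_card_independent)
  then have "card B = CARD('n)" by (simp add: spanB dim_UNIV)
  with B that show ?thesis by (auto simp: good_def)
qed

section \<open>Diagonalisation of symmetric matrices\<close>

definition diag_matrix :: "('n \<Rightarrow> real) \<Rightarrow> real^'n^'n" where
  "diag_matrix l = (\<chi> i j. if i = j then l j else 0)"

lemma transpose_diag_matrix [simp]: "transpose (diag_matrix l) = diag_matrix l"
  by (simp add: diag_matrix_def transpose_def vec_eq_iff)

lemma diag_matrix_mult: "diag_matrix a ** diag_matrix b = diag_matrix (\<lambda>i. a i * b i)"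
  by (simp add: diag_matrix_def matrix_matrix_mult_def vec_eq_iff if_distrib[of "\<lambda>x. x * _"] sum.delta cong: if_cong)

lemma diag_matrix_one: "diag_matrix (\<lambda>i. 1) = mat 1"
  by (simp add: diag_matrix_def mat_def)

lemma diag_matrix_add: "diag_matrix a + diag_matrix b = diag_matrix (\<lambda>i. a i + b i)"
  by (simp add: diag_matrix_def vec_eq_iff)

lemma diag_matrix_const: "diag_matrix (\<lambda>i. c) = c *\<^sub>R mat 1"
  by (simp add: diag_matrix_def mat_def vec_eq_iff)

lemma det_diag_matrix: "det (diag_matrix l) = (\<Prod>i\<in>UNIV. l i)"
  by (subst det_diagonal) (auto simp: diag_matrix_def)

lemma trace_diag_matrix: "trace (diag_matrix l) = (\<Sum>i\<in>UNIV. l i)"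
  by (simp add: diag_matrix_def trace_def)

lemma inner_diag_matrix: "v \<bullet> (diag_matrix l *v v) = (\<Sum>i\<in>UNIV. l i * (v $ i)\<^sup>2)"
  by (simp add: diag_matrix_def inner_vec_def matrix_vector_mult_def if_distrib[of "\<lambda>x. x * _"] sum.delta
      power2_eq_square cong: if_cong) (simp add: mult_ac)

lemma matrix_scaleR_right: "A ** (c *\<^sub>R B) = c *\<^sub>R (A ** B)" for A :: "real^'n^'m"
  by (simp add: matrix_matrix_mult_def vec_eq_iff sum_distrib_left mult_ac)

lemma scaleR_matrix_mult: "(c *\<^sub>R A) ** B = c *\<^sub>R (A ** B)" for A :: "real^'n^'m"
  by (simp add: matrix_matrix_mult_def vec_eq_iff sum_distrib_left mult_ac)

lemma matrix_mult_add_rdistrib: "(A + B) ** C = A ** C + B ** C" for A B :: "real^'n^'m"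
  by (simp add: matrix_matrix_mult_def vec_eq_iff sum.distrib distrib_right)

lemma spectral_theorem_symmetric:
  fixes A :: "real^'n^'n"
  assumes sym: "transpose A = A"
  obtains P :: "real^'n^'n" and l where "transpose P ** P = mat 1" "P ** transpose P = mat 1"
    "A = P ** diag_matrix l ** transpose P"
proof -
  obtain B where B: "pairwise orthogonal B" "\<And>v. v \<in> B \<Longrightarrow> norm v = 1 \<and> (\<exists>l. A *v v = l *\<^sub>R v)"
    "finite B" "card B = CARD('n)" using symmetric_matrix_eigenbasis[OF sym] by metis
  obtain b where b: "bij_betw b (UNIV :: 'n set) B"
    using B finite_same_card_bij[of "UNIV :: 'n set" B] by auto
  have bB: "b i \<in> B" for i using b by (auto simp: bij_betw_def)
  have "\<forall>i. \<exists>l. A *v b i = l *\<^sub>R b i" using B(2)[OF bB] by blast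
  from choice[OF this] obtain l where l: "\<And>i. A *v b i = l i *\<^sub>R b i" by blast
  define P where "P = (\<chi> i j. b j $ i)"
  have inn: "b i \<bullet> b j = (if i = j then 1 else 0)" for i j
  proof (cases "i = j")
    case True
    have "norm (b i) = 1" using B(2)[OF bB] by blast
    then have "b i \<bullet> b i = 1" by (simp only: norm_eq_1)
    then show ?thesis using True by simp
  next
    case False
    then have "b i \<noteq> b j" using b by (meson UNIV_I bij_betw_def inj_onD)
    then have "orthogonal (b i) (b j)" using B(1) bB by (meson pairwiseD)
    then show ?thesis using False by (simp add: orthogonal_def)
  qed
  have 1: "transpose P ** P = mat 1"
    unfolding P_def transpose_def matrix_matrix_mult_def mat_def vec_eq_iff using inn by (simp add: inner_vec_def)
  then have 2: "P ** transpose P = mat 1" by (simp add: matrix_left_right_inverse)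
  have "A ** P = P ** diag_matrix l"
  proof -
    have "(A ** P) $ i $ j = (A *v b j) $ i" for i j
      by (simp add: P_def matrix_matrix_mult_def matrix_vector_mult_def)
    moreover have "(P ** diag_matrix l) $ i $ j = (l j *\<^sub>R b j) $ i" for i j
      by (simp add: P_def matrix_matrix_mult_def diag_matrix_def if_distrib[of "\<lambda>x. _ * x"] sum.delta cong: if_cong)
    ultimately show ?thesis by (simp add: vec_eq_iff l)
  qed
  then have "A ** (P ** transpose P) = P ** diag_matrix l ** transpose P"
    by (simp add: matrix_mul_assoc)
  then have "A = P ** diag_matrix l ** transpose P" using 2 by simp
  with 1 2 that show ?thesis by blast
qed

section \<open>Positive definite matrices and inequalities for their determinants\<close>

definition pos_def :: "real^'n^'n \<Rightarrow> bool" where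
  "pos_def A \<longleftrightarrow> transpose A = A \<and> (\<forall>v. v \<noteq> 0 \<longrightarrow> 0 < v \<bullet> (A *v v))"

lemma spectral_theorem_pos_def:
  fixes A :: "real^'n^'n"
  assumes "pos_def A"
  obtains P :: "real^'n^'n" and l where "transpose P ** P = mat 1" "P ** transpose P = mat 1"
    "A = P ** diag_matrix l ** transpose P" "\<And>i. 0 < l i"
proof -
  obtain P :: "real^'n^'n" and l where P: "transpose P ** P = mat 1" "P ** transpose P = mat 1"
    "A = P ** diag_matrix l ** transpose P"
    using spectral_theorem_symmetric assms unfolding pos_def_def by metis
  have "0 < l i" for i
  proof -
    define v where "v = P *v axis i 1"
    have pv: "transpose P *v v = axis i 1"
      unfolding v_def matrix_vector_mul_assoc P(1) by simp
    then have "v \<noteq> 0" by auto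
    then have "0 < v \<bullet> (A *v v)" using assms by (simp add: pos_def_def)
    also have "A *v v = P *v (diag_matrix l *v (transpose P *v v))"
      unfolding P(3) by (simp only: matrix_vector_mul_assoc matrix_mul_assoc)
    also have "v \<bullet> \<dots> = (transpose P *v v) \<bullet> (diag_matrix l *v (transpose P *v v))"
      by (simp add: dot_lmul_matrix)
    also have "\<dots> = l i"
      unfolding pv inner_diag_matrix by (simp add: axis_def if_distrib[of "\<lambda>x. x^2"] if_distrib[of "\<lambda>x. _ * x"] sum.delta cong: if_cong)
    finally show ?thesis .
  qed
  then show ?thesis by (rule that[OF P])
qed

lemma det_orthogonal_conj:
  fixes P :: "real^'n^'n"
  assumes "transpose P ** P = mat 1"
  shows "det (P ** D ** transpose P) = det D"
proof -
  have "det (transpose P) * det P = 1"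
    using assms by (metis det_mul det_I)
  then show ?thesis by (simp add: det_mul)
qed

lemma trace_orthogonal_conj:
  fixes P :: "real^'n^'n"
  assumes "transpose P ** P = mat 1"
  shows "trace (P ** D ** transpose P) = trace D"
  by (metis assms matrix_mul_assoc matrix_mul_lid trace_mul_sym)

lemma det_pos_def:
  fixes A :: "real^'n^'n"
  assumes "pos_def A" shows "0 < det A"
proof -
  obtain P :: "real^'n^'n" and l where P: "transpose P ** P = mat 1" "A = P ** diag_matrix l ** transpose P" "\<And>i. 0 < l i"
    using spectral_theorem_pos_def[OF assms] by metis
  show ?thesis unfolding P(2) det_orthogonal_conj[OF P(1)] det_diag_matrix by (intro prod_pos ballI P(3))
qed

text \<open>The tangent to the concave function ln det at the identity, read off eigenvalue by
  eigenvalue from \<open>ln x \<le> x - 1\<close>.\<close>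

lemma ln_det_le_trace:
  fixes A :: "real^'n^'n"
  assumes "pos_def A"
  shows "ln (det A) \<le> trace A - real CARD('n)"
proof -
  obtain P :: "real^'n^'n" and l where P: "transpose P ** P = mat 1" "A = P ** diag_matrix l ** transpose P" "\<And>i. 0 < l i"
    using spectral_theorem_pos_def[OF assms] by metis
  have "l i \<noteq> 0" for i using P(3)[of i] by simp
  then have "ln (det A) = (\<Sum>i\<in>UNIV. ln (l i))"
    unfolding P(2) det_orthogonal_conj[OF P(1)] det_diag_matrix by (intro ln_prod) auto
  also have "\<dots> \<le> (\<Sum>i\<in>UNIV. l i - 1)" by (intro sum_mono ln_le_minus_one P(3))
  also have "\<dots> = trace A - real CARD('n)"
    by (simp add: P(1,2) trace_orthogonal_conj trace_diag_matrix sum_subtractf)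
  finally show ?thesis .
qed

lemma pos_def_congruence:
  fixes A R :: "real^'n^'n"
  assumes A: "pos_def A" and R: "transpose R = R" "S ** R = mat 1"
  shows "pos_def (R ** A ** R)"
  unfolding pos_def_def
proof (intro conjI allI impI)
  show "transpose (R ** A ** R) = R ** A ** R"
    using A R by (simp add: pos_def_def matrix_transpose_mul matrix_mul_assoc)
  fix v :: "real^'n" assume "v \<noteq> 0"
  have "R *v v \<noteq> 0"
  proof
    assume "R *v v = 0"
    then have "S *v (R *v v) = 0" by simp
    then show False using \<open>v \<noteq> 0\<close> R(2) by (simp add: matrix_vector_mul_assoc)
  qed
  then have "0 < (R *v v) \<bullet> (A *v (R *v v))" using A by (simp add: pos_def_def)
  also have "\<dots> = v \<bullet> (R *v (A *v (R *v v)))" by (rule symmetric_matrix_inner[OF R(1)])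
  finally show "0 < v \<bullet> (R ** A ** R *v v)" by (simp add: matrix_vector_mul_assoc matrix_mul_assoc)
qed

text \<open>\<open>R\<close> is the inverse square root of \<open>H\<close>, and the square root
  \<open>S\<close> witnesses that \<open>R\<close> is invertible. The purpose is to replace
  \<open>P ** G\<close>, which need not be symmetric, by the symmetric matrix
  \<open>R ** P ** R\<close> of the same trace.\<close>

lemma pos_def_inverse_sqrt:
  fixes H G :: "real^'n^'n"
  assumes H: "pos_def H" and G: "G ** H = mat 1"
  obtains R S where "transpose R = R" "S ** R = mat 1" "R ** R = G"
proof -
  obtain P :: "real^'n^'n" and l where P: "transpose P ** P = mat 1" "P ** transpose P = mat 1"
     "H = P ** diag_matrix l ** transpose P" "\<And>i. 0 < l i"
    using spectral_theorem_pos_def[OF H] by metis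
  define R where "R = P ** diag_matrix (\<lambda>i. 1 / sqrt (l i)) ** transpose P"
  define S where "S = P ** diag_matrix (\<lambda>i. sqrt (l i)) ** transpose P"
  have mul: "(P ** diag_matrix a ** transpose P) ** (P ** diag_matrix b ** transpose P)
      = P ** diag_matrix (\<lambda>i. a i * b i) ** transpose P" for a b
  proof -
    have "(P ** diag_matrix a ** transpose P) ** (P ** diag_matrix b ** transpose P)
       = P ** diag_matrix a ** (transpose P ** P) ** diag_matrix b ** transpose P"
      by (simp only: matrix_mul_assoc)
    then show ?thesis by (simp add: P(1) diag_matrix_mult matrix_mul_assoc[symmetric])
  qed
  have tR: "transpose R = R" by (simp add: R_def matrix_transpose_mul matrix_mul_assoc)
  have sl: "sqrt (l i) \<noteq> 0" for i using P(4)[of i] by simp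
  have SR: "S ** R = mat 1" unfolding R_def S_def mul using sl by (simp add: diag_matrix_one P(2))
  have RRH: "R ** R ** H = mat 1"
  proof -
    have "1 / sqrt (l i) * (1 / sqrt (l i)) * l i = 1" for i using P(4)[of i] by (simp add: field_simps)
    then have "R ** R ** H = P ** diag_matrix (\<lambda>i. 1) ** transpose P"
      unfolding R_def mul P(3) by presburger
    then show ?thesis by (simp add: diag_matrix_one P(2))
  qed
  have "H ** G = mat 1" using G by (simp add: matrix_left_right_inverse)
  then have "R ** R = G" using RRH by (metis matrix_mul_assoc matrix_mul_lid matrix_mul_rid)
  with tR SR that show ?thesis by blast
qed

text \<open>Concavity of ln det: the right side is the first-order change of ln det from
  \<open>H\<close> to \<open>P\<close>, as \<open>trace (H ** G)\<close> is the dimension.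
  Conjugation by the inverse square root of \<open>H\<close> moves the base point to the
  identity.\<close>

lemma ln_det_diff_le_trace:
  fixes P H G :: "real^'n^'n"
  assumes P: "pos_def P" and H: "pos_def H" and G: "G ** H = mat 1"
  shows "ln (det P) - ln (det H) \<le> trace (P ** G) - real CARD('n)"
proof -
  obtain R S where R: "transpose R = R" "S ** R = mat 1" "R ** R = G"
    using pos_def_inverse_sqrt[OF H G] by metis
  have N: "pos_def (R ** P ** R)" by (rule pos_def_congruence[OF P R(1,2)])
  have "det G * det H = 1" by (metis G det_mul det_I)
  then have dG: "det G = 1 / det H" using det_pos_def[OF H] by (simp add: field_simps)
  have "det (R ** P ** R) = det P * det G" by (simp add: R(3)[symmetric] det_mul)
  then have "ln (det (R ** P ** R)) = ln (det P) - ln (det H)"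
    using det_pos_def[OF H] det_pos_def[OF P] by (simp add: dG ln_div)
  moreover have "trace (R ** P ** R) = trace (P ** G)"
    by (metis R(3) matrix_mul_assoc trace_mul_sym)
  ultimately show ?thesis using ln_det_le_trace[OF N] by simp
qed

text \<open>\<open>det H * (v \<bullet> (G *v v))\<close> is the quadratic form of the cofactor
  matrix. In an eigenbasis its coefficients are products of all eigenvalues but one. Supplying the
  missing factor through \<open>t \<le> l k + t\<close> bounds each of them by the determinant of
  \<open>H + t *\<^sub>R mat 1\<close>, which is a Jacobian and can be integrated.\<close>

lemma det_mult_inverse_form_le:
  fixes H G :: "real^'n^'n"
  assumes H: "pos_def H" and G: "G ** H = mat 1" and t: "0 \<le> t"
  shows "t * det H * (v \<bullet> (G *v v)) \<le> (norm v)\<^sup>2 * det (H + t *\<^sub>R mat 1)"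
proof -
  obtain P :: "real^'n^'n" and l where P: "transpose P ** P = mat 1" "P ** transpose P = mat 1"
     "H = P ** diag_matrix l ** transpose P" "\<And>i. 0 < l i"
    using spectral_theorem_pos_def[OF H] by metis
  have Ht: "H + t *\<^sub>R mat 1 = P ** diag_matrix (\<lambda>i. l i + t) ** transpose P"
  proof -
    have "P ** diag_matrix (\<lambda>i. t) ** transpose P = t *\<^sub>R mat 1"
      by (simp add: diag_matrix_const matrix_scaleR_right scaleR_matrix_mult P(2))
    moreover have "P ** diag_matrix (\<lambda>i. l i + t) ** transpose P
        = P ** diag_matrix l ** transpose P + P ** diag_matrix (\<lambda>i. t) ** transpose P"
      by (simp add: diag_matrix_add[symmetric] matrix_add_ldistrib matrix_mult_add_rdistrib)
    ultimately show ?thesis using P(3) by simp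
  qed
  define c where "c = transpose P *v v"
  have GG: "G = P ** diag_matrix (\<lambda>i. 1 / l i) ** transpose P"
  proof -
    have "H ** (P ** diag_matrix (\<lambda>i. 1 / l i) ** transpose P)
      = P ** diag_matrix l ** (transpose P ** P) ** diag_matrix (\<lambda>i. 1 / l i) ** transpose P"
      unfolding P(3) by (simp only: matrix_mul_assoc)
    also have "\<dots> = P ** (diag_matrix l ** diag_matrix (\<lambda>i. 1 / l i)) ** transpose P"
      by (simp add: P(1) matrix_mul_assoc)
    also have "\<dots> = mat 1" using P(4) by (simp add: diag_matrix_mult diag_matrix_one P(2) less_imp_neq[symmetric])
    finally show ?thesis using G by (metis matrix_mul_assoc matrix_mul_lid matrix_mul_rid)
  qed
  have "v \<bullet> (G *v v) = c \<bullet> (diag_matrix (\<lambda>i. 1 / l i) *v c)"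
  proof -
    have "G *v v = P *v (diag_matrix (\<lambda>i. 1 / l i) *v c)"
      unfolding GG c_def by (simp only: matrix_vector_mul_assoc matrix_mul_assoc)
    then show ?thesis by (simp add: dot_lmul_matrix c_def)
  qed
  then have vG: "v \<bullet> (G *v v) = (\<Sum>i\<in>UNIV. 1 / l i * (c $ i)\<^sup>2)" by (simp only: inner_diag_matrix)
  have nc: "(norm v)\<^sup>2 = (\<Sum>i\<in>UNIV. (c $ i)\<^sup>2)"
  proof -
    have "c \<bullet> c = v \<bullet> (P *v (transpose P *v v))" by (simp add: dot_lmul_matrix c_def)
    also have "\<dots> = v \<bullet> v" by (simp only: matrix_vector_mul_assoc P(2) matrix_vector_mul_lid)
    finally show ?thesis by (simp add: power2_norm_eq_inner) (simp add: inner_vec_def power2_eq_square)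
  qed
  have k: "t * (\<Prod>i\<in>UNIV. l i) * (1 / l k) \<le> (\<Prod>i\<in>UNIV. l i + t)" for k
  proof -
    have "t * (\<Prod>i\<in>UNIV. l i) * (1 / l k) = t * (\<Prod>i\<in>UNIV - {k}. l i)"
      using P(4)[of k] by (subst prod.remove[of _ k]) auto
    also have "\<dots> \<le> (l k + t) * (\<Prod>i\<in>UNIV - {k}. l i + t)"
      using P(4) t by (intro mult_mono prod_mono prod_nonneg) (auto simp: less_imp_le add_nonneg_nonneg)
    also have "\<dots> = (\<Prod>i\<in>UNIV. l i + t)" by (subst prod.remove[of _ k]) auto
    finally show ?thesis .
  qed
  have "t * det H * (v \<bullet> (G *v v)) = (\<Sum>i\<in>UNIV. t * (\<Prod>i\<in>UNIV. l i) * (1 / l i) * (c $ i)\<^sup>2)"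
    unfolding vG P(3) det_orthogonal_conj[OF P(1)] det_diag_matrix by (simp add: sum_distrib_left mult.assoc)
  also have "\<dots> \<le> (\<Sum>i\<in>UNIV. (\<Prod>i\<in>UNIV. l i + t) * (c $ i)\<^sup>2)"
    by (intro sum_mono mult_right_mono k) auto
  also have "\<dots> = (norm v)\<^sup>2 * det (H + t *\<^sub>R mat 1)"
    unfolding Ht nc det_orthogonal_conj[OF P(1)] det_diag_matrix by (simp add: sum_distrib_left mult.commute)
  finally show ?thesis .
qed

section \<open>Change of variables with a symmetric derivative\<close>

text \<open>The change of variables theorems of the library require a wellordered index type, so a copy of
  the index type is equipped with an arbitrary wellorder. Determinants are transported along it only
  for symmetric matrices, where the spectral theorem avoids comparing signs of permutations.\<close>

typedef 'a wo = "UNIV :: 'a set" morphisms wo_rep wo_abs ..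

lemma bij_wo_rep: "bij wo_rep"
  by (metis UNIV_I bijI' wo_abs_inverse wo_rep_inject)

instance wo :: (finite) finite
proof
  have "finite (range (wo_abs :: 'a \<Rightarrow> 'a wo))" by simp
  moreover have "range (wo_abs :: 'a \<Rightarrow> 'a wo) = UNIV" by (metis wo_rep_inverse surjI)
  ultimately show "finite (UNIV :: 'a wo set)" by simp
qed

definition wo_enum :: "'a::finite wo \<Rightarrow> nat" where
  "wo_enum = (SOME f. inj f)"

lemma inj_wo_enum: "inj wo_enum"
proof -
  have "\<exists>f :: 'a wo \<Rightarrow> nat. inj f"
    using finite_imp_inj_to_nat_seg[of "UNIV :: 'a wo set"] by auto
  then show ?thesis unfolding wo_enum_def by (rule someI_ex)
qed

instantiation wo :: (finite) wellorder
begin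

definition less_eq_wo :: "'a wo \<Rightarrow> 'a wo \<Rightarrow> bool" where
  "less_eq_wo x y \<longleftrightarrow> wo_enum x \<le> wo_enum y"

definition less_wo :: "'a wo \<Rightarrow> 'a wo \<Rightarrow> bool" where
  "less_wo x y \<longleftrightarrow> wo_enum x < wo_enum y"

instance
proof
  fix P :: "'a wo \<Rightarrow> bool" and a
  assume "\<And>x. (\<And>y. y < x \<Longrightarrow> P y) \<Longrightarrow> P x"
  then show "P a" unfolding less_wo_def by (rule measure_induct_rule[of wo_enum])
qed (auto simp: less_eq_wo_def less_wo_def dest: injD[OF inj_wo_enum])

end

section \<open>Reindexing of vectors and matrices\<close>

definition wo_vec :: "real^'n \<Rightarrow> real^('n wo)" where
  "wo_vec x = (\<chi> i. x $ wo_rep i)"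

definition unwo_vec :: "real^('n wo) \<Rightarrow> real^'n" where
  "unwo_vec x = (\<chi> i. x $ wo_abs i)"

definition wo_mat :: "real^'n^'n \<Rightarrow> real^('n wo)^('n wo)" where
  "wo_mat A = (\<chi> i j. A $ wo_rep i $ wo_rep j)"

lemma unwo_wo [simp]: "unwo_vec (wo_vec x) = x"
  by (simp add: wo_vec_def unwo_vec_def wo_abs_inverse)

lemma wo_unwo [simp]: "wo_vec (unwo_vec x) = x"
  by (simp add: wo_vec_def unwo_vec_def wo_rep_inverse)

lemma sum_wo_rep: "(\<Sum>i\<in>UNIV. f (wo_rep i)) = (\<Sum>i\<in>UNIV. f i)"
  by (rule sum.reindex_bij_betw[OF bij_wo_rep])

lemma prod_wo_rep: "(\<Prod>i\<in>UNIV. f (wo_rep i)) = (\<Prod>i\<in>UNIV. f i)"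
  by (rule prod.reindex_bij_betw[OF bij_wo_rep])

lemma bounded_linear_wo_vec: "bounded_linear (wo_vec :: real^'n \<Rightarrow> _)"
  by (rule linear_conv_bounded_linear[THEN iffD1], rule linearI) (auto simp: wo_vec_def vec_eq_iff)

lemma bounded_linear_unwo_vec: "bounded_linear (unwo_vec :: _ \<Rightarrow> real^'n)"
  by (rule linear_conv_bounded_linear[THEN iffD1], rule linearI) (auto simp: unwo_vec_def vec_eq_iff)

lemma wo_mat_mult: "wo_mat (A ** B) = wo_mat A ** wo_mat B"
  by (simp add: wo_mat_def matrix_matrix_mult_def vec_eq_iff sum_wo_rep[of "\<lambda>k. A $ _ $ k * B $ k $ _"])

lemma wo_mat_vec: "wo_mat A *v wo_vec x = wo_vec (A *v x)"
  by (simp add: wo_mat_def wo_vec_def matrix_vector_mult_def vec_eq_iff sum_wo_rep[of "\<lambda>k. A $ _ $ k * x $ k"])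

lemma wo_mat_transpose: "wo_mat (transpose A) = transpose (wo_mat A)"
  by (simp add: wo_mat_def transpose_def)

lemma wo_mat_one: "wo_mat (mat 1) = mat 1"
  by (simp add: wo_mat_def mat_def vec_eq_iff wo_rep_inject)

lemma wo_mat_diag: "wo_mat (diag_matrix l) = diag_matrix (\<lambda>i. l (wo_rep i))"
  by (simp add: wo_mat_def diag_matrix_def vec_eq_iff wo_rep_inject)

lemma det_wo_mat:
  fixes A :: "real^'n^'n"
  assumes "transpose A = A"
  shows "det (wo_mat A) = det A"
proof -
  obtain P :: "real^'n^'n" and l where P: "transpose P ** P = mat 1" "A = P ** diag_matrix l ** transpose P"
    using spectral_theorem_symmetric[OF assms] by metis
  have "transpose (wo_mat P) ** wo_mat P = mat 1"
    by (simp add: wo_mat_transpose[symmetric] wo_mat_mult[symmetric] P(1) wo_mat_one)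
  then have "det (wo_mat A) = det (wo_mat (diag_matrix l))"
    unfolding P(2) wo_mat_mult wo_mat_transpose by (rule det_orthogonal_conj)
  then show ?thesis
    unfolding P(2) det_orthogonal_conj[OF P(1)] by (simp add: wo_mat_diag det_diag_matrix prod_wo_rep)
qed

lemma prod_Basis_cart: "(\<Prod>b\<in>Basis. (x :: real^'n) \<bullet> b) = (\<Prod>i\<in>UNIV. x $ i)"
  by (simp add: Basis_vec_def cart_eq_inner_axis axis_eq_axis prod.UNION_disjoint)

text \<open>Reindexing permutes coordinates, so preimages of boxes are boxes of the same volume, and
  the values on boxes determine Lebesgue measure.\<close>

lemma distr_wo_vec: "distr lborel borel (wo_vec :: real^'n \<Rightarrow> _) = lborel"
proof (rule lborel_eqI[symmetric])
  have m: "(wo_vec :: real^'n \<Rightarrow> _) \<in> borel_measurable borel"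
    by (intro borel_measurable_continuous_onI linear_continuous_on bounded_linear_wo_vec)
  fix l u :: "real^('n wo)" assume lu: "\<And>b. b \<in> Basis \<Longrightarrow> l \<bullet> b \<le> u \<bullet> b"
  have le: "l $ i \<le> u $ i" for i using lu[of "axis i 1"] by (simp add: axis_in_Basis_iff cart_eq_inner_axis)
  have "emeasure (distr lborel borel wo_vec) (box l u) = emeasure lborel (wo_vec -` box l u :: (real^'n) set)"
    using m by (simp add: emeasure_distr)
  also have "(wo_vec -` box l u :: (real^'n) set) = box (unwo_vec l) (unwo_vec u)"
  proof -
    have "(\<forall>i. P (wo_rep i)) \<longleftrightarrow> (\<forall>i. P i)" for P :: "'n \<Rightarrow> bool"
      by (metis bij_pointE bij_wo_rep)
    from this[of "\<lambda>j. l $ wo_abs j < x $ j \<and> x $ j < u $ wo_abs j" for x] show ?thesis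
      by (auto simp: mem_box_cart wo_vec_def unwo_vec_def wo_rep_inverse)
  qed
  also have "emeasure lborel (box (unwo_vec l) (unwo_vec u)) = (\<Prod>b\<in>Basis. (unwo_vec u - unwo_vec l :: real^'n) \<bullet> b)"
    by (rule emeasure_lborel_box)
      (auto simp: Basis_vec_def inner_axis unwo_vec_def le)
  also have "(\<Prod>b\<in>Basis. (unwo_vec u - unwo_vec l :: real^'n) \<bullet> b) = (\<Prod>b\<in>Basis. (u - l) \<bullet> b)"
    unfolding prod_Basis_cart
    by (subst prod_wo_rep[symmetric]) (simp add: unwo_vec_def wo_rep_inverse)
  finally show "emeasure (distr lborel borel wo_vec) (box l u) = (\<Prod>b\<in>Basis. (u - l) \<bullet> b)" .
qed simp

theorem emeasure_image_symmetric_derivative: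
  fixes f :: "real^'n \<Rightarrow> real^'n"
  assumes der: "\<And>x. (f has_derivative (\<lambda>h. J x *v h)) (at x)"
    and sym: "\<And>x. transpose (J x) = J x" and inj: "inj f" and S: "compact S"
    and [measurable]: "(\<lambda>x. det (J x)) \<in> borel_measurable borel"
  shows "emeasure lborel (f ` S) = (\<integral>\<^sup>+x. ennreal \<bar>det (J x)\<bar> * indicator S x \<partial>lborel)"
proof -
  define F where "F = (\<lambda>y. wo_vec (f (unwo_vec y)))"
  define T where "T = (wo_vec ` S :: (real^('n wo)) set)"
  have derF: "(F has_derivative (\<lambda>h. wo_mat (J (unwo_vec y)) *v h)) (at y within T)" for y
  proof -
    have "(F has_derivative (\<lambda>h. wo_vec (J (unwo_vec y) *v unwo_vec h))) (at y)"
      unfolding F_def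
      by (rule bounded_linear.has_derivative[OF bounded_linear_wo_vec])
        (rule has_derivative_compose[OF bounded_linear.has_derivative[OF bounded_linear_unwo_vec has_derivative_ident] der])
    then show ?thesis
      by (simp add: wo_mat_vec[symmetric] has_derivative_at_withinI)
  qed
  have contf: "continuous_on A f" for A
    using der by (meson continuous_at_imp_continuous_on has_derivative_continuous)
  have [measurable]: "(wo_vec :: real^'n \<Rightarrow> _) \<in> borel_measurable borel" "(unwo_vec :: _ \<Rightarrow> real^'n) \<in> borel_measurable borel"
    by (intro borel_measurable_continuous_onI linear_continuous_on bounded_linear_wo_vec bounded_linear_unwo_vec)+
  have cT: "compact T" unfolding T_def
    by (intro compact_continuous_image S linear_continuous_on bounded_linear_wo_vec)
  have FT: "F ` T = wo_vec ` f ` S" by (auto simp: F_def T_def image_image)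
  have cfS: "compact (f ` S)" by (intro compact_continuous_image S contf)
  have cFT: "compact (F ` T)" unfolding FT
    by (intro compact_continuous_image cfS linear_continuous_on bounded_linear_wo_vec)
  have bFT: "F ` T \<in> sets borel" using cFT by (intro borel_closed compact_imp_closed)
  have injF: "inj_on F T"
    unfolding F_def by (rule inj_onI) (metis inj injD unwo_wo wo_unwo)
  have TL: "T \<in> sets lebesgue" using cT by (simp add: lmeasurable_compact fmeasurableD)
  \<comment> \<open>The change of variables theorem is an equivalence in which the value of the
    integral is a parameter. Taking the measure of the compact image for that value makes one side
    trivial.\<close>
  have "F ` T \<in> lmeasurable \<and> measure lebesgue (F ` T) = measure lebesgue (F ` T)"
    using cFT by (simp add: lmeasurable_compact)
  then have "((\<lambda>x. \<bar>det (matrix (\<lambda>h. wo_mat (J (unwo_vec x)) *v h))\<bar>) has_integral measure lebesgue (F ` T)) T"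
    by (rule has_measure_differentiable_image[OF TL derF injF, THEN iffD1])
  then have hi: "((\<lambda>x. \<bar>det (J (unwo_vec x))\<bar>) has_integral measure lebesgue (F ` T)) T"
    by (simp add: det_wo_mat[OF sym])
  have tr: "(\<integral>\<^sup>+x. u (wo_vec x) \<partial>lborel) = (\<integral>\<^sup>+y. u y \<partial>lborel)"
    if "u \<in> borel_measurable borel" for u :: "real^('n wo) \<Rightarrow> ennreal"
    by (subst distr_wo_vec[symmetric]) (use that in \<open>simp add: nn_integral_distr\<close>)
  have bT[measurable]: "T \<in> sets borel" using cT by (simp add: borel_closed compact_imp_closed)
  have "(\<integral>\<^sup>+x. ennreal \<bar>det (J x)\<bar> * indicator S x \<partial>lborel)
     = (\<integral>\<^sup>+x. ennreal \<bar>det (J (unwo_vec (wo_vec x)))\<bar> * indicator T (wo_vec x) \<partial>lborel)"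
  proof (rule nn_integral_cong)
    fix x :: "real^'n"
    have "wo_vec x \<in> T \<longleftrightarrow> x \<in> S" unfolding T_def by (metis image_iff unwo_wo)
    then show "ennreal \<bar>det (J x)\<bar> * indicator S x = ennreal \<bar>det (J (unwo_vec (wo_vec x)))\<bar> * indicator T (wo_vec x)"
      by (simp add: indicator_def)
  qed
  also have "\<dots> = (\<integral>\<^sup>+y. ennreal \<bar>det (J (unwo_vec y))\<bar> * indicator T y \<partial>lborel)"
    by (rule tr) measurable
  also have "\<dots> = ennreal (measure lebesgue (F ` T))"
    by (rule nn_integral_has_integral_lebesgue'[OF _ hi]) simp
  also have "\<dots> = emeasure lebesgue (F ` T)"
    using cFT by (simp add: emeasure_eq_measure2 lmeasurable_compact)
  also have "\<dots> = emeasure lborel (F ` T)"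
    using bFT by (simp add: main_part_sets)
  also have "\<dots> = emeasure (distr lborel borel wo_vec) (F ` T)" by (simp add: distr_wo_vec)
  also have "\<dots> = emeasure lborel (wo_vec -` (F ` T))"
    using bFT by (subst emeasure_distr) auto
  also have "wo_vec -` (F ` T) = f ` S" unfolding FT
    by (auto simp: image_iff) (metis unwo_wo)
  finally show ?thesis by simp
qed

section \<open>The Prekopa-Leindler inequality\<close>

lemma emeasure_affine_preimage:
  fixes A :: "real set"
  assumes "A \<in> sets borel" "c > 0"
  shows "emeasure lborel A = ennreal c * emeasure lborel {x. t + c * x \<in> A}"
proof -
  have "emeasure lborel A = emeasure (density (distr lborel borel (\<lambda>x. t + c * x)) (\<lambda>_. ennreal \<bar>c\<bar>)) A"
    using lborel_real_affine[of c t] assms(2) by simp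
  also have "\<dots> = ennreal c * emeasure (distr lborel borel (\<lambda>x. t + c * x)) A"
    using assms by (subst emeasure_density) (auto simp: nn_integral_cmult)
  also have "emeasure (distr lborel borel (\<lambda>x. t + c * x)) A = emeasure lborel {x. t + c * x \<in> A}"
    using assms by (subst emeasure_distr) (auto simp: vimage_def)
  finally show ?thesis .
qed

text \<open>Up to an error \<open>e\<close>, the translate of \<open>A\<close> by a point near
  \<open>Inf B\<close> and the translate of \<open>B\<close> by a point near \<open>Sup A\<close>
  lie side by side on the line; halved, both fit into \<open>C\<close>.\<close>

lemma brunn_minkowski_real_bounded:
  fixes A B C :: "real set"
  assumes meas: "A \<in> sets borel" "B \<in> sets borel" "C \<in> sets borel"
    and ne: "A \<noteq> {}" "B \<noteq> {}" and bdd: "A \<subseteq> {-r..r}" "B \<subseteq> {-r..r}"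
    and sub: "\<And>x y. x \<in> A \<Longrightarrow> y \<in> B \<Longrightarrow> (x + y) / 2 \<in> C"
  shows "emeasure lborel A + emeasure lborel B \<le> 2 * emeasure lborel C"
proof (rule ennreal_le_epsilon)
  fix e :: real assume e: "0 < e"
  have bA: "bdd_above A" using bdd(1) by (meson bdd_above_Icc bdd_above_mono)
  have bB: "bdd_below B" using bdd(2) by (meson bdd_below_Icc bdd_below_mono)
  \<comment> \<open>The extrema need not be attained. Points within \<open>e/2\<close> of them cost
    at most an interval of length \<open>e/2\<close> in each set.\<close>
  obtain a where a: "a \<in> A" "Sup A - e/2 < a"
    using less_cSup_iff[OF ne(1) bA, of "Sup A - e/2"] e by auto
  obtain b where b: "b \<in> B" "b < Inf B + e/2"
    using cInf_less_iff[OF ne(2) bB, of "Inf B + e/2"] e by auto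
  have aA: "x \<le> a + e/2" if "x \<in> A" for x using cSup_upper[OF that bA] a(2) by linarith
  have bB': "b - e/2 \<le> x" if "x \<in> B" for x using cInf_lower[OF that bB] b(2) by linarith
  have lA: "emeasure lborel A \<le> emeasure lborel (A \<inter> {..<a}) + e/2"
  proof -
    have "A \<subseteq> (A \<inter> {..<a}) \<union> {a..a + e/2}" using aA by force
    then have "emeasure lborel A \<le> emeasure lborel ((A \<inter> {..<a}) \<union> {a..a + e/2})"
      using meas by (intro emeasure_mono) auto
    also have "\<dots> \<le> emeasure lborel (A \<inter> {..<a}) + emeasure lborel {a..a + e/2}"
      using meas by (intro emeasure_subadditive) auto
    also have "emeasure lborel {a..a + e/2} = e/2" using e by simp
    finally show ?thesis .
  qed
  have lB: "emeasure lborel B \<le> emeasure lborel (B \<inter> {b..}) + e/2"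
  proof -
    have "B \<subseteq> (B \<inter> {b..}) \<union> {b - e/2..b}" using bB' by force
    then have "emeasure lborel B \<le> emeasure lborel ((B \<inter> {b..}) \<union> {b - e/2..b})"
      using meas by (intro emeasure_mono) auto
    also have "\<dots> \<le> emeasure lborel (B \<inter> {b..}) + emeasure lborel {b - e/2..b}"
      using meas by (intro emeasure_subadditive) auto
    also have "emeasure lborel {b - e/2..b} = e/2" using e by simp
    finally show ?thesis .
  qed
  \<comment> \<open>Midpoints of \<open>A\<close> with the fixed \<open>b\<close>, and below
    midpoints of \<open>B\<close> with the fixed \<open>a\<close>: the former lie to the left of
    \<open>(a + b) / 2\<close>, the latter at or to the right of it, so the two sets are
    disjoint.\<close>
  define A1 where "A1 = {x. - b + 2 * x \<in> A \<inter> {..<a}}"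
  define B1 where "B1 = {x. - a + 2 * x \<in> B \<inter> {b..}}"
  have mA1: "A1 \<in> sets borel"
  proof -
    have "(\<lambda>x. - b + 2 * x) -` (A \<inter> {..<a}) \<inter> space borel \<in> sets borel"
      using meas by (intro measurable_sets[of _ _ borel]) auto
    then show ?thesis by (simp add: A1_def vimage_def)
  qed
  have mB1: "B1 \<in> sets borel"
  proof -
    have "(\<lambda>x. - a + 2 * x) -` (B \<inter> {b..}) \<inter> space borel \<in> sets borel"
      using meas by (intro measurable_sets[of _ _ borel]) auto
    then show ?thesis by (simp add: B1_def vimage_def)
  qed
  have "A1 \<union> B1 \<subseteq> C"
  proof
    fix x assume "x \<in> A1 \<union> B1"
    then show "x \<in> C"
    proof
      assume "x \<in> A1" then show ?thesis using sub[of "- b + 2 * x" b] b by (simp add: A1_def)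
    next
      assume "x \<in> B1" then show ?thesis using sub[of a "- a + 2 * x"] a by (simp add: B1_def)
    qed
  qed
  then have "emeasure lborel (A1 \<union> B1) \<le> emeasure lborel C" using meas by (intro emeasure_mono) auto
  moreover have "emeasure lborel (A1 \<union> B1) = emeasure lborel A1 + emeasure lborel B1"
    using mA1 mB1 by (intro plus_emeasure[symmetric]) (auto simp: A1_def B1_def)
  ultimately have "2 * emeasure lborel A1 + 2 * emeasure lborel B1 \<le> 2 * emeasure lborel C"
    by (metis distrib_left mult_left_mono zero_le)
  moreover have "emeasure lborel (A \<inter> {..<a}) = 2 * emeasure lborel A1"
    using emeasure_affine_preimage[of "A \<inter> {..<a}" 2 "-b"] meas by (simp add: A1_def)
  moreover have "emeasure lborel (B \<inter> {b..}) = 2 * emeasure lborel B1"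
    using emeasure_affine_preimage[of "B \<inter> {b..}" 2 "-a"] meas by (simp add: B1_def)
  ultimately have "emeasure lborel (A \<inter> {..<a}) + emeasure lborel (B \<inter> {b..}) \<le> 2 * emeasure lborel C" by simp
  note le = this
  have "emeasure lborel A + emeasure lborel B
      \<le> (emeasure lborel (A \<inter> {..<a}) + ennreal (e/2)) + (emeasure lborel (B \<inter> {b..}) + ennreal (e/2))"
    by (rule add_mono[OF lA lB])
  also have "\<dots> = (emeasure lborel (A \<inter> {..<a}) + emeasure lborel (B \<inter> {b..})) + (ennreal (e/2) + ennreal (e/2))"
    by (simp only: ac_simps)
  also have "\<dots> \<le> 2 * emeasure lborel C + (ennreal (e/2) + ennreal (e/2))"
    by (rule add_right_mono[OF le])
  also have "ennreal (e/2) + ennreal (e/2) = ennreal e" using e by (simp flip: ennreal_plus)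
  finally show "emeasure lborel A + emeasure lborel B \<le> 2 * emeasure lborel C + ennreal e" .
qed

lemma brunn_minkowski_real:
  fixes A B C :: "real set"
  assumes meas: "A \<in> sets borel" "B \<in> sets borel" "C \<in> sets borel"
    and ne: "A \<noteq> {}" "B \<noteq> {}"
    and sub: "\<And>x y. x \<in> A \<Longrightarrow> y \<in> B \<Longrightarrow> (x + y) / 2 \<in> C"
  shows "emeasure lborel A + emeasure lborel B \<le> 2 * emeasure lborel C"
proof -
  obtain x y where xy: "x \<in> A" "y \<in> B" using ne by blast
  \<comment> \<open>The offset keeps \<open>x\<close> and \<open>y\<close> in every truncation,
    which must be nonempty already for \<open>n = 0\<close>.\<close>
  define r where "r n = \<bar>x\<bar> + \<bar>y\<bar> + real n" for n
  have UN: "(\<Union>n. D \<inter> {- r n..r n}) = D" for D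
  proof -
    have "\<exists>n. z \<in> {- r n..r n}" for z
    proof -
      obtain n where "\<bar>z\<bar> < real n" using reals_Archimedean2 by blast
      then show ?thesis by (intro exI[of _ n]) (auto simp: r_def)
    qed
    then show ?thesis by auto
  qed
  have inc: "incseq (\<lambda>n. D \<inter> {- r n..r n})" for D by (rule incseq_SucI) (auto simp: r_def)
  have lim: "(\<lambda>n. emeasure lborel (D \<inter> {- r n..r n})) \<longlonglongrightarrow> emeasure lborel D" if "D \<in> sets borel" for D
  proof -
    have "range (\<lambda>n. D \<inter> {- r n..r n}) \<subseteq> sets lborel" using that by (auto intro: sets.Int)
    from Lim_emeasure_incseq[OF this inc[of D]] show ?thesis unfolding UN .
  qed
  have "(\<lambda>n. emeasure lborel (A \<inter> {- r n..r n}) + emeasure lborel (B \<inter> {- r n..r n}))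
     \<longlonglongrightarrow> emeasure lborel A + emeasure lborel B"
    using meas by (intro tendsto_add lim)
  then show ?thesis
  proof (rule Lim_bounded[where M = 0], intro allI impI)
    fix n :: nat
    show "emeasure lborel (A \<inter> {- r n..r n}) + emeasure lborel (B \<inter> {- r n..r n}) \<le> 2 * emeasure lborel C"
    proof (rule brunn_minkowski_real_bounded[where r = "r n"])
      have "x \<in> A \<inter> {- r n..r n}" "y \<in> B \<inter> {- r n..r n}" using xy by (auto simp: r_def)
      then show "A \<inter> {- r n..r n} \<noteq> {}" "B \<inter> {- r n..r n} \<noteq> {}" by blast+
    qed (use meas sub in auto)
  qed
qed

text \<open>The level is written \<open>s * c\<close> with \<open>s\<close> in the unit interval, so
  that functions truncated at different heights can be compared at the same relative level
  \<open>s\<close>.\<close>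

lemma layer_cake_truncated:
  fixes h :: "'a \<Rightarrow> ennreal"
  assumes "sigma_finite_measure M" and [measurable]: "h \<in> borel_measurable M" and c: "0 < c"
  shows "(\<integral>\<^sup>+x. min (h x) (ennreal c) \<partial>M)
    = ennreal c * (\<integral>\<^sup>+s. emeasure M {x \<in> space M. ennreal (s * c) < h x} * indicator {0<..<1} s \<partial>lborel)"
proof -
  interpret sigma_finite_measure M by fact
  interpret P: pair_sigma_finite M lborel ..
  have pt: "min (h x) (ennreal c) = ennreal c * (\<integral>\<^sup>+s. indicator {s. ennreal (s * c) < h x} s * indicator {0<..<1} s \<partial>lborel)" for x
  proof -
    have eq: "(\<integral>\<^sup>+s. indicator {s. ennreal (s * c) < h x} s * indicator {0<..<1} s \<partial>lborel)
        = emeasure lborel ({s. ennreal (s * c) < h x} \<inter> {0<..<1::real})"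
      by (subst nn_integral_indicator[symmetric]) (auto simp: indicator_inter_arith[symmetric] intro!: nn_integral_cong)
    show ?thesis
    proof (cases "h x")
      case top
      then have "{s. ennreal (s * c) < h x} \<inter> {0<..<1::real} = {0<..<1}" by auto
      then show ?thesis unfolding eq by (simp add: top)
    next
      case (real y)
      then have "{s. ennreal (s * c) < h x} \<inter> {0<..<1::real} = {0<..<min 1 (y / c)}"
        using c by (auto simp: ennreal_less_iff field_simps)
      then have "emeasure lborel ({s. ennreal (s * c) < h x} \<inter> {0<..<1::real}) = ennreal (min 1 (y/c))"
        using real c by simp
      then show ?thesis unfolding eq using real c
        by (auto simp: min_def ennreal_mult'[symmetric] field_simps ennreal_le_iff)
    qed
  qed
  have [measurable]: "(\<lambda>(x, s). indicator {s. ennreal (s * c) < h x} s * indicator {0<..<1::real} s :: ennreal)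
      \<in> borel_measurable (M \<Otimes>\<^sub>M lborel)"
    unfolding indicator_def by measurable
  have "(\<integral>\<^sup>+x. min (h x) (ennreal c) \<partial>M)
     = ennreal c * (\<integral>\<^sup>+x. (\<integral>\<^sup>+s. indicator {s. ennreal (s * c) < h x} s * indicator {0<..<1} s \<partial>lborel) \<partial>M)"
    unfolding pt by (rule nn_integral_cmult) measurable
  also have "(\<integral>\<^sup>+x. (\<integral>\<^sup>+s. indicator {s. ennreal (s * c) < h x} s * indicator {0<..<1} s \<partial>lborel) \<partial>M)
     = (\<integral>\<^sup>+s. (\<integral>\<^sup>+x. indicator {s. ennreal (s * c) < h x} s * indicator {0<..<1} s \<partial>M) \<partial>lborel)"
    by (rule P.Fubini'[symmetric]) measurable
  also have "\<dots> = (\<integral>\<^sup>+s. emeasure M {x \<in> space M. ennreal (s * c) < h x} * indicator {0<..<1} s \<partial>lborel)"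
  proof (rule nn_integral_cong)
    fix s :: real
    have "(\<integral>\<^sup>+x. indicator {s. ennreal (s * c) < h x} s * indicator {0<..<1} s \<partial>M)
      = (\<integral>\<^sup>+x. indicator {x \<in> space M. ennreal (s * c) < h x} x \<partial>M) * indicator {0<..<1} s"
      by (subst nn_integral_multc[symmetric]) (auto intro!: nn_integral_cong simp: indicator_def)
    then show "(\<integral>\<^sup>+x. indicator {s. ennreal (s * c) < h x} s * indicator {0<..<1} s \<partial>M)
      = emeasure M {x \<in> space M. ennreal (s * c) < h x} * indicator {0<..<1} s" by simp
  qed
  finally show ?thesis .
qed

text \<open>At each relative level below 1 the superlevel sets of \<open>f\<close> and
  \<open>g\<close>, measured against their own suprema, are nonempty, and midpoints between them lie
  in a superlevel set of \<open>h\<close>. The Brunn-Minkowski inequality on the line compares the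
  measures. Integrating over the levels bounds an arithmetic mean, which dominates the geometric
  mean that is wanted.\<close>

lemma prekopa_leindler_real_bounded:
  fixes f g h :: "real \<Rightarrow> ennreal"
  assumes [measurable]: "f \<in> borel_measurable borel" "g \<in> borel_measurable borel" "h \<in> borel_measurable borel"
    and le: "\<And>x y. f x * g y \<le> (h ((x + y) / 2))\<^sup>2"
    and bf: "\<And>x. f x \<le> ennreal N" and bg: "\<And>x. g x \<le> ennreal N"
  shows "(\<integral>\<^sup>+x. f x \<partial>lborel) * (\<integral>\<^sup>+x. g x \<partial>lborel) \<le> (\<integral>\<^sup>+x. h x \<partial>lborel)\<^sup>2"
proof (cases "(\<integral>\<^sup>+x. f x \<partial>lborel) = 0 \<or> (\<integral>\<^sup>+x. g x \<partial>lborel) = 0 \<or> (\<integral>\<^sup>+x. h x \<partial>lborel) = \<top>")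
  case True then show ?thesis by (auto simp: power2_eq_square)
next
  case False
  define a where "a = enn2real (SUP x. f x)"
  define b where "b = enn2real (SUP x. g x)"
  have Sf: "(SUP x. f x) \<le> ennreal N" and Sg: "(SUP x. g x) \<le> ennreal N" using bf bg by (auto intro: SUP_least)
  have a: "(SUP x. f x) = ennreal a" using Sf by (metis a_def ennreal_enn2real ennreal_less_top order_le_less_trans)
  have b: "(SUP x. g x) = ennreal b" using Sg by (metis b_def ennreal_enn2real ennreal_less_top order_le_less_trans)
  have fa: "f x \<le> ennreal a" for x unfolding a[symmetric] by (rule SUP_upper) simp
  have gb: "g x \<le> ennreal b" for x unfolding b[symmetric] by (rule SUP_upper) simp
  have a0: "a > 0"
  proof (rule ccontr)
    assume "\<not> a > 0" then have "f x = 0" for x using fa[of x] by (simp add: ennreal_neg)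
    then show False using False by simp
  qed
  have b0: "b > 0"
  proof (rule ccontr)
    assume "\<not> b > 0" then have "g x = 0" for x using gb[of x] by (simp add: ennreal_neg)
    then show False using False by simp
  qed
  \<comment> \<open>The geometric mean matches the square in the hypothesis: values above
    \<open>s * a\<close> and \<open>s * b\<close> force \<open>h\<close> above
    \<open>s * sqrt (a * b)\<close> at the midpoint.\<close>
  define c where "c = sqrt (a * b)"
  have c0: "c > 0" using a0 b0 by (simp add: c_def)
  have cc: "c * c = a * b" using a0 b0 by (simp add: c_def)
  have key: "emeasure lborel {x. ennreal (s * a) < f x} + emeasure lborel {x. ennreal (s * b) < g x}
      \<le> 2 * emeasure lborel {x. ennreal (s * c) < h x}" if s: "0 < s" "s < 1" for s
  proof (rule brunn_minkowski_real)
    have "ennreal (s * a) < ennreal a" using s a0 by (simp add: ennreal_less_iff)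
    then show "{x. ennreal (s * a) < f x} \<noteq> {}" unfolding a[symmetric] by (auto simp: less_SUP_iff)
    have "ennreal (s * b) < ennreal b" using s b0 by (simp add: ennreal_less_iff)
    then show "{x. ennreal (s * b) < g x} \<noteq> {}" unfolding b[symmetric] by (auto simp: less_SUP_iff)
    fix x y assume xy: "x \<in> {x. ennreal (s * a) < f x}" "y \<in> {x. ennreal (s * b) < g x}"
    have "ennreal (s * c) < h ((x + y) / 2)"
    proof (rule ccontr)
      assume "\<not> ?thesis"
      then have "h ((x + y) / 2) \<le> ennreal (s * c)" by simp
      then have "(h ((x + y) / 2))\<^sup>2 \<le> (ennreal (s * c))\<^sup>2" by (rule power_mono) simp
      then have "f x * g y \<le> (ennreal (s * c))\<^sup>2" using le[of x y] by simp
      also have "(ennreal (s * c))\<^sup>2 = ennreal (s * a) * ennreal (s * b)"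
        using s a0 b0 c0 cc by (simp add: power2_eq_square ennreal_mult'[symmetric] algebra_simps)
      also have "\<dots> < f x * g y"
      proof -
        obtain p where p: "f x = ennreal p" "0 \<le> p" using fa[of x] by (cases "f x") (auto simp: top_unique)
        obtain q where q: "g y = ennreal q" "0 \<le> q" using gb[of y] by (cases "g y") (auto simp: top_unique)
        have "s * a < p" "s * b < q" using xy p q s a0 b0 by (auto simp: ennreal_less_iff)
        moreover have "0 < s * a" "0 < s * b" using s a0 b0 by simp_all
        ultimately have "(s * a) * (s * b) < p * q" by (intro mult_strict_mono) linarith+
        then show ?thesis unfolding p q using s a0 b0 p q
          by (simp add: ennreal_mult'[symmetric] ennreal_less_iff)
      qed
      finally show False by simp
    qed
    then show "(x + y) / 2 \<in> {x. ennreal (s * c) < h x}" by simp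
  qed measurable
  define X where "X = (\<integral>\<^sup>+s. emeasure lborel {x. ennreal (s * a) < f x} * indicator {0<..<1} s \<partial>lborel)"
  define Y where "Y = (\<integral>\<^sup>+s. emeasure lborel {x. ennreal (s * b) < g x} * indicator {0<..<1} s \<partial>lborel)"
  define Z where "Z = (\<integral>\<^sup>+s. emeasure lborel {x. ennreal (s * c) < h x} * indicator {0<..<1} s \<partial>lborel)"
  have [measurable]: "(\<lambda>s. emeasure lborel {x. ennreal (s * d) < u x}) \<in> borel_measurable borel"
    if [measurable]: "u \<in> borel_measurable borel" for u :: "real \<Rightarrow> ennreal" and d :: real
  proof -
    have "(\<lambda>s. emeasure lborel (Pair s -` {z \<in> space (borel \<Otimes>\<^sub>M lborel). ennreal (fst z * d) < u (snd z)})) \<in> borel_measurable borel"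
      by (rule lborel.measurable_emeasure_Pair) measurable
    then show ?thesis by (simp add: space_pair_measure vimage_def)
  qed
  have XYZ: "X + Y \<le> 2 * Z"
  proof -
    have "X + Y = (\<integral>\<^sup>+s. (emeasure lborel {x. ennreal (s * a) < f x} + emeasure lborel {x. ennreal (s * b) < g x}) * indicator {0<..<1} s \<partial>lborel)"
      unfolding X_def Y_def by (subst nn_integral_add[symmetric]) (auto simp: distrib_right)
    also have "\<dots> \<le> (\<integral>\<^sup>+s. 2 * (emeasure lborel {x. ennreal (s * c) < h x} * indicator {0<..<1} s) \<partial>lborel)"
      by (intro nn_integral_mono) (auto simp: indicator_def key)
    also have "\<dots> = 2 * Z" unfolding Z_def by (rule nn_integral_cmult) measurable
    finally show ?thesis .
  qed
  have sf: "sigma_finite_measure (lborel :: real measure)" by (rule sigma_finite_lborel)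
  have If: "(\<integral>\<^sup>+x. f x \<partial>lborel) = ennreal a * X"
    using layer_cake_truncated[OF sf, of f a] a0 fa by (simp add: X_def min_absorb1)
  have Ig: "(\<integral>\<^sup>+x. g x \<partial>lborel) = ennreal b * Y"
    using layer_cake_truncated[OF sf, of g b] b0 gb by (simp add: Y_def min_absorb1)
  have Ih: "ennreal c * Z \<le> (\<integral>\<^sup>+x. h x \<partial>lborel)"
    using layer_cake_truncated[OF sf, of h c] c0
    by (simp add: Z_def) (metis (no_types, lifting) min.cobounded1 nn_integral_mono)
  have "Z \<noteq> \<top>" using Ih c0 False by (auto simp: ennreal_mult_top top_unique)
  then obtain z where z: "Z = ennreal z" "z \<ge> 0" by (cases Z) auto
  have "X + Y \<noteq> \<top>" using XYZ z by (auto simp: top_unique ennreal_mult_eq_top_iff)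
  then obtain x y where xy: "X = ennreal x" "x \<ge> 0" "Y = ennreal y" "y \<ge> 0"
    by (cases X; cases Y) auto
  have "x + y \<le> 2 * z"
    using XYZ z xy by (simp add: ennreal_plus[symmetric] ennreal_mult'[symmetric] ennreal_numeral[symmetric] ennreal_le_iff del: ennreal_plus ennreal_numeral)
  then have "(x + y)\<^sup>2 \<le> (2 * z)\<^sup>2" using xy by (intro power_mono) auto
  moreover have "4 * (x * y) \<le> (x + y)\<^sup>2" using zero_le_power2[of "x - y"] by (simp add: power2_eq_square algebra_simps)
  ultimately have "x * y \<le> z * z" by (simp add: power2_eq_square)
  then have "(a * b) * (x * y) \<le> (a * b) * (z * z)" using a0 b0 by (intro mult_left_mono) auto
  moreover have "(a * x) * (b * y) = (a * b) * (x * y)" by (simp only: ac_simps)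
  moreover have "(c * z) * (c * z) = (a * b) * (z * z)" unfolding cc[symmetric] by (simp only: ac_simps)
  ultimately have "(a * x) * (b * y) \<le> (c * z) * (c * z)" by (simp only:)
  then have "(\<integral>\<^sup>+x. f x \<partial>lborel) * (\<integral>\<^sup>+x. g x \<partial>lborel) \<le> (ennreal c * Z)\<^sup>2"
    unfolding If Ig using a0 b0 c0 xy z by (simp add: power2_eq_square ennreal_mult'[symmetric] ennreal_le_iff)
  also have "\<dots> \<le> (\<integral>\<^sup>+x. h x \<partial>lborel)\<^sup>2" using Ih by (intro power_mono) auto
  finally show ?thesis .
qed

text \<open>Truncating \<open>f\<close> and \<open>g\<close> at integer heights only shrinks the
  left side of the hypothesis, and monotone convergence removes the truncation.\<close>

lemma prekopa_leindler_real:
  fixes f g h :: "real \<Rightarrow> ennreal"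
  assumes [measurable]: "f \<in> borel_measurable borel" "g \<in> borel_measurable borel" "h \<in> borel_measurable borel"
    and le: "\<And>x y. f x * g y \<le> (h ((x + y) / 2))\<^sup>2"
  shows "(\<integral>\<^sup>+x. f x \<partial>lborel) * (\<integral>\<^sup>+x. g x \<partial>lborel) \<le> (\<integral>\<^sup>+x. h x \<partial>lborel)\<^sup>2"
proof -
  have sup: "(\<integral>\<^sup>+x. u x \<partial>lborel) = (SUP n. \<integral>\<^sup>+x. min (u x) (of_nat n) \<partial>lborel)"
    if [measurable]: "u \<in> borel_measurable borel" for u :: "real \<Rightarrow> ennreal"
  proof -
    have "(\<integral>\<^sup>+x. (SUP n. min (u x) (of_nat n)) \<partial>lborel) = (SUP n. \<integral>\<^sup>+x. min (u x) (of_nat n) \<partial>lborel)"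
      by (rule nn_integral_monotone_convergence_SUP) (auto simp: incseq_def le_fun_def intro: min.coboundedI2)
    moreover have "(SUP n. min (u x) (of_nat n)) = u x" for x
      by (metis inf_SUP inf_min inf_top.right_neutral ennreal_SUP_of_nat_eq_top)
    ultimately show ?thesis by simp
  qed
  have "(\<integral>\<^sup>+x. min (f x) (of_nat n) \<partial>lborel) * (\<integral>\<^sup>+x. min (g x) (of_nat m) \<partial>lborel) \<le> (\<integral>\<^sup>+x. h x \<partial>lborel)\<^sup>2" for n m
  proof (rule prekopa_leindler_real_bounded)
    show "min (f x) (of_nat n) \<le> ennreal (real (max n m))" for x
      by (rule order_trans[OF min.cobounded2]) (simp add: ennreal_of_nat_eq_real_of_nat)
    show "min (g x) (of_nat m) \<le> ennreal (real (max n m))" for x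
      by (rule order_trans[OF min.cobounded2]) (simp add: ennreal_of_nat_eq_real_of_nat)
    show "min (f x) (of_nat n) * min (g y) (of_nat m) \<le> (h ((x + y) / 2))\<^sup>2" for x y
      by (rule order_trans[OF mult_mono le[of x y]]) auto
  qed measurable
  note le = this
  show ?thesis
    unfolding sup[OF assms(1)] sup[OF assms(2)]
    by (subst SUP_mult_left_ennreal, subst SUP_mult_right_ennreal) (intro SUP_least le)
qed

text \<open>Tensorisation: with one coordinate frozen, the induction hypothesis says exactly that
  the partial integrals satisfy the one-dimensional hypothesis in that coordinate.\<close>

lemma prekopa_leindler_PiM:
  fixes f g h :: "('i \<Rightarrow> real) \<Rightarrow> ennreal"
  assumes "finite I"
    and "f \<in> borel_measurable (PiM I (\<lambda>_. lborel))" "g \<in> borel_measurable (PiM I (\<lambda>_. lborel))"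
      "h \<in> borel_measurable (PiM I (\<lambda>_. lborel))"
    and "\<And>x y. x \<in> space (PiM I (\<lambda>_. lborel :: real measure)) \<Longrightarrow> y \<in> space (PiM I (\<lambda>_. lborel :: real measure)) \<Longrightarrow>
        f x * g y \<le> (h (\<lambda>i\<in>I. (x i + y i) / 2))\<^sup>2"
  shows "(\<integral>\<^sup>+x. f x \<partial>PiM I (\<lambda>_. lborel)) * (\<integral>\<^sup>+x. g x \<partial>PiM I (\<lambda>_. lborel)) \<le> (\<integral>\<^sup>+x. h x \<partial>PiM I (\<lambda>_. lborel))\<^sup>2"
  using assms
proof (induction I arbitrary: f g h rule: finite_induct)
  case empty
  interpret product_sigma_finite "\<lambda>_ :: 'i. lborel :: real measure" ..
  \<comment> \<open>The product measure over no index is the point mass at the undefined function,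
    so the claim is the hypothesis at a single point.\<close>
  have "(\<lambda>i\<in>{}. (x i + y i) / 2) = (\<lambda>_. undefined)" for x y :: "'i \<Rightarrow> real" by auto
  then show ?case using empty(4)[of "\<lambda>_. undefined" "\<lambda>_. undefined"]
    by (simp add: space_PiM PiE_def extensional_def nn_integral_empty)
next
  case (insert i I)
  interpret product_sigma_finite "\<lambda>_ :: 'i. lborel :: real measure" ..
  note [measurable] = insert.prems(1-3)
  have meas: "(\<lambda>s. \<integral>\<^sup>+x. u (x(i := s)) \<partial>PiM I (\<lambda>_. lborel)) \<in> borel_measurable borel"
    if [measurable]: "u \<in> borel_measurable (PiM (insert i I) (\<lambda>_. lborel))" for u :: "('i \<Rightarrow> real) \<Rightarrow> ennreal"
  proof -
    interpret I: finite_product_sigma_finite "\<lambda>_. lborel :: real measure" I by standard (rule insert.hyps)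
    have 1: "(\<lambda>(s, x). x(i := s)) \<in> measurable (borel \<Otimes>\<^sub>M PiM I (\<lambda>_. lborel)) (PiM (insert i I) (\<lambda>_. lborel :: real measure))"
      by measurable
    have "(\<lambda>(s, x). u (x(i := s))) \<in> borel_measurable (borel \<Otimes>\<^sub>M PiM I (\<lambda>_. lborel))"
      using measurable_compose[OF 1 that] by (simp add: case_prod_beta)
    then show ?thesis by (rule I.borel_measurable_nn_integral)
  qed
  have sl: "(\<lambda>x. u (x(i := s))) \<in> borel_measurable (PiM I (\<lambda>_. lborel))"
    if "u \<in> borel_measurable (PiM (insert i I) (\<lambda>_. lborel))" for u :: "('i \<Rightarrow> real) \<Rightarrow> ennreal" and s
  proof -
    have "(\<lambda>x. x(i := s)) \<in> measurable (PiM I (\<lambda>_. lborel)) (PiM (insert i I) (\<lambda>_. lborel :: real measure))"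
      by measurable
    from measurable_compose[OF this that] show ?thesis .
  qed
  have "(\<integral>\<^sup>+s. (\<integral>\<^sup>+x. f (x(i := s)) \<partial>PiM I (\<lambda>_. lborel)) \<partial>lborel) * (\<integral>\<^sup>+s. (\<integral>\<^sup>+x. g (x(i := s)) \<partial>PiM I (\<lambda>_. lborel)) \<partial>lborel)
      \<le> (\<integral>\<^sup>+s. (\<integral>\<^sup>+x. h (x(i := s)) \<partial>PiM I (\<lambda>_. lborel)) \<partial>lborel)\<^sup>2"
  proof (rule prekopa_leindler_real)
    fix s t :: real
    show "(\<integral>\<^sup>+x. f (x(i := s)) \<partial>PiM I (\<lambda>_. lborel)) * (\<integral>\<^sup>+x. g (x(i := t)) \<partial>PiM I (\<lambda>_. lborel))
      \<le> (\<integral>\<^sup>+x. h (x(i := (s + t) / 2)) \<partial>PiM I (\<lambda>_. lborel))\<^sup>2"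
    proof (rule insert.IH)
      fix x y assume "x \<in> space (PiM I (\<lambda>_. lborel :: real measure))" "y \<in> space (PiM I (\<lambda>_. lborel :: real measure))"
      then have "x(i := s) \<in> space (PiM (insert i I) (\<lambda>_. lborel :: real measure))"
         "y(i := t) \<in> space (PiM (insert i I) (\<lambda>_. lborel :: real measure))"
        by (auto simp: space_PiM PiE_def extensional_def)
      from insert.prems(4)[OF this]
      have "f (x(i := s)) * g (y(i := t)) \<le> (h (\<lambda>j\<in>insert i I. ((x(i := s)) j + (y(i := t)) j) / 2))\<^sup>2" .
      moreover have "(\<lambda>j\<in>insert i I. ((x(i := s)) j + (y(i := t)) j) / 2) = (\<lambda>j\<in>I. (x j + y j) / 2)(i := (s + t) / 2)"
        using insert.hyps(2) by (auto simp: fun_eq_iff)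
      ultimately show "f (x(i := s)) * g (y(i := t)) \<le> (h ((\<lambda>j\<in>I. (x j + y j) / 2)(i := (s + t) / 2)))\<^sup>2" by simp
    qed (intro sl insert.prems)+
  qed (intro meas insert.prems)+
  then show ?case
    by (simp add: product_nn_integral_insert_rev[OF insert.hyps] insert.prems)
qed

text \<open>The midpoint case, with a square on the right in place of a root on the left. Lebesgue
  measure is the image of the product measure under the linear coordinate map \<open>T\<close>,
  which preserves midpoints.\<close>

theorem prekopa_leindler:
  fixes f g h :: "'a::euclidean_space \<Rightarrow> ennreal"
  assumes [measurable]: "f \<in> borel_measurable borel" "g \<in> borel_measurable borel" "h \<in> borel_measurable borel"
    and le: "\<And>x y. f x * g y \<le> (h ((1/2) *\<^sub>R (x + y)))\<^sup>2"
  shows "(\<integral>\<^sup>+x. f x \<partial>lborel) * (\<integral>\<^sup>+x. g x \<partial>lborel) \<le> (\<integral>\<^sup>+x. h x \<partial>lborel)\<^sup>2"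
proof -
  define T where "T x = (\<Sum>b\<in>Basis. x b *\<^sub>R b)" for x :: "'a \<Rightarrow> real"
  have [measurable]: "T \<in> measurable (PiM Basis (\<lambda>_. lborel)) borel"
    unfolding T_def by measurable
  have int: "(\<integral>\<^sup>+x. u x \<partial>lborel) = (\<integral>\<^sup>+x. u (T x) \<partial>PiM Basis (\<lambda>_. lborel))"
    if "u \<in> borel_measurable borel" for u :: "'a \<Rightarrow> ennreal"
    unfolding lborel_eq[where 'a = 'a] T_def[symmetric] using that by (subst nn_integral_distr) auto
  show ?thesis
    unfolding int[OF assms(1)] int[OF assms(2)] int[OF assms(3)]
  proof (rule prekopa_leindler_PiM)
    fix x y :: "'a \<Rightarrow> real"
    have "T (\<lambda>i\<in>Basis. (x i + y i) / 2) = (1/2) *\<^sub>R (T x + T y)"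
      by (simp add: T_def scaleR_sum_right sum.distrib[symmetric] add_divide_distrib scaleR_add_left scaleR_add_right cong: sum.cong)
    then show "f (T x) * g (T y) \<le> (h (T (\<lambda>i\<in>Basis. (x i + y i) / 2)))\<^sup>2" using le by simp
  qed auto
qed

section \<open>Integration by parts on Euclidean space\<close>

lemma integrable_compact_support:
  fixes f :: "'a::euclidean_space \<Rightarrow> real"
  assumes "continuous_on UNIV f" "\<And>x. norm x > r \<Longrightarrow> f x = 0"
  shows "integrable lborel f"
proof -
  have "integrable lborel (\<lambda>x. indicator (cball 0 r) x *\<^sub>R f x)"
    using assms(1) by (intro borel_integrable_compact) (auto intro: continuous_on_subset)
  moreover have "(\<lambda>x. indicator (cball 0 r) x *\<^sub>R f x) = f"
    using assms(2) by (auto simp: fun_eq_iff indicator_def not_le)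
  ultimately show ?thesis by simp
qed

lemma lborel_integral_translation:
  fixes f :: "'a::euclidean_space \<Rightarrow> real"
  assumes "f \<in> borel_measurable borel"
  shows "integrable lborel (\<lambda>x. f (x + c)) \<longleftrightarrow> integrable lborel f"
    and "(\<integral>x. f (x + c) \<partial>lborel) = (\<integral>x. f x \<partial>lborel)"
proof -
  have eq: "lborel = distr lborel borel ((+) c)" by (rule lborel_distr_plus[symmetric])
  have "integrable lborel f \<longleftrightarrow> integrable (distr lborel borel ((+) c)) f" using eq by simp
  also have "\<dots> \<longleftrightarrow> integrable lborel (\<lambda>x. f (c + x))" using assms by (intro integrable_distr_eq) auto
  finally show "integrable lborel (\<lambda>x. f (x + c)) \<longleftrightarrow> integrable lborel f" by (simp add: add.commute)
  have "(\<integral>x. f x \<partial>lborel) = (\<integral>x. f x \<partial>distr lborel borel ((+) c))" using eq by simp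
  also have "\<dots> = (\<integral>x. f (c + x) \<partial>lborel)" using assms by (intro integral_distr) auto
  finally show "(\<integral>x. f (x + c) \<partial>lborel) = (\<integral>x. f x \<partial>lborel)" by (simp add: add.commute)
qed

lemma nn_integral_translation:
  fixes f :: "'a::euclidean_space \<Rightarrow> ennreal"
  assumes "f \<in> borel_measurable borel"
  shows "(\<integral>\<^sup>+x. f (x + c) \<partial>lborel) = (\<integral>\<^sup>+x. f x \<partial>lborel)"
proof -
  have "(\<integral>\<^sup>+x. f x \<partial>lborel) = (\<integral>\<^sup>+x. f x \<partial>distr lborel borel ((+) c))" by (simp add: lborel_distr_plus)
  also have "\<dots> = (\<integral>\<^sup>+x. f (c + x) \<partial>lborel)" using assms by (intro nn_integral_distr) auto
  finally show ?thesis by (simp add: add.commute)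
qed

lemma segment_FTC:
  fixes F :: "'a::euclidean_space \<Rightarrow> real"
  assumes der: "\<And>x. (F has_derivative DF x) (at x)" and cont: "continuous_on UNIV (\<lambda>x. DF x v)"
  shows "(\<integral>s. indicator {0..1} s *\<^sub>R DF (x + s *\<^sub>R v) v \<partial>lborel) = F (x + v) - F x"
proof -
  have "(\<integral>s. indicator {0..1} s *\<^sub>R DF (x + s *\<^sub>R v) v \<partial>lborel) = F (x + 1 *\<^sub>R v) - F (x + 0 *\<^sub>R v)"
  proof (rule integral_FTC_atLeastAtMost)
    fix s :: real
    have "((\<lambda>s. F (x + s *\<^sub>R v)) has_derivative (\<lambda>h. DF (x + s *\<^sub>R v) (h *\<^sub>R v))) (at s)"
      by (rule has_derivative_compose[OF _ der]) (auto intro!: derivative_eq_intros)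
    moreover have "DF (x + s *\<^sub>R v) (h *\<^sub>R v) = h *\<^sub>R DF (x + s *\<^sub>R v) v" for h
      using has_derivative_linear[OF der] by (simp add: linear_cmul)
    ultimately show "((\<lambda>s. F (x + s *\<^sub>R v)) has_vector_derivative DF (x + s *\<^sub>R v) v) (at s within {0..1})"
      by (simp add: has_vector_derivative_def has_derivative_at_withinI)
  qed (auto intro!: continuous_on_compose2[OF cont] continuous_intros)
  then show ?thesis by simp
qed

text \<open>By translation invariance every slice over \<open>s\<close> has the same integral, so
  Fubini may exchange the average along a segment with the integral over the space.\<close>

lemma integrable_segment_average:
  fixes g :: "'a::euclidean_space \<Rightarrow> real"
  assumes g: "integrable lborel g" and cont: "continuous_on UNIV g"
  shows "integrable (lborel \<Otimes>\<^sub>M lborel) (\<lambda>(s::real, x). indicator {0..1} s * g (x + s *\<^sub>R v))"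
proof -
  have [measurable]: "g \<in> borel_measurable borel" using cont by (rule borel_measurable_continuous_onI)
  have m: "(\<lambda>(s::real, x). indicator {0..1} s * g (x + s *\<^sub>R v)) \<in> borel_measurable (lborel \<Otimes>\<^sub>M lborel)"
    by measurable
  have "(\<integral>\<^sup>+z. norm (case z of (s::real, x) \<Rightarrow> indicator {0..1} s * g (x + s *\<^sub>R v)) \<partial>(lborel \<Otimes>\<^sub>M lborel))
    = (\<integral>\<^sup>+s. \<integral>\<^sup>+x. norm (indicator {0..1} (s::real) * g (x + s *\<^sub>R v)) \<partial>lborel \<partial>lborel)"
    using m by (subst lborel.nn_integral_fst[symmetric]) (auto simp: case_prod_beta)
  also have "\<dots> = (\<integral>\<^sup>+s. indicator {0..1} (s::real) * (\<integral>\<^sup>+x. norm (g x) \<partial>lborel) \<partial>lborel)"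
  proof (rule nn_integral_cong)
    fix s :: real
    have "(\<integral>\<^sup>+x. norm (indicator {0..1} (s::real) * g (x + s *\<^sub>R v)) \<partial>lborel)
       = (\<integral>\<^sup>+x. indicator {0..1} s * ennreal (norm (g (x + s *\<^sub>R v))) \<partial>lborel)"
      by (intro nn_integral_cong) (auto simp: indicator_def)
    also have "\<dots> = indicator {0..1} s * (\<integral>\<^sup>+x. norm (g (x + s *\<^sub>R v)) \<partial>lborel)"
      by (rule nn_integral_cmult) measurable
    also have "(\<integral>\<^sup>+x. norm (g (x + s *\<^sub>R v)) \<partial>lborel) = (\<integral>\<^sup>+x. norm (g x) \<partial>lborel)"
      by (rule nn_integral_translation) measurable
    finally show "(\<integral>\<^sup>+x. norm (indicator {0..1} (s::real) * g (x + s *\<^sub>R v)) \<partial>lborel) = indicator {0..1} s * (\<integral>\<^sup>+x. norm (g x) \<partial>lborel)" .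
  qed
  also have "\<dots> = (\<integral>\<^sup>+x. norm (g x) \<partial>lborel)"
    by (subst nn_integral_multc) auto
  also have "\<dots> < \<infinity>" using g by (simp add: integrable_iff_bounded)
  finally show ?thesis using m by (intro integrableI_bounded) auto
qed

text \<open>The increment \<open>F (x + v) - F x\<close> integrates to zero by translation
  invariance. It is also the average of the derivative along the segment, and averaging over
  translates does not change the integral. Integrability thus takes the place of decay at
  infinity.\<close>

lemma integral_directional_derivative_zero:
  fixes F :: "'a::euclidean_space \<Rightarrow> real"
  assumes der: "\<And>x. (F has_derivative DF x) (at x)" and cont: "continuous_on UNIV (\<lambda>x. DF x v)"
    and F: "integrable lborel F" and DF: "integrable lborel (\<lambda>x. DF x v)"
  shows "(\<integral>x. DF x v \<partial>lborel) = 0"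
proof -
  have contF: "continuous_on UNIV F" using der by (meson continuous_at_imp_continuous_on has_derivative_continuous)
  have [measurable]: "F \<in> borel_measurable borel" "(\<lambda>x. DF x v) \<in> borel_measurable borel"
    by (rule borel_measurable_continuous_onI, fact)+
  note I = integrable_segment_average[OF DF cont, of v]
  have "0 = (\<integral>x. F (x + v) - F x \<partial>lborel)"
    using F lborel_integral_translation[of F v] by (simp add: Bochner_Integration.integral_diff)
  also have "\<dots> = (\<integral>x. (\<integral>s. indicator {0..1} s * DF (x + s *\<^sub>R v) v \<partial>lborel) \<partial>lborel)"
    using segment_FTC[OF der cont] by simp
  also have "\<dots> = (\<integral>s. (\<integral>x. indicator {0..1} s * DF (x + s *\<^sub>R v) v \<partial>lborel) \<partial>lborel)"
    by (rule lborel_pair.Fubini_integral) (rule I)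
  also have "\<dots> = (\<integral>s. indicator {0..1::real} s * (\<integral>x. DF x v \<partial>lborel) \<partial>lborel)"
    using lborel_integral_translation(2)[of "\<lambda>x. DF x v"] by simp
  also have "\<dots> = (\<integral>x. DF x v \<partial>lborel)" by simp
  finally show ?thesis by simp
qed

text \<open>The same segment average in absolute value: a modulus of continuity in L1, which later
  turns a translation of length \<epsilon> into a factor \<epsilon>.\<close>

lemma integral_translation_difference_le:
  fixes F :: "'a::euclidean_space \<Rightarrow> real"
  assumes der: "\<And>x. (F has_derivative DF x) (at x)" and cont: "continuous_on UNIV (\<lambda>x. DF x v)"
    and F: "integrable lborel F" and DF: "integrable lborel (\<lambda>x. DF x v)"
  shows "(\<integral>x. \<bar>F (x + v) - F x\<bar> \<partial>lborel) \<le> (\<integral>x. \<bar>DF x v\<bar> \<partial>lborel)"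
proof -
  have contF: "continuous_on UNIV F" using der by (meson continuous_at_imp_continuous_on has_derivative_continuous)
  have [measurable]: "F \<in> borel_measurable borel" "(\<lambda>x. DF x v) \<in> borel_measurable borel"
    by (rule borel_measurable_continuous_onI, fact)+
  have DFa: "integrable lborel (\<lambda>x. \<bar>DF x v\<bar>)" using DF by (rule integrable_abs)
  have contA: "continuous_on UNIV (\<lambda>x. \<bar>DF x v\<bar>)" by (intro continuous_intros cont)
  note I = integrable_segment_average[OF DFa contA, of v]
  have I2: "integrable lborel (\<lambda>x. (\<integral>s. indicator {0..1} s * \<bar>DF (x + s *\<^sub>R v) v\<bar> \<partial>lborel))"
    using lborel_pair.integrable_snd[of "\<lambda>s x. indicator {0..1} s * \<bar>DF (x + s *\<^sub>R v) v\<bar>"] I by simp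
  have "(\<integral>x. \<bar>F (x + v) - F x\<bar> \<partial>lborel) \<le> (\<integral>x. (\<integral>s. indicator {0..1} s * \<bar>DF (x + s *\<^sub>R v) v\<bar> \<partial>lborel) \<partial>lborel)"
  proof (rule integral_mono)
    show "integrable lborel (\<lambda>x. \<bar>F (x + v) - F x\<bar>)"
      using F lborel_integral_translation(1)[of F v] by simp
    fix x
    have "\<bar>F (x + v) - F x\<bar> = \<bar>\<integral>s. indicator {0..1} s * DF (x + s *\<^sub>R v) v \<partial>lborel\<bar>"
      using segment_FTC[OF der cont] by simp
    also have "\<dots> \<le> (\<integral>s. \<bar>indicator {0..1} s * DF (x + s *\<^sub>R v) v\<bar> \<partial>lborel)" by (rule integral_abs_bound)
    also have "\<dots> = (\<integral>s. indicator {0..1} s * \<bar>DF (x + s *\<^sub>R v) v\<bar> \<partial>lborel)" by (simp add: abs_mult)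
    finally show "\<bar>F (x + v) - F x\<bar> \<le> (\<integral>s. indicator {0..1} s * \<bar>DF (x + s *\<^sub>R v) v\<bar> \<partial>lborel)" .
  qed (rule I2)
  also have "\<dots> = (\<integral>s. (\<integral>x. indicator {0..1} s * \<bar>DF (x + s *\<^sub>R v) v\<bar> \<partial>lborel) \<partial>lborel)"
    by (rule lborel_pair.Fubini_integral) (rule I)
  also have "\<dots> = (\<integral>s. indicator {0..1::real} s * (\<integral>x. \<bar>DF x v\<bar> \<partial>lborel) \<partial>lborel)"
    using lborel_integral_translation(2)[of "\<lambda>x. \<bar>DF x v\<bar>"] by simp
  also have "\<dots> = (\<integral>x. \<bar>DF x v\<bar> \<partial>lborel)" by simp
  finally show ?thesis .
qed

text \<open>Squaring the positive part makes the function continuously differentiable across the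
  sphere of radius \<open>N\<close>, with an explicit gradient of size at most
  \<open>4 / N\<close>.\<close>

definition cutoff :: "real \<Rightarrow> 'a::euclidean_space \<Rightarrow> real" where
  "cutoff N x = (max 0 (1 - (x \<bullet> x) / N\<^sup>2))\<^sup>2"

definition cutoff_grad :: "real \<Rightarrow> 'a::euclidean_space \<Rightarrow> 'a" where
  "cutoff_grad N x = (- 4 * max 0 (1 - (x \<bullet> x) / N\<^sup>2) / N\<^sup>2) *\<^sub>R x"

lemma DERIV_pos_part_square: "((\<lambda>t::real. (max 0 t)\<^sup>2) has_real_derivative 2 * max 0 t) (at t)"
proof -
  consider "t < 0" | "t = 0" | "t > 0" by linarith
  then show ?thesis
  proof cases
    case 1
    have "((\<lambda>t. 0) has_real_derivative 0) (at t)" by simp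
    then have "((\<lambda>t::real. (max 0 t)\<^sup>2) has_real_derivative 0) (at t)"
      by (rule DERIV_cong_ev[THEN iffD1, rotated 3])
        (use 1 in \<open>auto intro!: eventually_mono[OF eventually_nhds_in_open[of "{..<0}"]]\<close>)
    then show ?thesis using 1 by simp
  next
    case 2
    have "((\<lambda>h::real. (max 0 h)\<^sup>2 / h) \<longlongrightarrow> 0) (at 0)"
    proof (rule Lim_null_comparison)
      show "\<forall>\<^sub>F h in at 0. norm ((max 0 h)\<^sup>2 / h) \<le> \<bar>h :: real\<bar>"
        by (rule always_eventually) (auto simp: max_def power2_eq_square)
      show "((\<lambda>h::real. \<bar>h\<bar>) \<longlongrightarrow> 0) (at 0)" by (simp add: tendsto_rabs_zero)
    qed
    then show ?thesis using 2 by (simp add: DERIV_def)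
  next
    case 3
    have "((\<lambda>t. t\<^sup>2) has_real_derivative 2 * t) (at t)" by (auto intro!: derivative_eq_intros)
    then have "((\<lambda>t::real. (max 0 t)\<^sup>2) has_real_derivative 2 * t) (at t)"
      by (rule DERIV_cong_ev[THEN iffD1, rotated 3])
        (use 3 in \<open>auto intro!: eventually_mono[OF eventually_nhds_in_open[of "{0<..}"]]\<close>)
    then show ?thesis using 3 by simp
  qed
qed

lemma cutoff_has_derivative:
  "(cutoff N has_derivative (\<lambda>h. cutoff_grad N x \<bullet> h)) (at x)"
proof -
  have "((\<lambda>x. 1 - inverse (N\<^sup>2) * (x \<bullet> x)) has_derivative (\<lambda>h. - (inverse (N\<^sup>2) * (2 * (x \<bullet> h))))) (at x)"
    by (auto intro!: derivative_eq_intros simp: inner_commute)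
  then have 1: "((\<lambda>x. 1 - (x \<bullet> x) / N\<^sup>2) has_derivative (\<lambda>h. - (2 * (x \<bullet> h)) / N\<^sup>2)) (at x)"
    by (simp add: divide_inverse mult_ac)
  have 2: "((\<lambda>t::real. (max 0 t)\<^sup>2) has_derivative (\<lambda>h. 2 * max 0 t * h)) (at t)" for t
    using DERIV_pos_part_square[of t] by (simp add: has_field_derivative_def)
  have "((\<lambda>x. (max 0 (1 - (x \<bullet> x) / N\<^sup>2))\<^sup>2) has_derivative
     (\<lambda>h. 2 * max 0 (1 - (x \<bullet> x) / N\<^sup>2) * (- (2 * (x \<bullet> h)) / N\<^sup>2))) (at x)"
    by (rule has_derivative_compose[OF 1 2])
  then show ?thesis unfolding cutoff_def[abs_def] cutoff_grad_def by (simp add: mult_ac)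
qed

lemma cutoff_grad_continuous: "continuous_on S (cutoff_grad N)"
  unfolding cutoff_grad_def divide_inverse by (intro continuous_intros)

lemma cutoff_continuous: "continuous_on S (cutoff N)"
  unfolding cutoff_def[abs_def] divide_inverse by (intro continuous_intros)

lemma cutoff_nonneg: "0 \<le> cutoff N x" by (simp add: cutoff_def)

lemma cutoff_le_1: "cutoff N x \<le> 1"
  unfolding cutoff_def by (rule power_le_one) auto

lemma cutoff_outside:
  assumes "norm x \<ge> N" "N > 0"
  shows "cutoff N x = 0" "cutoff_grad N x = 0"
proof -
  have "N\<^sup>2 \<le> x \<bullet> x" using assms by (metis dot_square_norm power_mono less_imp_le)
  then have "max 0 (1 - (x \<bullet> x) / N\<^sup>2) = 0" using assms(2) by (simp add: max_def field_simps)
  then show "cutoff N x = 0" "cutoff_grad N x = 0" by (simp_all add: cutoff_def cutoff_grad_def)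
qed

lemma norm_cutoff_grad_le:
  assumes "N > 0"
  shows "norm (cutoff_grad N x) \<le> 4 / N"
proof (cases "norm x \<ge> N")
  case True then show ?thesis using assms by (simp add: cutoff_outside)
next
  case False
  have "norm (cutoff_grad N x) = 4 * max 0 (1 - (x \<bullet> x) / N\<^sup>2) / N\<^sup>2 * norm x"
    by (simp add: cutoff_grad_def)
  also have "\<dots> \<le> 4 * 1 / N\<^sup>2 * N"
    using False assms by (intro mult_mono divide_right_mono) auto
  also have "\<dots> = 4 / N" using assms by (simp add: power2_eq_square)
  finally show ?thesis .
qed

lemma cutoff_tendsto_1: "(\<lambda>n. cutoff (real (Suc n)) x) \<longlonglongrightarrow> 1"
proof -
  have "(\<lambda>n. (max 0 (1 - (x \<bullet> x) * (inverse (real (Suc n)))\<^sup>2))\<^sup>2) \<longlonglongrightarrow> (max 0 (1 - (x \<bullet> x) * 0\<^sup>2))\<^sup>2"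
    by (intro tendsto_intros LIMSEQ_inverse_real_of_nat)
  then show ?thesis by (simp add: cutoff_def divide_inverse power_inverse)
qed

text \<open>Integrability is assumed for the fields and for the whole divergence, not for the single
  derivatives. Multiplying the divergence by the cutoff and integrating by parts term by term leaves
  only the fields against the gradient of the cutoff, an error of order
  \<open>1 / N\<close>.\<close>

theorem integral_divergence_zero:
  fixes X :: "'i \<Rightarrow> 'a::euclidean_space \<Rightarrow> real"
  assumes fin: "finite I"
    and der: "\<And>i x. i \<in> I \<Longrightarrow> (X i has_derivative DX i x) (at x)"
    and cont: "\<And>i. i \<in> I \<Longrightarrow> continuous_on UNIV (\<lambda>x. DX i x (v i))"
    and X: "\<And>i. i \<in> I \<Longrightarrow> integrable lborel (X i)"
    and div: "integrable lborel (\<lambda>x. \<Sum>i\<in>I. DX i x (v i))"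
  shows "(\<integral>x. (\<Sum>i\<in>I. DX i x (v i)) \<partial>lborel) = 0"
proof -
  let ?D = "\<lambda>x. \<Sum>i\<in>I. DX i x (v i)"
  define N where "N n = real (Suc n)" for n
  have N0: "N n > 0" for n by (simp add: N_def)
  have contX: "continuous_on UNIV (X i)" if "i \<in> I" for i
    using der[OF that] by (meson continuous_at_imp_continuous_on has_derivative_continuous)
  have [measurable]: "cutoff r \<in> borel_measurable borel" "cutoff_grad r \<in> borel_measurable borel" for r :: real
    by (intro borel_measurable_continuous_onI cutoff_continuous cutoff_grad_continuous)+
  have bound: "\<bar>\<integral>x. cutoff (N n) x * ?D x \<partial>lborel\<bar> \<le> 4 / N n * (\<Sum>i\<in>I. norm (v i) * (\<integral>x. \<bar>X i x\<bar> \<partial>lborel))" for n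
  proof -
    have d: "((\<lambda>x. cutoff (N n) x * X i x) has_derivative
        (\<lambda>h. cutoff (N n) x * DX i x h + (cutoff_grad (N n) x \<bullet> h) * X i x)) (at x)" if "i \<in> I" for i x
      using der[OF that] cutoff_has_derivative by (auto intro!: derivative_eq_intros)
    have c1: "continuous_on UNIV (\<lambda>x. cutoff (N n) x * DX i x (v i))" if "i \<in> I" for i
      by (intro continuous_intros cutoff_continuous cont that)
    have c2: "continuous_on UNIV (\<lambda>x. (cutoff_grad (N n) x \<bullet> v i) * X i x)" if "i \<in> I" for i
      by (intro continuous_intros cutoff_grad_continuous contX that)
    have i1: "integrable lborel (\<lambda>x. cutoff (N n) x * DX i x (v i))" if "i \<in> I" for i
      using c1[OF that] by (rule integrable_compact_support[where r = "N n"]) (simp add: cutoff_outside N0)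
    have i2: "integrable lborel (\<lambda>x. (cutoff_grad (N n) x \<bullet> v i) * X i x)" if "i \<in> I" for i
      using c2[OF that] by (rule integrable_compact_support[where r = "N n"]) (simp add: cutoff_outside N0)
    have i0: "integrable lborel (\<lambda>x. cutoff (N n) x * X i x)" if "i \<in> I" for i
      by (rule integrable_compact_support[where r = "N n"])
        (auto simp: cutoff_outside N0 intro!: continuous_intros cutoff_continuous contX that)
    have z: "(\<integral>x. cutoff (N n) x * DX i x (v i) \<partial>lborel) = - (\<integral>x. (cutoff_grad (N n) x \<bullet> v i) * X i x \<partial>lborel)"
      if "i \<in> I" for i
    proof -
      have "(\<integral>x. cutoff (N n) x * DX i x (v i) + (cutoff_grad (N n) x \<bullet> v i) * X i x \<partial>lborel) = 0"
        by (rule integral_directional_derivative_zero[OF d[OF that]])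
          (use c1[OF that] c2[OF that] i0[OF that] i1[OF that] i2[OF that] in \<open>auto intro!: continuous_on_add\<close>)
      then show ?thesis using i1[OF that] i2[OF that] by simp
    qed
    have "(\<integral>x. cutoff (N n) x * ?D x \<partial>lborel) = (\<Sum>i\<in>I. - (\<integral>x. (cutoff_grad (N n) x \<bullet> v i) * X i x \<partial>lborel))"
      unfolding sum_distrib_left using i1 z by (subst Bochner_Integration.integral_sum) auto
    also have "\<bar>\<dots>\<bar> \<le> (\<Sum>i\<in>I. 4 / N n * (norm (v i) * (\<integral>x. \<bar>X i x\<bar> \<partial>lborel)))"
    proof (rule order_trans[OF sum_abs], rule sum_mono)
      fix i assume i: "i \<in> I"
      have "\<bar>- (\<integral>x. (cutoff_grad (N n) x \<bullet> v i) * X i x \<partial>lborel)\<bar> \<le> (\<integral>x. \<bar>(cutoff_grad (N n) x \<bullet> v i) * X i x\<bar> \<partial>lborel)"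
        by (simp add: integral_abs_bound)
      also have "\<dots> \<le> (\<integral>x. (4 / N n * norm (v i)) * \<bar>X i x\<bar> \<partial>lborel)"
      proof (rule integral_mono)
        show "integrable lborel (\<lambda>x. \<bar>(cutoff_grad (N n) x \<bullet> v i) * X i x\<bar>)" using i2[OF i] by (rule integrable_abs)
        show "integrable lborel (\<lambda>x. (4 / N n * norm (v i)) * \<bar>X i x\<bar>)" using X[OF i] by simp
        fix x
        have "\<bar>cutoff_grad (N n) x \<bullet> v i\<bar> \<le> 4 / N n * norm (v i)"
          by (rule order_trans[OF Cauchy_Schwarz_ineq2]) (intro mult_right_mono norm_cutoff_grad_le N0 norm_ge_zero)
        then show "\<bar>(cutoff_grad (N n) x \<bullet> v i) * X i x\<bar> \<le> (4 / N n * norm (v i)) * \<bar>X i x\<bar>"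
          unfolding abs_mult by (rule mult_right_mono) simp
      qed
      finally show "\<bar>- (\<integral>x. (cutoff_grad (N n) x \<bullet> v i) * X i x \<partial>lborel)\<bar> \<le> 4 / N n * (norm (v i) * (\<integral>x. \<bar>X i x\<bar> \<partial>lborel))"
        by (simp add: mult_ac)
    qed
    finally show ?thesis by (simp add: sum_distrib_left)
  qed
  have "(\<lambda>n. \<integral>x. cutoff (N n) x * ?D x \<partial>lborel) \<longlonglongrightarrow> (\<integral>x. ?D x \<partial>lborel)"
  proof (rule integral_dominated_convergence[where w = "\<lambda>x. \<bar>?D x\<bar>"])
    show "?D \<in> borel_measurable lborel" using div by simp
    then show "(\<lambda>x. cutoff (N n) x * ?D x) \<in> borel_measurable lborel" for n by measurable
    show "AE x in lborel. (\<lambda>n. cutoff (N n) x * ?D x) \<longlonglongrightarrow> ?D x"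
      using tendsto_mult[OF cutoff_tendsto_1 tendsto_const] by (auto simp: N_def intro!: AE_I2)
    show "AE x in lborel. norm (cutoff (N n) x * ?D x) \<le> \<bar>?D x\<bar>" for n
    proof (rule AE_I2)
      fix x :: 'a
      have "\<bar>cutoff (N n) x\<bar> \<le> 1" using cutoff_nonneg[of "N n" x] cutoff_le_1[of "N n" x] by simp
      then show "norm (cutoff (N n) x * ?D x) \<le> \<bar>?D x\<bar>"
        unfolding real_norm_def abs_mult by (rule mult_left_le_one_le[rotated 2]) auto
    qed
  qed (use div in auto)
  moreover have "(\<lambda>n. \<integral>x. cutoff (N n) x * ?D x \<partial>lborel) \<longlonglongrightarrow> 0"
  proof (rule Lim_null_comparison)
    show "\<forall>\<^sub>F n in sequentially. norm (\<integral>x. cutoff (N n) x * ?D x \<partial>lborel)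
       \<le> 4 / N n * (\<Sum>i\<in>I. norm (v i) * (\<integral>x. \<bar>X i x\<bar> \<partial>lborel))"
      using bound by (intro always_eventually) auto
    have "(\<lambda>n. 4 * inverse (N n) * (\<Sum>i\<in>I. norm (v i) * (\<integral>x. \<bar>X i x\<bar> \<partial>lborel))) \<longlonglongrightarrow>
        4 * 0 * (\<Sum>i\<in>I. norm (v i) * (\<integral>x. \<bar>X i x\<bar> \<partial>lborel))"
      unfolding N_def by (intro tendsto_intros LIMSEQ_inverse_real_of_nat)
    then show "(\<lambda>n. 4 / N n * (\<Sum>i\<in>I. norm (v i) * (\<integral>x. \<bar>X i x\<bar> \<partial>lborel))) \<longlonglongrightarrow> 0"
      by (simp add: divide_inverse)
  qed
  ultimately show ?thesis using LIMSEQ_unique by blast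
qed

section \<open>Smooth functions\<close>

lemma smooth_on_imp_differentiable:
  "smooth_on f S \<Longrightarrow> x \<in> S \<Longrightarrow> f differentiable (at x)"
  unfolding smooth_on_def by (drule spec[of _ "Suc 0"]) simp

lemma smooth_on_imp_has_derivative:
  "smooth_on f S \<Longrightarrow> x \<in> S \<Longrightarrow> (f has_derivative frechet_derivative f (at x)) (at x)"
  by (simp add: frechet_derivative_works[symmetric] smooth_on_imp_differentiable)

lemma smooth_on_imp_continuous_on: "smooth_on f S \<Longrightarrow> continuous_on S f"
  unfolding smooth_on_def by (drule spec[of _ 0]) simp

lemma smooth_on_frechet_derivative:
  "smooth_on f S \<Longrightarrow> smooth_on (\<lambda>x. frechet_derivative f (at x) v) S"
  unfolding smooth_on_def by (metis Ck_on.simps(2))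

lemma has_real_derivative_of_scaled:
  "(F has_derivative (\<lambda>h. h * c)) (at a) \<Longrightarrow> (F has_real_derivative c) (at a)"
  unfolding has_field_derivative_def by (simp add: mult_commute_abs)

text \<open>The mean value theorem in direction \<open>u\<close> and then in direction
  \<open>v\<close>. The double difference is symmetric in the two directions, which yields the
  symmetry of second derivatives; for opposite directions it is, up to sign, a central second
  difference.\<close>

lemma double_difference_mvt:
  fixes f :: "'a::real_normed_vector \<Rightarrow> real"
  assumes f: "\<And>x. (f has_derivative Df x) (at x)"
    and Df: "\<And>x. ((\<lambda>x. Df x u) has_derivative D2 x) (at x)" and e: "0 < e"
  shows "\<exists>a b. 0 < a \<and> a < e \<and> 0 < b \<and> b < e \<and>
    f (x + e *\<^sub>R u + e *\<^sub>R v) - f (x + e *\<^sub>R u) - f (x + e *\<^sub>R v) + f x = e * e * D2 (x + a *\<^sub>R u + b *\<^sub>R v) v"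
proof -
  have scale: "L (h *\<^sub>R w) = h * L w" if "linear L" for L :: "'a \<Rightarrow> real" and h w
    using that by (simp add: linear_cmul)
  define p where "p a = f (x + a *\<^sub>R u + e *\<^sub>R v) - f (x + a *\<^sub>R u)" for a
  have dp: "(p has_real_derivative Df (x + a *\<^sub>R u + e *\<^sub>R v) u - Df (x + a *\<^sub>R u) u) (at a)" for a
  proof -
    have 1: "((\<lambda>a. f (x + a *\<^sub>R u + e *\<^sub>R v)) has_derivative (\<lambda>h. Df (x + a *\<^sub>R u + e *\<^sub>R v) (h *\<^sub>R u))) (at a)"
      by (rule has_derivative_compose[OF _ f]) (auto intro!: derivative_eq_intros)
    have 2: "((\<lambda>a. f (x + a *\<^sub>R u)) has_derivative (\<lambda>h. Df (x + a *\<^sub>R u) (h *\<^sub>R u))) (at a)"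
      by (rule has_derivative_compose[OF _ f]) (auto intro!: derivative_eq_intros)
    show ?thesis
      using has_derivative_diff[OF 1 2] unfolding p_def
      by (intro has_real_derivative_of_scaled) (simp add: scale[OF has_derivative_linear[OF f]] right_diff_distrib)
  qed
  obtain a where a: "0 < a" "a < e"
    "p e - p 0 = (e - 0) * (Df (x + a *\<^sub>R u + e *\<^sub>R v) u - Df (x + a *\<^sub>R u) u)"
    using MVT2[OF e dp] by blast
  define q where "q b = Df (x + a *\<^sub>R u + b *\<^sub>R v) u" for b
  have dq: "(q has_real_derivative D2 (x + a *\<^sub>R u + b *\<^sub>R v) v) (at b)" for b
  proof -
    have "((\<lambda>b. Df (x + a *\<^sub>R u + b *\<^sub>R v) u) has_derivative (\<lambda>h. D2 (x + a *\<^sub>R u + b *\<^sub>R v) (h *\<^sub>R v))) (at b)"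
      by (rule has_derivative_compose[OF _ Df]) (auto intro!: derivative_eq_intros)
    then show ?thesis unfolding q_def
      by (intro has_real_derivative_of_scaled) (simp add: scale[OF has_derivative_linear[OF Df]])
  qed
  obtain b where b: "0 < b" "b < e" "q e - q 0 = (e - 0) * D2 (x + a *\<^sub>R u + b *\<^sub>R v) v"
    using MVT2[OF e dq] by blast
  show ?thesis using a b by (intro exI[of _ a] exI[of _ b]) (auto simp: p_def q_def)
qed

text \<open>The double difference over a shrinking parallelogram equals, up to the same factor, each
  of the two mixed derivatives at some point of it. Continuity of both lets these points converge to
  \<open>x\<close>.\<close>

lemma second_derivative_symmetric:
  fixes f :: "'a::real_normed_vector \<Rightarrow> real"
  assumes f: "smooth_on f UNIV"
  shows "frechet_derivative (\<lambda>x. frechet_derivative f (at x) u) (at x) v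
       = frechet_derivative (\<lambda>x. frechet_derivative f (at x) v) (at x) u"
proof -
  define A where "A = (\<lambda>x. frechet_derivative (\<lambda>x. frechet_derivative f (at x) u) (at x) v)"
  define B where "B = (\<lambda>x. frechet_derivative (\<lambda>x. frechet_derivative f (at x) v) (at x) u)"
  have contA: "isCont A x" and contB: "isCont B x"
    unfolding A_def B_def
    using smooth_on_imp_continuous_on[OF smooth_on_frechet_derivative[OF smooth_on_frechet_derivative[OF f]]]
    by (auto simp: continuous_on_eq_continuous_at)
  have Df: "(f has_derivative frechet_derivative f (at x)) (at x)" for x
    using smooth_on_imp_has_derivative[OF f] by simp
  have D2: "((\<lambda>x. frechet_derivative f (at x) w) has_derivative
      frechet_derivative (\<lambda>x. frechet_derivative f (at x) w) (at x)) (at x)" for w x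
    using smooth_on_imp_has_derivative[OF smooth_on_frechet_derivative[OF f]] by simp
  define e where "e n = inverse (real (Suc n))" for n
  have e0: "e n > 0" for n by (simp add: e_def)
  have elim: "e \<longlonglongrightarrow> 0" unfolding e_def[abs_def] by (rule LIMSEQ_inverse_real_of_nat)
  have "\<exists>a b a' b'. 0 < a \<and> a < e n \<and> 0 < b \<and> b < e n \<and> 0 < a' \<and> a' < e n \<and> 0 < b' \<and> b' < e n \<and>
      A (x + a *\<^sub>R u + b *\<^sub>R v) = B (x + a' *\<^sub>R v + b' *\<^sub>R u)" for n
  proof -
    obtain a b where ab: "0 < a" "a < e n" "0 < b" "b < e n"
      "f (x + e n *\<^sub>R u + e n *\<^sub>R v) - f (x + e n *\<^sub>R u) - f (x + e n *\<^sub>R v) + f x = e n * e n * A (x + a *\<^sub>R u + b *\<^sub>R v)"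
      using double_difference_mvt[OF Df D2 e0, where x = x and u = u and v = v] unfolding A_def by blast
    obtain a' b' where ab': "0 < a'" "a' < e n" "0 < b'" "b' < e n"
      "f (x + e n *\<^sub>R v + e n *\<^sub>R u) - f (x + e n *\<^sub>R v) - f (x + e n *\<^sub>R u) + f x = e n * e n * B (x + a' *\<^sub>R v + b' *\<^sub>R u)"
      using double_difference_mvt[OF Df D2 e0, where x = x and u = v and v = u] unfolding B_def by blast
    have "x + e n *\<^sub>R v + e n *\<^sub>R u = x + e n *\<^sub>R u + e n *\<^sub>R v" by simp
    then have "e n * e n * A (x + a *\<^sub>R u + b *\<^sub>R v) = e n * e n * B (x + a' *\<^sub>R v + b' *\<^sub>R u)"
      using ab(5) ab'(5) by (simp only:)
    then have "A (x + a *\<^sub>R u + b *\<^sub>R v) = B (x + a' *\<^sub>R v + b' *\<^sub>R u)" using e0[of n] by simp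
    with ab ab' show ?thesis by blast
  qed
  then obtain a b a' b' where ab: "\<And>n. 0 < a n \<and> a n < e n" "\<And>n. 0 < b n \<and> b n < e n"
      "\<And>n. 0 < a' n \<and> a' n < e n" "\<And>n. 0 < b' n \<and> b' n < e n"
      "\<And>n. A (x + a n *\<^sub>R u + b n *\<^sub>R v) = B (x + a' n *\<^sub>R v + b' n *\<^sub>R u)"
    by metis
  have lim: "c \<longlonglongrightarrow> 0" if "\<And>n. 0 < c n \<and> c n < e n" for c :: "nat \<Rightarrow> real"
    by (rule real_tendsto_sandwich[OF _ _ tendsto_const elim]) (use that in \<open>auto intro!: always_eventually less_imp_le\<close>)
  have "(\<lambda>n. x + a n *\<^sub>R u + b n *\<^sub>R v) \<longlonglongrightarrow> x + 0 *\<^sub>R u + 0 *\<^sub>R v"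
    by (intro tendsto_intros lim ab)
  then have "(\<lambda>n. A (x + a n *\<^sub>R u + b n *\<^sub>R v)) \<longlonglongrightarrow> A x"
    using contA by (intro isCont_tendsto_compose[of _ A]) auto
  moreover have "(\<lambda>n. x + a' n *\<^sub>R v + b' n *\<^sub>R u) \<longlonglongrightarrow> x + 0 *\<^sub>R v + 0 *\<^sub>R u"
    by (intro tendsto_intros lim ab)
  then have "(\<lambda>n. B (x + a' n *\<^sub>R v + b' n *\<^sub>R u)) \<longlonglongrightarrow> B x"
    using contB by (intro isCont_tendsto_compose[of _ B]) auto
  ultimately have "A x = B x" using ab(5) LIMSEQ_unique by auto
  then show ?thesis by (simp add: A_def B_def)
qed

section \<open>Gradient, Hessian and third derivatives in coordinates\<close>

lemma grad_component: "grad f x $ i = frechet_derivative f (at x) (axis i 1)"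
  by (simp add: grad_def)

lemma linear_cart_sum:
  fixes L :: "real^'n \<Rightarrow> 'b::real_vector"
  assumes "linear L"
  shows "L h = (\<Sum>i\<in>UNIV. h $ i *\<^sub>R L (axis i 1))"
proof -
  have "L h = L (\<Sum>i\<in>UNIV. h $ i *\<^sub>R axis i 1)" by (simp add: basis_expansion[of h, unfolded scalar_mult_eq_scaleR])
  also have "\<dots> = (\<Sum>i\<in>UNIV. h $ i *\<^sub>R L (axis i 1))"
    by (simp add: linear_sum[OF assms] linear_cmul[OF assms])
  finally show ?thesis .
qed

lemma has_derivative_grad_at:
  fixes f :: "real^'n \<Rightarrow> real"
  assumes "f differentiable (at x)"
  shows "(f has_derivative (\<lambda>h. grad f x \<bullet> h)) (at x)"
proof -
  have d: "(f has_derivative frechet_derivative f (at x)) (at x)"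
    using assms by (simp add: frechet_derivative_works)
  have "frechet_derivative f (at x) h = grad f x \<bullet> h" for h
    by (subst linear_cart_sum[OF has_derivative_linear[OF d]]) (simp add: inner_vec_def grad_component mult.commute)
  then have "frechet_derivative f (at x) = (\<lambda>h. grad f x \<bullet> h)" by auto
  with d show ?thesis by simp
qed

lemma smooth_on_grad_component:
  "smooth_on f UNIV \<Longrightarrow> smooth_on (\<lambda>x. grad f x $ i) UNIV"
  unfolding grad_component by (rule smooth_on_frechet_derivative)

lemma hessian_component:
  fixes f :: "real^'n \<Rightarrow> real"
  assumes "smooth_on f UNIV"
  shows "hessian f x $ i $ j = frechet_derivative (\<lambda>x. grad f x $ i) (at x) (axis j 1)"
    and "(grad f has_derivative (\<lambda>h. hessian f x *v h)) (at x)"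
proof -
  have d: "((\<lambda>x. grad f x $ i) has_derivative frechet_derivative (\<lambda>x. grad f x $ i) (at x)) (at x)" for i
    using smooth_on_imp_has_derivative[OF smooth_on_grad_component[OF assms]] by simp
  have D: "(grad f has_derivative (\<lambda>h. \<chi> i. frechet_derivative (\<lambda>x. grad f x $ i) (at x) h)) (at x)"
    unfolding has_derivative_componentwise_within[of "grad f"]
    using d by (auto simp: Basis_vec_def inner_axis)
  then have eq: "frechet_derivative (grad f) (at x) = (\<lambda>h. \<chi> i. frechet_derivative (\<lambda>x. grad f x $ i) (at x) h)"
    by (rule frechet_derivative_at[symmetric])
  show hess: "hessian f x $ i $ j = frechet_derivative (\<lambda>x. grad f x $ i) (at x) (axis j 1)" for i j
    by (simp add: hessian_def jacobian_def matrix_def eq)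
  have "(\<chi> i. frechet_derivative (\<lambda>x. grad f x $ i) (at x) h) = hessian f x *v h" for h
    using linear_cart_sum[OF has_derivative_linear[OF d], of _ h]
    by (simp add: vec_eq_iff matrix_vector_mult_def hess mult.commute)
  with D show "(grad f has_derivative (\<lambda>h. hessian f x *v h)) (at x)" by simp
qed

lemma smooth_on_hessian_component:
  fixes f :: "real^'n \<Rightarrow> real"
  assumes "smooth_on f UNIV"
  shows "smooth_on (\<lambda>x. hessian f x $ i $ j) UNIV"
  unfolding hessian_component[OF assms]
  by (rule smooth_on_frechet_derivative) (rule smooth_on_grad_component[OF assms])

lemma hessian_symmetric:
  fixes f :: "real^'n \<Rightarrow> real"
  assumes "smooth_on f UNIV"
  shows "hessian f x $ i $ j = hessian f x $ j $ i"
  unfolding hessian_component[OF assms] grad_component by (rule second_derivative_symmetric[OF assms])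

definition third_derivative :: "(real^'n \<Rightarrow> real) \<Rightarrow> real^'n \<Rightarrow> 'n \<Rightarrow> 'n \<Rightarrow> 'n \<Rightarrow> real" where
  "third_derivative f x i j k = frechet_derivative (\<lambda>x. hessian f x $ i $ j) (at x) (axis k 1)"

lemma hessian_has_derivative:
  fixes f :: "real^'n \<Rightarrow> real"
  assumes "smooth_on f UNIV"
  shows "((\<lambda>x. hessian f x $ i $ j) has_derivative (\<lambda>h. \<Sum>k\<in>UNIV. third_derivative f x i j k * h $ k)) (at x)"
proof -
  have d: "((\<lambda>x. hessian f x $ i $ j) has_derivative frechet_derivative (\<lambda>x. hessian f x $ i $ j) (at x)) (at x)"
    using smooth_on_imp_has_derivative[OF smooth_on_hessian_component[OF assms]] by simp
  have "frechet_derivative (\<lambda>x. hessian f x $ i $ j) (at x) h = (\<Sum>k\<in>UNIV. third_derivative f x i j k * h $ k)" for h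
    by (subst linear_cart_sum[OF has_derivative_linear[OF d]]) (simp add: third_derivative_def mult.commute)
  then have "frechet_derivative (\<lambda>x. hessian f x $ i $ j) (at x) = (\<lambda>h. \<Sum>k\<in>UNIV. third_derivative f x i j k * h $ k)" by auto
  with d show ?thesis by simp
qed

lemma third_derivative_symmetric:
  fixes f :: "real^'n \<Rightarrow> real"
  assumes "smooth_on f UNIV"
  shows "third_derivative f x i j k = third_derivative f x i k j"
  unfolding third_derivative_def hessian_component[OF assms]
  by (rule second_derivative_symmetric[OF smooth_on_grad_component[OF assms]])

lemma continuous_third_derivative:
  fixes f :: "real^'n \<Rightarrow> real"
  assumes "smooth_on f UNIV"
  shows "continuous_on S (\<lambda>x. third_derivative f x i j k)"
  unfolding third_derivative_def
  by (rule continuous_on_subset[OF smooth_on_imp_continuous_on[OF smooth_on_frechet_derivative[OF smooth_on_hessian_component[OF assms]]]]) simp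

text \<open>Convexity bounds the forward difference quotients along the segment by
  \<open>f y - f x\<close>, and their limit is the directional derivative.\<close>

lemma convex_on_tangent:
  fixes f :: "'a::real_normed_vector \<Rightarrow> real"
  assumes conv: "convex_on S f" and xy: "x \<in> S" "y \<in> S" and d: "(f has_derivative D) (at x)"
  shows "f x + D (y - x) \<le> f y"
proof -
  have "((\<lambda>t. f (x + t *\<^sub>R (y - x))) has_derivative (\<lambda>h. D (h *\<^sub>R (y - x)))) (at 0)"
    by (rule has_derivative_compose[of "\<lambda>t. x + t *\<^sub>R (y - x)" _ 0 UNIV f D])
      (use d in \<open>auto intro!: derivative_eq_intros\<close>)
  then have "((\<lambda>t. f (x + t *\<^sub>R (y - x))) has_real_derivative D (y - x)) (at 0)"
    by (intro has_real_derivative_of_scaled) (simp add: linear_cmul[OF has_derivative_linear[OF d]])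
  then have "((\<lambda>t. (f (x + t *\<^sub>R (y - x)) - f x) / t) \<longlongrightarrow> D (y - x)) (at_right 0)"
    unfolding DERIV_def by (simp add: filterlim_at_split)
  moreover have "\<forall>\<^sub>F t in at_right (0::real). (f (x + t *\<^sub>R (y - x)) - f x) / t \<le> f y - f x"
    unfolding eventually_at_right_field
  proof (intro exI[of _ 1] conjI allI impI)
    fix t :: real assume t: "0 < t" "t < 1"
    have "f ((1 - t) *\<^sub>R x + t *\<^sub>R y) \<le> (1 - t) * f x + t * f y"
      by (rule convex_onD[OF conv]) (use t xy in auto)
    moreover have "(1 - t) *\<^sub>R x + t *\<^sub>R y = x + t *\<^sub>R (y - x)" by (simp add: algebra_simps)
    ultimately show "(f (x + t *\<^sub>R (y - x)) - f x) / t \<le> f y - f x"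
      using t by (simp only: pos_divide_le_eq) (simp add: algebra_simps)
  qed simp
  ultimately have "D (y - x) \<le> f y - f x"
    by (rule tendsto_upperbound) simp
  then show ?thesis by simp
qed

section \<open>The moment map\<close>

lemma linear_eq_matrix_mult:
  fixes L :: "real^'n \<Rightarrow> real^'m"
  assumes "linear L"
  shows "L h = matrix L *v h"
  by (subst linear_cart_sum[OF assms]) (simp add: vec_eq_iff matrix_vector_mult_def matrix_def mult.commute)

lemma continuous_on_det:
  fixes A :: "'a::topological_space \<Rightarrow> real^'n^'n"
  assumes "\<And>i j. continuous_on S (\<lambda>x. A x $ i $ j)"
  shows "continuous_on S (\<lambda>x. det (A x))"
  unfolding det_def by (intro continuous_intros assms)

lemma continuous_on_matrix_vector:
  fixes A :: "'a::topological_space \<Rightarrow> real^'n^'m"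
  assumes "\<And>i j. continuous_on S (\<lambda>x. A x $ i $ j)" "continuous_on S v"
  shows "continuous_on S (\<lambda>x. A x *v v x)"
  unfolding matrix_vector_mult_def
  by (rule continuous_on_vec_lambda) (intro continuous_intros assms)

text \<open>A zero of a nonnegative form is a minimum of it, so the first variation in the direction
  of \<open>A *v v\<close> vanishes there.\<close>

lemma psd_zero_imp_kernel:
  fixes A :: "real^'n^'n"
  assumes sym: "transpose A = A" and psd: "\<And>v. 0 \<le> v \<bullet> (A *v v)" and v: "v \<bullet> (A *v v) = 0"
  shows "A *v v = 0"
proof -
  define w where "w = A *v v"
  have "w \<bullet> w = 0"
  proof (rule quadratic_nonpos_imp_zero[where c = "- (w \<bullet> (A *v w))"])
    fix t :: real
    have "0 \<le> (v - t *\<^sub>R w) \<bullet> (A *v (v - t *\<^sub>R w))" by (rule psd)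
    also have "\<dots> = - 2 * t * (w \<bullet> w) + t\<^sup>2 * (w \<bullet> (A *v w))"
      using v symmetric_matrix_inner[OF sym, of v w]
      by (simp add: matrix_vector_mult_diff_distrib matrix_vector_mult_scaleR inner_diff_left inner_diff_right
          w_def[symmetric] power2_eq_square algebra_simps)
    finally show "2 * t * (w \<bullet> w) + t\<^sup>2 * - (w \<bullet> (A *v w)) \<le> 0" by simp
  qed simp
  then show ?thesis by (simp add: w_def)
qed

locale moment_map =
  fixes K :: "(real^'n) set" and V \<psi> :: "real^'n \<Rightarrow> real" and \<mu> :: "(real^'n) measure"
  assumes target: "regular_isotropic_log_concave_target K V \<mu>"
    and potential: "moment_potential K \<mu> \<psi>"
begin

abbreviation F :: "real^'n \<Rightarrow> real^'n" where "F \<equiv> grad \<psi>"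
abbreviation H :: "real^'n \<Rightarrow> real^'n^'n" where "H \<equiv> hessian \<psi>"

lemma smooth_psi: "smooth_on \<psi> UNIV"
  using potential by (simp add: moment_potential_def)

lemma psi_has_derivative: "(\<psi> has_derivative (\<lambda>h. F x \<bullet> h)) (at x)"
  by (rule has_derivative_grad_at[OF smooth_on_imp_differentiable[OF smooth_psi]]) simp

lemma F_has_derivative: "(F has_derivative (\<lambda>h. H x *v h)) (at x)"
  by (rule hessian_component(2)[OF smooth_psi])

lemma H_transpose: "transpose (H x) = H x"
  by (simp add: transpose_def vec_eq_iff hessian_symmetric[OF smooth_psi, of x])

lemma continuous_psi: "continuous_on S \<psi>"
  by (rule continuous_on_subset[OF smooth_on_imp_continuous_on[OF smooth_psi]]) simp

lemma continuous_F: "continuous_on S F"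
  using F_has_derivative by (meson continuous_at_imp_continuous_on has_derivative_continuous)

lemma continuous_H: "continuous_on S (\<lambda>x. H x $ i $ j)"
  by (rule continuous_on_subset[OF smooth_on_imp_continuous_on[OF smooth_on_hessian_component[OF smooth_psi]]]) simp

lemma borel_measurable_F [measurable]: "F \<in> borel_measurable borel"
  by (rule borel_measurable_continuous_onI[OF continuous_F])

lemma borel_measurable_psi [measurable]: "\<psi> \<in> borel_measurable borel"
  by (rule borel_measurable_continuous_onI[OF continuous_psi])

lemma K_props: "open K" "bounded K" "convex K"
  using target by (auto simp: regular_isotropic_log_concave_target_def)

lemma K_borel [measurable]: "K \<in> sets borel"
  using K_props by simp

lemma V_regular: "\<exists>N. open N \<and> closure K \<subseteq> N \<and> smooth_on V N \<and> convex_on N V"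
  using target by (simp add: regular_isotropic_log_concave_target_def)

lemma V_has_derivative_K:
  assumes "y \<in> K" shows "(V has_derivative frechet_derivative V (at y)) (at y)"
proof -
  obtain N where N: "closure K \<subseteq> N" "smooth_on V N" using V_regular by blast
  show ?thesis by (rule smooth_on_imp_has_derivative[OF N(2)]) (use assms N(1) closure_subset[of K] in blast)
qed

lemma continuous_V: "continuous_on K V"
  using V_has_derivative_K by (meson continuous_at_imp_continuous_on has_derivative_continuous)

lemma mu_eq: "\<mu> = density lborel (\<lambda>y. ennreal (exp (- V y) * indicator K y))"
  using target by (simp add: regular_isotropic_log_concave_target_def)

lemma exp_psi_integral: "(\<integral>u. exp (- \<psi> u) \<partial>lborel) = 1"
  using potential by (simp add: moment_potential_def)

lemma exp_psi_integrable: "integrable lborel (\<lambda>u. exp (- \<psi> u))"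
  using exp_psi_integral not_integrable_integral_eq by fastforce

lemma pushforward: "distr (density lborel (\<lambda>u. ennreal (exp (- \<psi> u)))) borel F = \<mu>"
  using potential by (simp add: moment_potential_def)

text \<open>The inverse of the gradient map, classically the gradient of the Legendre transform of
  \<psi>. It gives the coordinates in which the target is log-concave.\<close>

definition g :: "real^'n \<Rightarrow> real^'n" where
  "g = (SOME g. homeomorphism UNIV K F g \<and> smooth_on g K)"

lemma g_props: "homeomorphism UNIV K F g" "smooth_on g K"
proof -
  have "\<exists>g. homeomorphism UNIV K F g \<and> smooth_on g K"
    using potential by (auto simp: moment_potential_def diffeomorphism_def)
  then have "homeomorphism UNIV K F g \<and> smooth_on g K" unfolding g_def by (rule someI_ex)
  then show "homeomorphism UNIV K F g" "smooth_on g K" by auto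
qed

lemma F_in_K: "F x \<in> K"
  using g_props(1) by (auto simp: homeomorphism_def)

lemma g_F: "g (F x) = x"
  using g_props(1) by (auto simp: homeomorphism_def)

lemma F_g: "y \<in> K \<Longrightarrow> F (g y) = y"
  using g_props(1) by (auto simp: homeomorphism_def)

lemma inj_F: "inj F"
  by (metis g_F injI)

lemma continuous_g: "continuous_on K g"
  using g_props(1) by (auto simp: homeomorphism_def)

text \<open>The inverse matrix of \<open>H x\<close>, taken as the derivative of the inverse map so
  that its continuity follows from the smoothness of \<open>g\<close>.\<close>

definition G :: "real^'n \<Rightarrow> real^'n^'n" where
  "G x = matrix (frechet_derivative g (at (F x)))"

lemma g_has_derivative: "(g has_derivative (\<lambda>h. G x *v h)) (at (F x))"
proof -
  have d: "(g has_derivative frechet_derivative g (at (F x))) (at (F x))"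
    by (rule smooth_on_imp_has_derivative[OF g_props(2) F_in_K])
  have "frechet_derivative g (at (F x)) = (\<lambda>h. G x *v h)"
    unfolding G_def using linear_eq_matrix_mult[OF has_derivative_linear[OF d]] by auto
  with d show ?thesis by simp
qed

lemma G_H: "G x ** H x = mat 1"
proof -
  have "((\<lambda>x. g (F x)) has_derivative (\<lambda>h. G x *v (H x *v h))) (at x)"
    by (rule has_derivative_compose[OF F_has_derivative g_has_derivative])
  then have "((\<lambda>x. x) has_derivative (\<lambda>h. G x *v (H x *v h))) (at x)" by (simp add: g_F)
  moreover have "((\<lambda>x. x) has_derivative (\<lambda>h. h)) (at x)" by (rule has_derivative_ident)
  ultimately have "(\<lambda>h. G x *v (H x *v h)) = (\<lambda>h. h)" by (rule has_derivative_unique)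
  then have "(G x ** H x) *v h = mat 1 *v h" for h by (simp add: matrix_vector_mul_assoc fun_eq_iff)
  then show ?thesis by (simp add: matrix_eq)
qed

lemma H_G: "H x ** G x = mat 1"
  using G_H by (simp add: matrix_left_right_inverse)

lemma H_G_vec: "H x *v (G x *v v) = v" and G_H_vec: "G x *v (H x *v v) = v"
  by (simp_all add: matrix_vector_mul_assoc H_G G_H)

lemma continuous_G: "continuous_on S (\<lambda>x. G x $ i $ j)"
proof -
  have "continuous_on K (\<lambda>y. frechet_derivative g (at y) (axis j 1) $ i)"
    by (intro continuous_intros smooth_on_imp_continuous_on smooth_on_frechet_derivative g_props)
  then have "continuous_on S (\<lambda>x. frechet_derivative g (at (F x)) (axis j 1) $ i)"
    by (rule continuous_on_compose2[OF _ continuous_F]) (use F_in_K in auto)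
  then show ?thesis by (simp add: G_def matrix_def)
qed

lemma psi_convex: "convex_on UNIV \<psi>"
proof (rule convex_onI)
  have *: "strictly_convex_on UNIV \<psi>" using potential by (simp add: moment_potential_def)
  fix t :: real and x y assume t: "0 < t" "t < 1"
  show "\<psi> ((1 - t) *\<^sub>R x + t *\<^sub>R y) \<le> (1 - t) * \<psi> x + t * \<psi> y"
  proof (cases "x = y")
    case True then show ?thesis by (simp add: algebra_simps)
  next
    case False
    then have "\<psi> ((1 - t) *\<^sub>R x + t *\<^sub>R y) < (1 - t) * \<psi> x + t * \<psi> y"
      using * t unfolding strictly_convex_on_def by auto
    then show ?thesis by simp
  qed
qed simp

lemma psi_tangent: "\<psi> x + F x \<bullet> (y - x) \<le> \<psi> y"
  by (rule convex_on_tangent[OF psi_convex _ _ psi_has_derivative]) auto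

lemma F_monotone: "0 \<le> (F y - F x) \<bullet> (y - x)"
  using psi_tangent[of x y] psi_tangent[of y x] by (simp add: inner_diff_left inner_diff_right)

text \<open>The gradient of a convex function is monotone, so \<open>p\<close> is nondecreasing on
  each line, and its derivative is the form.\<close>

lemma H_psd: "0 \<le> v \<bullet> (H x *v v)"
proof -
  define p where "p t = F (x + t *\<^sub>R v) \<bullet> v" for t
  have "((\<lambda>t. F (x + t *\<^sub>R v)) has_derivative (\<lambda>h. H (x + 0 *\<^sub>R v) *v (h *\<^sub>R v))) (at 0)"
    by (rule has_derivative_compose[OF _ F_has_derivative]) (auto intro!: derivative_eq_intros)
  from has_derivative_inner_left[OF this, of v]
  have "(p has_real_derivative (H x *v v) \<bullet> v) (at 0)"
    unfolding p_def by (intro has_real_derivative_of_scaled) (simp add: matrix_vector_mult_scaleR)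
  moreover have "mono_on UNIV p"
  proof (rule mono_onI)
    fix s t :: real assume "s \<le> t"
    have "0 \<le> (F (x + t *\<^sub>R v) - F (x + s *\<^sub>R v)) \<bullet> ((x + t *\<^sub>R v) - (x + s *\<^sub>R v))" by (rule F_monotone)
    also have "\<dots> = (t - s) * (p t - p s)"
      by (simp add: p_def scaleR_diff_left[symmetric] inner_diff_left)
    finally show "p s \<le> p t" using \<open>s \<le> t\<close> by (cases "s = t") (auto simp: zero_le_mult_iff)
  qed
  ultimately have "0 \<le> (H x *v v) \<bullet> v" using mono_on_imp_deriv_nonneg[of UNIV p] by simp
  then show ?thesis by (simp add: inner_commute)
qed

text \<open>Strict convexity alone would allow a degenerate Hessian at some points. Definiteness
  comes from the smooth inverse of the gradient map, which makes \<open>H x\<close>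
  invertible.\<close>

lemma H_pos_def: "pos_def (H x)"
  unfolding pos_def_def
proof (intro conjI allI impI H_transpose)
  fix v :: "real^'n" assume v: "v \<noteq> 0"
  have "v \<bullet> (H x *v v) \<noteq> 0"
  proof
    assume "v \<bullet> (H x *v v) = 0"
    then have "H x *v v = 0" by (rule psd_zero_imp_kernel[OF H_transpose H_psd])
    then show False using v G_H_vec[of x v] by simp
  qed
  with H_psd[of v x] show "0 < v \<bullet> (H x *v v)" by simp
qed

lemma G_transpose: "transpose (G x) = G x"
proof -
  have "H x ** transpose (G x) = mat 1"
    by (metis G_H H_transpose matrix_transpose_mul transpose_mat)
  then show ?thesis by (metis G_H matrix_mul_assoc matrix_mul_lid matrix_mul_rid)
qed

lemma G_psd: "0 \<le> v \<bullet> (G x *v v)"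
  using H_psd[of "G x *v v" x] by (simp add: H_G_vec inner_commute)

text \<open>The squared length of a covector in the metric \<open>\<nabla>\<^sup>2\<psi>\<close>.\<close>

definition costar :: "real^'n \<Rightarrow> real^'n \<Rightarrow> real" where
  "costar x v = v \<bullet> (G x *v v)"

lemma costar_nonneg: "0 \<le> costar x v"
  by (simp add: costar_def G_psd)

lemma costar_add: "costar x (u + v) = costar x u + 2 * (u \<bullet> (G x *v v)) + costar x v"
  using symmetric_matrix_inner[OF G_transpose, of x u v]
  by (simp add: costar_def matrix_vector_right_distrib inner_add_left inner_add_right inner_commute algebra_simps)

lemma costar_scale: "costar x (c *\<^sub>R v) = c\<^sup>2 * costar x v"
  by (simp add: costar_def matrix_vector_mult_scaleR power2_eq_square)

lemma costar_H: "costar x (H x *v v) = v \<bullet> (H x *v v)"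
  by (simp add: costar_def G_H_vec inner_commute)

text \<open>Cauchy-Schwarz with free weights \<open>a\<close> and \<open>b\<close>, in the form in
  which cross terms are absorbed in the energy estimates.\<close>

lemma costar_mixed: "0 \<le> a\<^sup>2 * costar x u + 2 * a * b * (u \<bullet> (G x *v v)) + b\<^sup>2 * costar x v"
  using costar_nonneg[of x "a *\<^sub>R u + b *\<^sub>R v"]
  by (simp add: costar_add costar_scale matrix_vector_mult_scaleR mult_ac)

text \<open>The version for a vector \<open>v\<close> paired with a covector \<open>D\<close>:
  lowering \<open>v\<close> to \<open>H x *v v\<close> turns its dual norm into the Hessian form and
  the mixed term into \<open>v \<bullet> D\<close>.\<close>

lemma costar_mixed_H: "0 \<le> a\<^sup>2 * (v \<bullet> (H x *v v)) + 2 * a * b * (v \<bullet> D) + b\<^sup>2 * costar x D"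
  using costar_mixed[of a x "H x *v v" b D] symmetric_matrix_inner[OF H_transpose, of x v "G x *v D"]
  by (simp add: costar_H H_G_vec)

lemma F_bounded: obtains R where "R > 0" "\<And>x. norm (F x) \<le> R"
  using K_props(2) F_in_K unfolding bounded_pos by metis

section \<open>The Monge-Ampere equation\<close>

lemma emeasure_image_F:
  assumes S: "compact S"
  shows "(\<integral>\<^sup>+x. ennreal (exp (- \<psi> x)) * indicator S x \<partial>lborel)
     = (\<integral>\<^sup>+y. ennreal (exp (- V y)) * indicator (F ` S) y \<partial>lborel)"
proof -
  have cF: "compact (F ` S)" by (intro compact_continuous_image continuous_F S)
  then have [measurable]: "F ` S \<in> sets borel" by (intro borel_closed compact_imp_closed)
  have [measurable]: "S \<in> sets borel" using S by (intro borel_closed compact_imp_closed)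
  have "(\<lambda>y. indicator K y *\<^sub>R exp (- V y)) \<in> borel_measurable borel"
    by (intro borel_measurable_continuous_on_indicator) (auto intro!: continuous_intros continuous_V)
  then have m: "(\<lambda>y. ennreal (exp (- V y) * indicator K y)) \<in> borel_measurable borel"
    by (simp add: mult.commute)
  have "emeasure \<mu> (F ` S) = (\<integral>\<^sup>+y. ennreal (exp (- V y) * indicator K y) * indicator (F ` S) y \<partial>lborel)"
    unfolding mu_eq using m by (subst emeasure_density) auto
  also have "\<dots> = (\<integral>\<^sup>+y. ennreal (exp (- V y)) * indicator (F ` S) y \<partial>lborel)"
    by (intro nn_integral_cong) (use F_in_K in \<open>auto simp: indicator_def\<close>)
  finally have 1: "emeasure \<mu> (F ` S) = \<dots>" .
  have "emeasure \<mu> (F ` S) = emeasure (density lborel (\<lambda>u. ennreal (exp (- \<psi> u)))) (F -` (F ` S))"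
    unfolding pushforward[symmetric] by (subst emeasure_distr) auto
  also have "F -` (F ` S) = S" using inj_F by (simp add: inj_vimage_image_eq)
  also have "emeasure (density lborel (\<lambda>u. ennreal (exp (- \<psi> u)))) S = (\<integral>\<^sup>+x. ennreal (exp (- \<psi> x)) * indicator S x \<partial>lborel)"
    by (subst emeasure_density) auto
  finally show ?thesis using 1 by simp
qed

lemma V_tangent:
  assumes "x \<in> K" "y \<in> K" shows "V x + frechet_derivative V (at x) (y - x) \<le> V y"
proof -
  obtain N where N: "closure K \<subseteq> N" "convex_on N V" using V_regular by blast
  have "x \<in> N" "y \<in> N" using assms N(1) closure_subset[of K] by blast+
  then show ?thesis by (rule convex_on_tangent[OF N(2) _ _ V_has_derivative_K[OF assms(1)]])
qed

text \<open>\<open>V\<close> is regular on a neighbourhood of the compact closure of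
  \<open>K\<close>, so the target density stays bounded up to the boundary.\<close>

lemma exp_V_bounded: obtains M where "M > 0" "\<And>y. y \<in> K \<Longrightarrow> exp (- V y) \<le> M"
proof -
  obtain N where N: "closure K \<subseteq> N" "smooth_on V N" using V_regular by blast
  have "continuous_on (closure K) (\<lambda>y. exp (- V y))"
    by (intro continuous_intros continuous_on_subset[OF smooth_on_imp_continuous_on[OF N(2)] N(1)])
  moreover have "compact (closure K)" using K_props by simp
  ultimately have "bounded ((\<lambda>y. exp (- V y)) ` closure K)" by (intro compact_imp_bounded compact_continuous_image)
  then obtain M where "M > 0" "\<And>y. y \<in> closure K \<Longrightarrow> norm (exp (- V y)) \<le> M"
    unfolding bounded_pos by auto
  then show ?thesis using that[of M] closure_subset[of K] by force
qed

lemma continuous_det_H: "continuous_on S (\<lambda>x. det (H x))"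
  by (intro continuous_on_det continuous_H)

lemma det_H_pos: "0 < det (H x)"
  by (rule det_pos_def[OF H_pos_def])

lemma volume_image_F:
  assumes S: "compact S"
  shows "emeasure lborel (F ` S) = (\<integral>\<^sup>+x. ennreal (det (H x)) * indicator S x \<partial>lborel)"
proof -
  have "(\<lambda>x. det (H x)) \<in> borel_measurable borel"
    by (rule borel_measurable_continuous_onI[OF continuous_det_H])
  from emeasure_image_symmetric_derivative[OF F_has_derivative H_transpose inj_F S this]
  show ?thesis using det_H_pos by (simp add: abs_of_pos)
qed

text \<open>The mass that the target gives to the image of a small ball is computed in two ways:
  from the density of the source, and from the density of the target by the change of variables. All
  three factors are continuous, so a strict inequality at \<open>x\<close> would persist on a ball
  of positive finite volume and contradict the equality of masses. The equation therefore holds at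
  every point and not just almost everywhere.\<close>

lemma monge_ampere: "exp (- \<psi> x) = exp (- V (F x)) * det (H x)"
proof -
  define a where "a = (\<lambda>x. exp (- \<psi> x))"
  define b where "b = (\<lambda>x. exp (- V (F x)))"
  define d where "d = (\<lambda>x. det (H x))"
  have contb: "isCont b x"
  proof -
    have "continuous_on UNIV b" unfolding b_def
      by (intro continuous_intros continuous_on_compose2[OF continuous_V continuous_F]) (use F_in_K in auto)
    then show ?thesis by (simp add: continuous_on_eq_continuous_at)
  qed
  have conta: "isCont a x"
    using continuous_on_exp[OF continuous_on_minus[OF continuous_psi[of UNIV]]]
    by (simp add: a_def continuous_on_eq_continuous_at)
  have contd: "isCont d x"
    using continuous_det_H[of UNIV] by (simp add: d_def continuous_on_eq_continuous_at)
  have pos: "a x > 0" "b x > 0" "d x > 0" by (auto simp: a_def b_def d_def det_H_pos)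
  have near: "\<exists>r>0. \<forall>z\<in>cball x r. \<bar>u z - u x\<bar> < e" if "isCont u x" "e > 0" for u :: "_ \<Rightarrow> real" and e
  proof -
    from that(1) have "\<forall>e>0. \<exists>d>0. \<forall>z. dist z x < d \<longrightarrow> dist (u z) (u x) < e"
      by (simp only: continuous_at_eps_delta)
    with that(2) obtain s where s: "s > 0" "\<forall>z. dist z x < s \<longrightarrow> dist (u z) (u x) < e" by blast
    have "\<bar>u z - u x\<bar> < e" if "z \<in> cball x (s/2)" for z
      using s(2)[rule_format, of z] that \<open>s > 0\<close> by (simp add: dist_commute dist_real_def)
    then show ?thesis using \<open>s > 0\<close> by (intro exI[of _ "s/2"]) auto
  qed
  have ball: "\<exists>S. compact S \<and> emeasure lborel S \<noteq> 0 \<and> emeasure lborel S \<noteq> \<top> \<and>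
      (\<forall>z\<in>S. \<bar>a z - a x\<bar> < e \<and> \<bar>b z - b x\<bar> < e \<and> \<bar>d z - d x\<bar> < e)" if e0: "e > 0" for e
  proof -
    obtain r1 where r1: "r1 > 0" "\<forall>z\<in>cball x r1. \<bar>a z - a x\<bar> < e" using near[OF conta e0] by blast
    obtain r2 where r2: "r2 > 0" "\<forall>z\<in>cball x r2. \<bar>b z - b x\<bar> < e" using near[OF contb e0] by blast
    obtain r3 where r3: "r3 > 0" "\<forall>z\<in>cball x r3. \<bar>d z - d x\<bar> < e" using near[OF contd e0] by blast
    note r = r1 r2 r3
    define r where "r = min r1 (min r2 r3)"
    have "r > 0" using r by (simp add: r_def)
    have "emeasure lborel (cball x r) \<noteq> 0"
    proof -
      have "0 < measure lborel (cball x r)" using \<open>r > 0\<close> by (rule content_cball_pos)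
      then show ?thesis by (auto simp: measure_def)
    qed
    moreover have "emeasure lborel (cball x r) \<noteq> \<top>"
      using emeasure_bounded_finite[of "cball x r"] by (simp add: less_top)
    ultimately show ?thesis using r by (intro exI[of _ "cball x r"]) (auto simp: r_def)
  qed
  have upper: "\<not> b x * d x < a x"
  proof
    assume lt: "b x * d x < a x"
    \<comment> \<open>The margin \<open>e\<close> is chosen so small that the strict inequality
      survives a change of all three values by \<open>e\<close>.\<close>
    have "((\<lambda>e. a x - e - (b x + e) * (d x + e)) \<longlongrightarrow> a x - 0 - (b x + 0) * (d x + 0)) (at_right 0)"
      by (intro tendsto_intros)
    then have "\<forall>\<^sub>F e in at_right 0. 0 < a x - e - (b x + e) * (d x + e)"
      by (rule order_tendstoD) (use lt in simp)
    moreover have "\<forall>\<^sub>F e in at_right (0::real). 0 < e" by (rule eventually_at_right_less)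
    ultimately have "\<exists>e>0. 0 < a x - e - (b x + e) * (d x + e)"
      by (metis (mono_tags, lifting) eventually_conj eventually_happens' trivial_limit_at_right_real)
    then obtain e where e: "e > 0" "(b x + e) * (d x + e) < a x - e" by auto
    obtain S where S: "compact S" "emeasure lborel S \<noteq> 0" "emeasure lborel S \<noteq> \<top>"
      "\<And>z. z \<in> S \<Longrightarrow> \<bar>a z - a x\<bar> < e \<and> \<bar>b z - b x\<bar> < e \<and> \<bar>d z - d x\<bar> < e" using ball[OF e(1)] by blast
    have [measurable]: "S \<in> sets borel" using S by (intro borel_closed compact_imp_closed)
    have [measurable]: "F ` S \<in> sets borel" by (intro borel_closed compact_imp_closed compact_continuous_image continuous_F S)
    have [measurable]: "d \<in> borel_measurable borel" unfolding d_def by (rule borel_measurable_continuous_onI[OF continuous_det_H])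
    have "ennreal (a x - e) * emeasure lborel S = (\<integral>\<^sup>+z. ennreal (a x - e) * indicator S z \<partial>lborel)"
      by (simp add: nn_integral_cmult)
    also have "\<dots> \<le> (\<integral>\<^sup>+z. ennreal (a z) * indicator S z \<partial>lborel)"
      by (intro nn_integral_mono) (use S(4) in \<open>force simp: indicator_def intro!: ennreal_leI\<close>)
    also have "\<dots> = (\<integral>\<^sup>+y. ennreal (exp (- V y)) * indicator (F ` S) y \<partial>lborel)"
      unfolding a_def by (rule emeasure_image_F[OF S(1)])
    also have "\<dots> \<le> (\<integral>\<^sup>+y. ennreal (b x + e) * indicator (F ` S) y \<partial>lborel)"
      by (intro nn_integral_mono) (use S(4) in \<open>force simp: indicator_def b_def intro!: ennreal_leI\<close>)
    also have "\<dots> = ennreal (b x + e) * emeasure lborel (F ` S)" by (simp add: nn_integral_cmult)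
    also have "\<dots> = ennreal (b x + e) * (\<integral>\<^sup>+z. ennreal (d z) * indicator S z \<partial>lborel)"
      unfolding volume_image_F[OF S(1)] d_def ..
    also have "\<dots> \<le> ennreal (b x + e) * (\<integral>\<^sup>+z. ennreal (d x + e) * indicator S z \<partial>lborel)"
      by (intro mult_left_mono nn_integral_mono) (use S(4) in \<open>force simp: indicator_def intro!: ennreal_leI\<close>)+
    also have "\<dots> = ennreal ((b x + e) * (d x + e)) * emeasure lborel S"
      using pos e by (simp add: nn_integral_cmult ennreal_mult' mult.assoc)
    finally have "ennreal (a x - e) \<le> ennreal ((b x + e) * (d x + e))"
      using S(2,3) by (simp add: ennreal_mult_le_mult_iff mult.commute[of _ "emeasure lborel S"])
    moreover have "0 \<le> (b x + e) * (d x + e)" using pos e by simp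
    ultimately have "a x - e \<le> (b x + e) * (d x + e)" by (simp add: ennreal_le_iff)
    with e show False by simp
  qed
  have lower: "\<not> a x < b x * d x"
  proof
    assume lt: "a x < b x * d x"
    have t1: "((\<lambda>e. (b x - e) * (d x - e) - (a x + e)) \<longlongrightarrow> (b x - 0) * (d x - 0) - (a x + 0)) (at_right 0)"
      and t2: "((\<lambda>e. b x - e) \<longlongrightarrow> b x - 0) (at_right 0)" and t3: "((\<lambda>e. d x - e) \<longlongrightarrow> d x - 0) (at_right 0)"
      by (intro tendsto_intros)+
    have "\<forall>\<^sub>F e in at_right 0. 0 < (b x - e) * (d x - e) - (a x + e)"
      by (rule order_tendstoD[OF t1]) (use lt in simp)
    moreover have "\<forall>\<^sub>F e in at_right (0::real). 0 < e" by (rule eventually_at_right_less)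
    moreover have "\<forall>\<^sub>F e in at_right 0. 0 < b x - e" by (rule order_tendstoD[OF t2]) (use pos in simp)
    moreover have "\<forall>\<^sub>F e in at_right 0. 0 < d x - e" by (rule order_tendstoD[OF t3]) (use pos in simp)
    ultimately have "\<forall>\<^sub>F e in at_right 0. 0 < (b x - e) * (d x - e) - (a x + e) \<and> 0 < e \<and> 0 < b x - e \<and> 0 < d x - e"
      by (intro eventually_conj)
    then obtain e where e: "e > 0" "a x + e < (b x - e) * (d x - e)" "e < b x" "e < d x"
      by (metis (mono_tags, lifting) eventually_happens' trivial_limit_at_right_real diff_gt_0_iff_gt)
    obtain S where S: "compact S" "emeasure lborel S \<noteq> 0" "emeasure lborel S \<noteq> \<top>"
      "\<And>z. z \<in> S \<Longrightarrow> \<bar>a z - a x\<bar> < e \<and> \<bar>b z - b x\<bar> < e \<and> \<bar>d z - d x\<bar> < e" using ball[OF e(1)] by blast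
    have [measurable]: "S \<in> sets borel" using S by (intro borel_closed compact_imp_closed)
    have [measurable]: "F ` S \<in> sets borel" by (intro borel_closed compact_imp_closed compact_continuous_image continuous_F S)
    have [measurable]: "d \<in> borel_measurable borel" unfolding d_def by (rule borel_measurable_continuous_onI[OF continuous_det_H])
    have "ennreal ((b x - e) * (d x - e)) * emeasure lborel S
        = ennreal (b x - e) * (\<integral>\<^sup>+z. ennreal (d x - e) * indicator S z \<partial>lborel)"
      using pos e by (simp add: nn_integral_cmult ennreal_mult' mult.assoc)
    also have "\<dots> \<le> ennreal (b x - e) * (\<integral>\<^sup>+z. ennreal (d z) * indicator S z \<partial>lborel)"
      by (intro mult_left_mono nn_integral_mono) (use S(4) in \<open>force simp: indicator_def intro!: ennreal_leI\<close>)+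
    also have "\<dots> = ennreal (b x - e) * emeasure lborel (F ` S)"
      unfolding volume_image_F[OF S(1)] d_def ..
    also have "\<dots> = (\<integral>\<^sup>+y. ennreal (b x - e) * indicator (F ` S) y \<partial>lborel)" by (simp add: nn_integral_cmult)
    also have "\<dots> \<le> (\<integral>\<^sup>+y. ennreal (exp (- V y)) * indicator (F ` S) y \<partial>lborel)"
      by (intro nn_integral_mono) (use S(4) in \<open>force simp: indicator_def b_def intro!: ennreal_leI\<close>)
    also have "\<dots> = (\<integral>\<^sup>+z. ennreal (a z) * indicator S z \<partial>lborel)"
      unfolding a_def by (rule emeasure_image_F[OF S(1), symmetric])
    also have "\<dots> \<le> (\<integral>\<^sup>+z. ennreal (a x + e) * indicator S z \<partial>lborel)"
      by (intro nn_integral_mono) (use S(4) in \<open>force simp: indicator_def intro!: ennreal_leI\<close>)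
    also have "\<dots> = ennreal (a x + e) * emeasure lborel S"
      by (simp add: nn_integral_cmult)
    finally have "ennreal ((b x - e) * (d x - e)) \<le> ennreal (a x + e)"
      using S(2,3) by (simp add: ennreal_mult_le_mult_iff mult.commute[of _ "emeasure lborel S"])
    moreover have "0 \<le> a x + e" using pos e by simp
    ultimately have "(b x - e) * (d x - e) \<le> a x + e" by (simp add: ennreal_le_iff)
    with e show False by simp
  qed
  from upper lower show ?thesis by (simp add: a_def b_def d_def)
qed

lemma ln_det_H: "ln (det (H x)) = V (F x) - \<psi> x"
proof -
  have "det (H x) = exp (V (F x) - \<psi> x)"
    using monge_ampere[of x] by (simp add: exp_diff exp_minus field_simps)
  then show ?thesis by simp
qed

section \<open>Energy of Euclidean cutoffs in the Hessian metric\<close>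

lemma continuous_costar: "continuous_on S v \<Longrightarrow> continuous_on S (\<lambda>x. costar x (v x))"
  unfolding costar_def by (intro continuous_intros continuous_on_matrix_vector continuous_G)

text \<open>By the Monge-Ampere equation the weight contains the factor \<open>det (H x)\<close>,
  which turns \<open>costar\<close> into the cofactor form. The squared gradient of the cutoff is at
  most 16 / N^2 and the shift by \<open>t\<close> costs a factor \<open>N\<close>, so one power of
  \<open>1 / N\<close> survives; \<open>M\<close> bounds the target density and \<open>W\<close> is
  the volume of a fixed ball.\<close>

lemma cutoff_energy:
  obtains C where "0 \<le> C"
    "\<And>N. N \<ge> 1 \<Longrightarrow> (\<integral>x. exp (- \<psi> x) * costar x (cutoff_grad N x) \<partial>lborel) \<le> C / N"
proof -
  obtain R where R: "R > 0" "\<And>x. norm (F x) \<le> R" using F_bounded by metis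
  obtain M where M: "M > 0" "\<And>y. y \<in> K \<Longrightarrow> exp (- V y) \<le> M" using exp_V_bounded by metis
  define W where "W = measure lborel (cball (0 :: real^'n) (R + 1))"
  have W: "emeasure lborel (cball (0 :: real^'n) (R + 1)) = ennreal W"
    unfolding W_def using emeasure_bounded_finite[of "cball (0 :: real^'n) (R + 1)"]
    by (simp add: emeasure_eq_ennreal_measure less_top)
  have est: "(\<integral>x. exp (- \<psi> x) * costar x (cutoff_grad N x) \<partial>lborel) \<le> 16 * M * W / N" if N: "N \<ge> 1" for N
  proof -
    \<comment> \<open>This is the order of the largest shift for which \<open>P\<close> keeps the
      ball of radius \<open>N\<close> inside a fixed ball, here of radius
      \<open>R + 1\<close>.\<close>
    define t where "t = 1 / N"
    have t: "t > 0" "t * N = 1" using N by (auto simp: t_def)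
    define P where "P x = F x + t *\<^sub>R x" for x
    have dP: "(P has_derivative (\<lambda>h. (H x + t *\<^sub>R mat 1) *v h)) (at x)" for x
      unfolding P_def
      by (auto intro!: derivative_eq_intros F_has_derivative simp: matrix_vector_mult_add_rdistrib scaleR_matrix_vector_assoc[symmetric])
    have sP: "transpose (H x + t *\<^sub>R mat 1) = H x + t *\<^sub>R mat 1" for x
      using H_transpose[of x] by (simp add: transpose_def vec_eq_iff mat_def)
    \<comment> \<open>\<open>F\<close> is monotone, so adding a positive multiple of the identity
      makes it strictly monotone.\<close>
    have injP: "inj P"
    proof (rule injI)
      fix x y assume "P x = P y"
      then have eq: "F x - F y = t *\<^sub>R (y - x)" by (simp add: P_def algebra_simps)
      have "(F x - F y) \<bullet> (x - y) = - t * ((x - y) \<bullet> (x - y))"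
        unfolding eq by (simp add: inner_diff_left inner_diff_right algebra_simps)
      with F_monotone[of x y] t have "t * ((x - y) \<bullet> (x - y)) \<le> 0" by simp
      then have "(x - y) \<bullet> (x - y) \<le> 0" using t by (simp add: mult_le_0_iff)
      then have "(x - y) \<bullet> (x - y) = 0" by (intro antisym inner_ge_zero)
      then show "x = y" by simp
    qed
    have cdet: "continuous_on S (\<lambda>x. det (H x + t *\<^sub>R mat 1))" for S
      by (intro continuous_on_det) (auto simp: mat_def intro!: continuous_intros continuous_H)
    have mdet [measurable]: "(\<lambda>x. det (H x + t *\<^sub>R mat 1)) \<in> borel_measurable borel"
      by (rule borel_measurable_continuous_onI[OF cdet])
    have [measurable]: "cball (0 :: real^'n) N \<in> sets borel" by simp
    have pt: "exp (- \<psi> x) * costar x (cutoff_grad N x)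
        \<le> 16 * M / N * (\<bar>det (H x + t *\<^sub>R mat 1)\<bar> * indicator (cball 0 N) x)" for x
    proof (cases "x \<in> cball 0 N")
      case False
      then have "cutoff_grad N x = 0" using N by (intro cutoff_outside) auto
      then show ?thesis using False by (simp add: costar_def)
    next
      case True
      let ?v = "cutoff_grad N x"
      have "t * det (H x) * costar x ?v \<le> (norm ?v)\<^sup>2 * det (H x + t *\<^sub>R mat 1)"
        unfolding costar_def using det_mult_inverse_form_le[OF H_pos_def G_H] t by simp
      also have "\<dots> \<le> (norm ?v)\<^sup>2 * \<bar>det (H x + t *\<^sub>R mat 1)\<bar>" by (intro mult_left_mono) auto
      also have "\<dots> \<le> (4 / N)\<^sup>2 * \<bar>det (H x + t *\<^sub>R mat 1)\<bar>"
        using N by (intro mult_right_mono power_mono norm_cutoff_grad_le) auto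
      finally have "N * (t * det (H x) * costar x ?v) \<le> N * ((4 / N)\<^sup>2 * \<bar>det (H x + t *\<^sub>R mat 1)\<bar>)"
        using N by (intro mult_left_mono) auto
      moreover have "N * (t * det (H x) * costar x ?v) = det (H x) * costar x ?v"
        using t by (simp add: mult_ac)
      moreover have "N * ((4 / N)\<^sup>2 * \<bar>det (H x + t *\<^sub>R mat 1)\<bar>) = 16 / N * \<bar>det (H x + t *\<^sub>R mat 1)\<bar>"
        using N by (simp add: power2_eq_square)
      ultimately have *: "det (H x) * costar x ?v \<le> 16 / N * \<bar>det (H x + t *\<^sub>R mat 1)\<bar>" by simp
      have "exp (- \<psi> x) * costar x ?v = exp (- V (F x)) * (det (H x) * costar x ?v)"
        by (simp add: monge_ampere mult.assoc)
      also have "\<dots> \<le> M * (det (H x) * costar x ?v)"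
        using M(2)[OF F_in_K] costar_nonneg det_H_pos[of x] by (intro mult_right_mono) (auto intro: mult_nonneg_nonneg less_imp_le)
      also have "\<dots> \<le> M * (16 / N * \<bar>det (H x + t *\<^sub>R mat 1)\<bar>)" using * M(1) by (intro mult_left_mono) auto
      finally show ?thesis using True by (simp add: mult_ac)
    qed
    have cont: "continuous_on UNIV (\<lambda>x. exp (- \<psi> x) * costar x (cutoff_grad N x))"
      by (intro continuous_intros continuous_psi continuous_costar cutoff_grad_continuous)
    have int: "integrable lborel (\<lambda>x. exp (- \<psi> x) * costar x (cutoff_grad N x))"
      using cont by (rule integrable_compact_support[where r = N]) (use N in \<open>simp add: cutoff_outside costar_def\<close>)
    have "ennreal (\<integral>x. exp (- \<psi> x) * costar x (cutoff_grad N x) \<partial>lborel)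
       = (\<integral>\<^sup>+x. ennreal (exp (- \<psi> x) * costar x (cutoff_grad N x)) \<partial>lborel)"
      by (rule nn_integral_eq_integral[OF int, symmetric]) (simp add: costar_nonneg)
    also have "\<dots> \<le> (\<integral>\<^sup>+x. ennreal (16 * M / N) * (ennreal \<bar>det (H x + t *\<^sub>R mat 1)\<bar> * indicator (cball 0 N) x) \<partial>lborel)"
    proof (rule nn_integral_mono)
      fix x
      have "ennreal (exp (- \<psi> x) * costar x (cutoff_grad N x))
          \<le> ennreal (16 * M / N * (\<bar>det (H x + t *\<^sub>R mat 1)\<bar> * indicator (cball 0 N) x))"
        by (rule ennreal_leI[OF pt])
      also have "\<dots> = ennreal (16 * M / N) * (ennreal \<bar>det (H x + t *\<^sub>R mat 1)\<bar> * indicator (cball 0 N) x)"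
        using M N by (subst ennreal_mult') (auto simp: indicator_def)
      finally show "ennreal (exp (- \<psi> x) * costar x (cutoff_grad N x))
          \<le> ennreal (16 * M / N) * (ennreal \<bar>det (H x + t *\<^sub>R mat 1)\<bar> * indicator (cball 0 N) x)" .
    qed
    also have "\<dots> = ennreal (16 * M / N) * (\<integral>\<^sup>+x. ennreal \<bar>det (H x + t *\<^sub>R mat 1)\<bar> * indicator (cball 0 N) x \<partial>lborel)"
      by (intro nn_integral_cmult) measurable
    also have "\<dots> = ennreal (16 * M / N) * emeasure lborel (P ` cball 0 N)"
      using emeasure_image_symmetric_derivative[OF dP sP injP compact_cball mdet] by simp
    also have "\<dots> \<le> ennreal (16 * M / N) * emeasure lborel (cball (0 :: real^'n) (R + 1))"
    proof (intro mult_left_mono emeasure_mono)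
      show "P ` cball 0 N \<subseteq> cball 0 (R + 1)"
      proof safe
        fix x :: "real^'n" assume "x \<in> cball 0 N"
        then have "norm (t *\<^sub>R x) \<le> 1" using t by simp (metis mult_left_mono less_imp_le)
        then show "P x \<in> cball 0 (R + 1)"
          using norm_triangle_ineq[of "F x" "t *\<^sub>R x"] R(2)[of x] by (simp add: P_def)
      qed
    qed auto
    also have "\<dots> = ennreal (16 * M * W / N)" using M N W by (simp add: ennreal_mult'[symmetric] W_def)
    finally show ?thesis using M N by (subst (asm) ennreal_le_iff) (auto simp: W_def)
  qed
  show ?thesis by (rule that[OF _ est]) (use M in \<open>auto simp: W_def\<close>)
qed

end

section \<open>Subsolutions in the Hessian metric\<close>

lemma trace_eq_sum_inner: "trace A = (\<Sum>i\<in>UNIV. (A *v axis i 1) $ i)" for A :: "real^'n^'n"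
  by (simp add: trace_def matrix_vector_mult_basis column_def)

lemma sum_inner_axis: "(\<Sum>i\<in>UNIV. (u \<bullet> axis i 1) * (s $ i)) = u \<bullet> s" for u s :: "real^'n"
  by (simp add: inner_axis) (simp add: inner_vec_def)

context moment_map
begin

lemma V_has_derivative_grad: "y \<in> K \<Longrightarrow> (V has_derivative (\<lambda>h. grad V y \<bullet> h)) (at y)"
  using V_has_derivative_K by (intro has_derivative_grad_at) (auto simp: differentiable_def)

lemma continuous_grad_V: "continuous_on K (grad V)"
proof -
  obtain N where N: "closure K \<subseteq> N" "smooth_on V N" using V_regular by blast
  have "K \<subseteq> N" using N(1) closure_subset[of K] by blast
  then have "continuous_on K (\<lambda>x. frechet_derivative V (at x) (axis i 1))" for i
    using smooth_on_imp_continuous_on[OF smooth_on_frechet_derivative[OF N(2)]] continuous_on_subset by blast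
  then show ?thesis unfolding grad_def by (intro continuous_on_vec_lambda)
qed

lemma V_grad_tangent:
  assumes "x \<in> K" "y \<in> K" shows "V x + grad V x \<bullet> (y - x) \<le> V y"
proof -
  have "frechet_derivative V (at x) = (\<lambda>h. grad V x \<bullet> h)"
    by (rule frechet_derivative_at[symmetric, OF V_has_derivative_grad[OF assms(1)]])
  then show ?thesis using V_tangent[OF assms] by simp
qed

lemma borel_measurable_indicator_K:
  fixes b :: "real^'n \<Rightarrow> real"
  assumes "continuous_on K b"
  shows "(\<lambda>y. indicator K y * b y) \<in> borel_measurable borel"
  using borel_measurable_continuous_on_indicator[OF _ assms] K_borel by simp

text \<open>Both sides are the integral of \<open>b\<close> against the target, once through its
  density and once through the pushforward. Both rules hold for the Bochner integral without
  integrability, so only continuity on \<open>K\<close> is assumed.\<close>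

lemma integral_change_to_psi:
  fixes b :: "real^'n \<Rightarrow> real"
  assumes b: "continuous_on K b"
  shows "(\<integral>y. indicator K y * (exp (- V y) * b y) \<partial>lborel) = (\<integral>x. exp (- \<psi> x) * b (F x) \<partial>lborel)"
proof -
  let ?b = "\<lambda>y. indicator K y * b y"
  have mb: "?b \<in> borel_measurable borel" by (rule borel_measurable_indicator_K[OF b])
  have mV: "(\<lambda>y. exp (- V y) * indicator K y) \<in> borel_measurable borel"
    using borel_measurable_indicator_K[of "\<lambda>y. exp (- V y)"] continuous_V
    by (simp add: mult.commute continuous_on_exp continuous_on_minus)
  have "(\<integral>y. ?b y \<partial>\<mu>) = (\<integral>y. (exp (- V y) * indicator K y) *\<^sub>R ?b y \<partial>lborel)"
    unfolding mu_eq using mb mV by (intro integral_density) auto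
  also have "\<dots> = (\<integral>y. indicator K y * (exp (- V y) * b y) \<partial>lborel)"
    by (intro Bochner_Integration.integral_cong) (auto simp: indicator_def)
  finally have 1: "(\<integral>y. ?b y \<partial>\<mu>) = \<dots>" .
  have "(\<integral>y. ?b y \<partial>\<mu>) = (\<integral>x. ?b (F x) \<partial>density lborel (\<lambda>u. ennreal (exp (- \<psi> u))))"
    unfolding pushforward[symmetric] using mb by (intro integral_distr) auto
  also have "\<dots> = (\<integral>x. exp (- \<psi> x) *\<^sub>R ?b (F x) \<partial>lborel)"
    using measurable_compose[OF borel_measurable_F mb] by (intro integral_density) auto
  also have "\<dots> = (\<integral>x. exp (- \<psi> x) * b (F x) \<partial>lborel)" using F_in_K by simp
  finally show ?thesis using 1 by simp
qed

text \<open>Shifting the potential by \<open>a\<close> gives a subsolution. In the coordinates \<open>y = \<nabla>\<psi>(x)\<close> this is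
  integration by parts for the map \<open>y \<mapsto> \<nabla>\<psi>(x + a)\<close>, whose divergence
  \<open>Tr(\<nabla>\<^sup>2\<psi>(x + a) \<nabla>\<^sup>2\<psi>(x)\<^sup>-\<^sup>1)\<close> is bounded below by the Monge-Ampere equation and the convexity of \<open>V\<close>.\<close>

lemma shift_subsolution:
  assumes \<eta>: "\<And>x. (\<eta> has_derivative (\<lambda>h. e x \<bullet> h)) (at x)" and e: "continuous_on UNIV e"
    and nonneg: "\<And>x. 0 \<le> \<eta> x" and supp: "\<And>x. norm x > r \<Longrightarrow> \<eta> x = 0" "\<And>x. norm x > r \<Longrightarrow> e x = 0"
  shows "(\<integral>x. exp (- \<psi> x) * (e x \<bullet> (G x *v (F (x + a) - F x))) \<partial>lborel)
    \<le> (\<integral>x. exp (- \<psi> x) * (\<eta> x * (\<psi> (x + a) - \<psi> x)) \<partial>lborel)"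
proof -
  define S where "S x = F (x + a) - F x" for x
  have c\<eta>: "continuous_on A \<eta>" for A using \<eta> by (meson continuous_at_imp_continuous_on has_derivative_continuous)
  have ce: "continuous_on A e" for A using e by (rule continuous_on_subset) simp
  have cS: "continuous_on A S" for A unfolding S_def
    by (intro continuous_intros continuous_F continuous_on_compose2[OF continuous_F[of UNIV]]) auto
  have cHa: "continuous_on A (\<lambda>x. H (x + a) $ i $ j)" for A i j
    by (intro continuous_on_compose2[OF continuous_H[of UNIV]] continuous_intros) auto
  \<comment> \<open>The divergence of the field \<open>X\<close> below, divided by
    \<open>exp (- V y)\<close> and written at \<open>x = g y\<close>. The dimension is subtracted
    because \<open>S (g y)\<close> contains the identity map of \<open>y\<close> with a minus
    sign.\<close>
  define br where "br x = - (\<eta> x * (grad V (F x) \<bullet> S x)) + e x \<bullet> (G x *v S x)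
      + \<eta> x * (trace (H (x + a) ** G x) - real CARD('n))" for x
  have cV: "continuous_on A (\<lambda>x. grad V (F x))" for A
    by (rule continuous_on_compose2[OF continuous_grad_V continuous_F]) (use F_in_K in auto)
  have ctr: "continuous_on A (\<lambda>x. trace (H (x + a) ** G x))" for A
    unfolding trace_def matrix_matrix_mult_def by (simp, intro continuous_intros cHa continuous_G)
  have cbr: "continuous_on A br" for A unfolding br_def
    by (intro continuous_intros c\<eta> ce cS cV ctr continuous_on_matrix_vector continuous_G)
  define C where "C = F ` cball 0 r"
  have compC: "compact C" unfolding C_def by (intro compact_continuous_image continuous_F compact_cball)
  have CK: "C \<subseteq> K" using F_in_K by (auto simp: C_def)
  have out: "\<eta> (g y) = 0" "e (g y) = 0" if "y \<in> K" "y \<notin> C" for y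
  proof -
    have "norm (g y) > r"
    proof (rule ccontr)
      assume "\<not> norm (g y) > r"
      then have "F (g y) \<in> C" by (auto simp: C_def)
      then show False using that F_g by simp
    qed
    then show "\<eta> (g y) = 0" "e (g y) = 0" using supp by auto
  qed
  \<comment> \<open>The field lives on the target side and is supported in the compact set
    \<open>C\<close> inside \<open>K\<close>, so its extension by zero is continuously
    differentiable on the whole space and has no boundary term.\<close>
  define X where "X i y = (if y \<in> K then exp (- V y) * (\<eta> (g y) * S (g y) $ i) else 0)" for i :: 'n and y
  define DX where "DX i y h = (if y \<in> K then exp (- V y) * (
      - (grad V y \<bullet> h) * (\<eta> (g y) * S (g y) $ i) + ((e (g y) \<bullet> (G (g y) *v h)) * S (g y) $ i
      + \<eta> (g y) * ((H (g y + a) *v (G (g y) *v h)) $ i - h $ i))) else 0)" for i :: 'n and y h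
  have Xout: "X i y = 0" "DX i y h = 0" if "y \<notin> C" for i y h
    using out that by (auto simp: X_def DX_def)
  have derX: "(X i has_derivative DX i y) (at y)" for i y
  proof (cases "y \<in> K")
    case True
    define x where "x = g y"
    have yx: "y = F x" using F_g[OF True] by (simp add: x_def)
    have dg: "(g has_derivative (\<lambda>h. G x *v h)) (at y)" unfolding yx by (rule g_has_derivative)
    have d\<eta>: "((\<lambda>y. \<eta> (g y)) has_derivative (\<lambda>h. e x \<bullet> (G x *v h))) (at y)"
      using has_derivative_compose[OF dg, of \<eta> "\<lambda>h. e x \<bullet> h"] \<eta>[of x] by (simp add: x_def)
    have dga: "((\<lambda>y. g y + a) has_derivative (\<lambda>h. G x *v h)) (at y)"
      by (rule has_derivative_add_const[OF dg])
    have dFa: "((\<lambda>y. F (g y + a)) has_derivative (\<lambda>h. H (x + a) *v (G x *v h))) (at y)"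
      using has_derivative_compose[OF dga, of F "\<lambda>h. H (x + a) *v h"] F_has_derivative[of "x + a"] by (simp add: x_def)
    have dS: "((\<lambda>y. (F (g y + a) - y) $ i) has_derivative (\<lambda>h. (H (x + a) *v (G x *v h) - h) $ i)) (at y)"
      by (intro bounded_linear.has_derivative[OF bounded_linear_vec_nth] has_derivative_diff[OF dFa has_derivative_ident])
    have dV: "((\<lambda>y. exp (- V y)) has_derivative (\<lambda>h. - (grad V y \<bullet> h) * exp (- V y))) (at y)"
      using V_has_derivative_grad[OF True] by (auto intro!: derivative_eq_intros)
    have "((\<lambda>y. exp (- V y) * (\<eta> (g y) * (F (g y + a) - y) $ i)) has_derivative DX i y) (at y)"
      by (rule has_derivative_eq_rhs[OF has_derivative_mult[OF dV has_derivative_mult[OF d\<eta> dS]]])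
        (use True in \<open>auto simp: DX_def fun_eq_iff x_def[symmetric] S_def yx[symmetric] algebra_simps\<close>)
    then show ?thesis
      by (rule has_derivative_transform_within_open[OF _ K_props(1) True])
        (auto simp: X_def S_def F_g)
  next
    case False
    have op: "open (- C)" using compC by (simp add: compact_imp_closed open_Compl)
    have y: "y \<in> - C" using False CK by auto
    have "DX i y = (\<lambda>h. 0)" using False by (auto simp: DX_def)
    moreover have "(X i has_derivative (\<lambda>h. 0)) (at y)"
      by (rule has_derivative_transform_within_open[OF has_derivative_const op y]) (simp add: Xout)
    ultimately show ?thesis by simp
  qed
  have cont_open: "continuous_on UNIV u" if "continuous_on K u" "\<And>y. y \<notin> C \<Longrightarrow> u y = 0" for u :: "real^'n \<Rightarrow> real"
  proof -
    have "continuous_on (- C) u" using that(2) by (subst continuous_on_cong[OF refl, of _ _ "\<lambda>_. 0"]) auto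
    then have "continuous_on (K \<union> - C) u"
      using compC that(1) K_props(1) by (intro continuous_on_open_Un) (auto simp: compact_imp_closed open_Compl)
    moreover have "K \<union> - C = UNIV" using CK by auto
    ultimately show ?thesis by simp
  qed
  have cgK: "continuous_on K (\<lambda>y. u (g y))" if "continuous_on UNIV u" for u :: "real^'n \<Rightarrow> 'b::topological_space"
    by (rule continuous_on_compose2[OF that continuous_g]) auto
  have contDX: "continuous_on UNIV (\<lambda>y. DX i y h)" for i h
  proof (rule cont_open)
    have 1: "continuous_on UNIV (\<lambda>x. \<eta> x * S x $ i)" "continuous_on UNIV (\<lambda>x. (e x \<bullet> (G x *v h)) * S x $ i
      + \<eta> x * ((H (x + a) *v (G x *v h)) $ i - h $ i))"
      by (intro continuous_intros c\<eta> ce cS continuous_on_matrix_vector continuous_G cHa)+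
    have "continuous_on K (\<lambda>y. exp (- V y) * (
      - (grad V y \<bullet> h) * (\<eta> (g y) * S (g y) $ i) + ((e (g y) \<bullet> (G (g y) *v h)) * S (g y) $ i
      + \<eta> (g y) * ((H (g y + a) *v (G (g y) *v h)) $ i - h $ i))))"
      by (intro continuous_on_mult continuous_on_add continuous_on_exp continuous_on_minus continuous_V
          continuous_on_inner continuous_grad_V continuous_on_const cgK[OF 1(1)] cgK[OF 1(2)])
    then show "continuous_on K (\<lambda>y. DX i y h)"
      by (rule continuous_on_eq) (simp add: DX_def)
  qed (rule Xout)
  obtain \<rho> where \<rho>: "\<And>y. norm y > \<rho> \<Longrightarrow> y \<notin> C"
    using compC compact_imp_bounded bounded_iff by (metis not_le)
  have contX: "continuous_on UNIV (X i)" for i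
    using derX by (meson continuous_at_imp_continuous_on has_derivative_continuous)
  have intX: "integrable lborel (X i)" for i
    by (rule integrable_compact_support[OF contX, of \<rho>]) (use \<rho> Xout in blast)
  have intD: "integrable lborel (\<lambda>y. \<Sum>i\<in>UNIV. DX i y (axis i 1))"
    by (rule integrable_compact_support[of _ \<rho>]) (use \<rho> Xout contDX in \<open>auto intro!: continuous_intros\<close>)
  have zero: "(\<integral>y. (\<Sum>i\<in>UNIV. DX i y (axis i 1)) \<partial>lborel) = 0"
    by (rule integral_divergence_zero[OF finite_class.finite_UNIV derX contDX intX intD])
  have divX: "(\<Sum>i\<in>UNIV. DX i y (axis i 1)) = indicator K y * (exp (- V y) * br (g y))" for y
  proof (cases "y \<in> K")
    case False then show ?thesis by (simp add: DX_def)
  next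
    case True
    let ?x = "g y"
    have Ge: "(e ?x \<bullet> (G ?x *v h)) = (G ?x *v e ?x) \<bullet> h" for h
      using symmetric_matrix_inner[OF G_transpose] by simp
    have t: "trace (H (?x + a) ** G ?x) = (\<Sum>i\<in>UNIV. (H (?x + a) *v (G ?x *v axis i 1)) $ i)"
      unfolding trace_eq_sum_inner matrix_vector_mul_assoc ..
    have "(\<Sum>i\<in>UNIV. DX i y (axis i 1)) = exp (- V y) * (
       - \<eta> ?x * (\<Sum>i\<in>UNIV. (grad V y \<bullet> axis i 1) * S ?x $ i)
       + (\<Sum>i\<in>UNIV. ((G ?x *v e ?x) \<bullet> axis i 1) * S ?x $ i)
       + \<eta> ?x * (\<Sum>i\<in>UNIV. (H (?x + a) *v (G ?x *v axis i 1)) $ i - 1))"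
      using True unfolding DX_def Ge
      by (simp add: sum_distrib_left sum.distrib[symmetric] algebra_simps)
    also have "\<dots> = exp (- V y) * br ?x"
      unfolding sum_inner_axis br_def t sum_subtractf F_g[OF True]
      by (simp add: Ge algebra_simps)
    finally show ?thesis using True by simp
  qed
  have "(\<integral>x. exp (- \<psi> x) * br (g (F x)) \<partial>lborel) = 0"
    using zero unfolding divX integral_change_to_psi[OF cgK[OF cbr[of UNIV]]] .
  then have brz: "(\<integral>x. exp (- \<psi> x) * br x \<partial>lborel) = 0" by (simp add: g_F)
  \<comment> \<open>By the Monge-Ampere equation the increment of ln det is that of \<open>V\<close>
    along \<open>F\<close> minus that of \<psi>. The tangent inequality for \<open>V\<close> makes
    the first of these at least the drift term \<open>grad V (F x) \<bullet> S x\<close>, which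
    cancels the drift in \<open>br\<close> and leaves only the increment of \<psi>.\<close>
  have lower: "e x \<bullet> (G x *v S x) - \<eta> x * (\<psi> (x + a) - \<psi> x) \<le> br x" for x
  proof -
    have "ln (det (H (x + a))) - ln (det (H x)) \<le> trace (H (x + a) ** G x) - real CARD('n)"
      by (rule ln_det_diff_le_trace[OF H_pos_def H_pos_def G_H])
    moreover have "V (F x) + grad V (F x) \<bullet> S x \<le> V (F (x + a))"
      unfolding S_def by (rule V_grad_tangent[OF F_in_K F_in_K])
    ultimately have "grad V (F x) \<bullet> S x - (\<psi> (x + a) - \<psi> x) \<le> trace (H (x + a) ** G x) - real CARD('n)"
      unfolding ln_det_H by linarith
    then have "\<eta> x * (grad V (F x) \<bullet> S x - (\<psi> (x + a) - \<psi> x)) \<le> \<eta> x * (trace (H (x + a) ** G x) - real CARD('n))"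
      using nonneg by (rule mult_left_mono)
    then show ?thesis by (simp add: br_def algebra_simps)
  qed
  have c1: "continuous_on UNIV (\<lambda>x. exp (- \<psi> x) * (e x \<bullet> (G x *v S x)))"
    by (intro continuous_intros continuous_psi ce cS continuous_on_matrix_vector continuous_G)
  have i1: "integrable lborel (\<lambda>x. exp (- \<psi> x) * (e x \<bullet> (G x *v S x)))"
    by (rule integrable_compact_support[OF c1, of r]) (simp add: supp)
  have c2: "continuous_on UNIV (\<lambda>x. exp (- \<psi> x) * (\<eta> x * (\<psi> (x + a) - \<psi> x)))"
    by (intro continuous_intros continuous_psi c\<eta> continuous_on_compose2[OF continuous_psi[of UNIV]]) auto
  have i2: "integrable lborel (\<lambda>x. exp (- \<psi> x) * (\<eta> x * (\<psi> (x + a) - \<psi> x)))"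
    by (rule integrable_compact_support[OF c2, of r]) (simp add: supp)
  have c3: "continuous_on UNIV (\<lambda>x. exp (- \<psi> x) * br x)"
    by (intro continuous_intros continuous_psi cbr)
  have i3: "integrable lborel (\<lambda>x. exp (- \<psi> x) * br x)"
    by (rule integrable_compact_support[OF c3, of r]) (simp add: supp br_def)
  have "(\<integral>x. exp (- \<psi> x) * (e x \<bullet> (G x *v S x)) - exp (- \<psi> x) * (\<eta> x * (\<psi> (x + a) - \<psi> x)) \<partial>lborel)
      \<le> (\<integral>x. exp (- \<psi> x) * br x \<partial>lborel)"
  proof (rule integral_mono[OF Bochner_Integration.integrable_diff[OF i1 i2] i3])
    fix x
    have "exp (- \<psi> x) * (e x \<bullet> (G x *v S x) - \<eta> x * (\<psi> (x + a) - \<psi> x)) \<le> exp (- \<psi> x) * br x"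
      by (rule mult_left_mono[OF lower]) simp
    then show "exp (- \<psi> x) * (e x \<bullet> (G x *v S x)) - exp (- \<psi> x) * (\<eta> x * (\<psi> (x + a) - \<psi> x)) \<le> exp (- \<psi> x) * br x"
      by (simp only: right_diff_distrib)
  qed
  then show ?thesis using brz i1 i2 by (simp add: S_def)
qed

lemma integration_by_parts:
  assumes h: "\<And>x. (h has_derivative Dh x) (at x)" and c: "continuous_on UNIV (\<lambda>x. Dh x v)"
    and supp: "\<And>x. norm x > r \<Longrightarrow> h x = 0" "\<And>x. norm x > r \<Longrightarrow> Dh x v = 0"
  shows "(\<integral>x. exp (- \<psi> x) * Dh x v \<partial>lborel) = (\<integral>x. exp (- \<psi> x) * (h x * (F x \<bullet> v)) \<partial>lborel)"
proof -
  have ch: "continuous_on UNIV h" using h by (meson continuous_at_imp_continuous_on has_derivative_continuous)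
  have d: "((\<lambda>x. exp (- \<psi> x) * h x) has_derivative (\<lambda>k. exp (- \<psi> x) * Dh x k - exp (- \<psi> x) * (h x * (F x \<bullet> k)))) (at x)" for x
    using h[of x] psi_has_derivative[of x] by (auto intro!: derivative_eq_intros simp: algebra_simps)
  have c1: "continuous_on UNIV (\<lambda>x. exp (- \<psi> x) * Dh x v)"
    by (intro continuous_intros continuous_psi c)
  have c2: "continuous_on UNIV (\<lambda>x. exp (- \<psi> x) * (h x * (F x \<bullet> v)))"
    by (intro continuous_intros continuous_psi ch continuous_F)
  have i1: "integrable lborel (\<lambda>x. exp (- \<psi> x) * Dh x v)"
    by (rule integrable_compact_support[OF c1, of r]) (simp add: supp)
  have i2: "integrable lborel (\<lambda>x. exp (- \<psi> x) * (h x * (F x \<bullet> v)))"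
    by (rule integrable_compact_support[OF c2, of r]) (simp add: supp)
  have i0: "integrable lborel (\<lambda>x. exp (- \<psi> x) * h x)"
    by (rule integrable_compact_support[of _ r]) (auto simp: supp intro!: continuous_intros continuous_psi ch)
  have "(\<integral>x. exp (- \<psi> x) * Dh x v - exp (- \<psi> x) * (h x * (F x \<bullet> v)) \<partial>lborel) = 0"
    by (rule integral_directional_derivative_zero[OF d])
      (use c1 c2 i0 i1 i2 in \<open>auto intro!: continuous_on_diff\<close>)
  then show ?thesis using i1 i2 by simp
qed

end

section \<open>Integrability of the squared Hessian\<close>

context moment_map
begin

lemma second_difference_eq:
  assumes "0 < \<epsilon>"
  shows "\<exists>b. \<bar>b\<bar> < \<epsilon> \<and>
    \<psi> (x + \<epsilon> *\<^sub>R \<theta>) + \<psi> (x - \<epsilon> *\<^sub>R \<theta>) - 2 * \<psi> x = \<epsilon> * \<epsilon> * (\<theta> \<bullet> (H (x + b *\<^sub>R \<theta>) *v \<theta>))"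
proof -
  have D2: "((\<lambda>x. F x \<bullet> \<theta>) has_derivative (\<lambda>h. (H x *v h) \<bullet> \<theta>)) (at x)" for x
    by (rule has_derivative_inner_left[OF F_has_derivative])
  \<comment> \<open>For opposite directions two of the four corners of the parallelogram coincide
    with \<open>x\<close>.\<close>
  obtain a b where ab: "0 < a" "a < \<epsilon>" "0 < b" "b < \<epsilon>"
    "\<psi> (x + \<epsilon> *\<^sub>R \<theta> + \<epsilon> *\<^sub>R (- \<theta>)) - \<psi> (x + \<epsilon> *\<^sub>R \<theta>) - \<psi> (x + \<epsilon> *\<^sub>R (- \<theta>)) + \<psi> x
      = \<epsilon> * \<epsilon> * ((H (x + a *\<^sub>R \<theta> + b *\<^sub>R (- \<theta>)) *v (- \<theta>)) \<bullet> \<theta>)"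
    using double_difference_mvt[OF psi_has_derivative D2 assms, of x "- \<theta>"] by blast
  have e: "x + a *\<^sub>R \<theta> + b *\<^sub>R (- \<theta>) = x + (a - b) *\<^sub>R \<theta>" by (simp add: scaleR_diff_left)
  have neg: "H y *v (- \<theta>) = - (H y *v \<theta>)" for y
    using matrix_vector_mult_scaleR[of "H y" "-1" \<theta>] by simp
  have "2 * \<psi> x - \<psi> (x + \<epsilon> *\<^sub>R \<theta>) - \<psi> (x - \<epsilon> *\<^sub>R \<theta>) = - (\<epsilon> * \<epsilon> * (\<theta> \<bullet> (H (x + (a - b) *\<^sub>R \<theta>) *v \<theta>)))"
    using ab(5)[unfolded e neg] by (simp add: inner_commute)
  then show ?thesis using ab by (intro exI[of _ "a - b"]) auto
qed

lemma cutoff_square_derivative: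
  "((\<lambda>x. (cutoff N x)\<^sup>2) has_derivative (\<lambda>h. (2 * cutoff N x) * (cutoff_grad N x \<bullet> h))) (at x)"
  using has_derivative_power[OF cutoff_has_derivative, where n = 2] by (simp add: mult_ac)

text \<open>Testing the subsolution \<open>Q\<close> with \<open>Q\<close> bounds the Dirichlet energy \<open>BB\<close> of \<open>Q\<close>; integrating
  \<open>\<psi>\<^sub>\<theta>\<close> by parts against \<open>Q\<^sup>2 \<psi>\<^sub>\<theta>\<close> then bounds \<open>CC = E Q\<^sup>2 \<psi>\<^sub>\<theta>\<^sub>\<theta>\<close>; and moving one second difference off
  \<open>E Q\<^sup>3\<close> leaves a first difference of \<open>\<psi>\<close>, of size \<open>R \<epsilon>\<close>, and a derivative controlled by both.\<close>

lemma second_difference_cube_le: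
  assumes R: "R > 0" "\<And>x. norm (F x) \<le> R" and \<theta>: "norm \<theta> = 1" and \<epsilon>: "0 < \<epsilon>"
    and Q_def: "Q = (\<lambda>x. \<psi> (x + \<epsilon> *\<^sub>R \<theta>) + \<psi> (x - \<epsilon> *\<^sub>R \<theta>) - 2 * \<psi> x)"
  shows "(\<integral>x. exp (- \<psi> x) * Q x ^ 3 \<partial>lborel) \<le> R * (10 * R\<^sup>2 + R + 2) * \<epsilon>\<^sup>2 * (\<integral>x. exp (- \<psi> x) * (Q x)\<^sup>2 \<partial>lborel)"
    and "\<And>x. 0 \<le> Q x" "\<And>x. Q x \<le> 2 * R * \<epsilon>"
proof -
  define a where "a = \<epsilon> *\<^sub>R \<theta>"
  have na: "norm a = \<epsilon>" using \<theta> \<epsilon> by (simp add: a_def)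
  have lip: "\<bar>\<psi> (x + c) - \<psi> x\<bar> \<le> R * norm c" for x c
  proof -
    have "F x \<bullet> c \<le> \<psi> (x + c) - \<psi> x" "\<psi> (x + c) - \<psi> x \<le> F (x + c) \<bullet> c"
      using psi_tangent[of x "x + c"] psi_tangent[of "x + c" x] by simp_all
    moreover have "\<bar>F y \<bullet> c\<bar> \<le> R * norm c" for y
      by (rule order_trans[OF Cauchy_Schwarz_ineq2]) (intro mult_right_mono R norm_ge_zero)
    from this[of x] this[of "x + c"] have "- (R * norm c) \<le> F x \<bullet> c" "F (x + c) \<bullet> c \<le> R * norm c" by linarith+
    ultimately show ?thesis by linarith
  qed
  have Qa: "Q x = (\<psi> (x + a) - \<psi> x) + (\<psi> (x + - a) - \<psi> x)" for x by (simp add: Q_def a_def)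
  show Q0: "0 \<le> Q x" for x
    using psi_tangent[of x "x + a"] psi_tangent[of x "x + - a"] by (simp add: Qa)
  show QB: "Q x \<le> 2 * R * \<epsilon>" for x
    using lip[of x a] lip[of x "- a"] na by (simp add: Qa)
  \<comment> \<open>This uniform bound on \<open>Q\<close> depends on the step. It enters only the
    cutoff errors, which vanish before the step is sent to zero.\<close>
  define B where "B = 2 * R * \<epsilon>"
  have B0: "0 \<le> B" using R \<epsilon> by (simp add: B_def)
  have Q2B: "(Q x)\<^sup>2 \<le> B\<^sup>2" for x using Q0 QB by (intro power_mono) (auto simp: B_def)
  define D where "D x = (F (x + a) - F x) + (F (x + - a) - F x)" for x
  have dshift: "((\<lambda>x. \<psi> (x + c)) has_derivative (\<lambda>h. F (x + c) \<bullet> h)) (at x)" for c x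
    by (rule has_derivative_compose[OF _ psi_has_derivative]) (auto intro!: derivative_eq_intros)
  have dQ: "(Q has_derivative (\<lambda>h. D x \<bullet> h)) (at x)" for x
    unfolding Qa[abs_def] D_def inner_add_left inner_diff_left
    by (intro has_derivative_add has_derivative_diff dshift psi_has_derivative)
  have cF: "continuous_on A (\<lambda>x. F (x + c))" for A c
    by (intro continuous_on_compose2[OF continuous_F[of UNIV]] continuous_intros) auto
  have c\<psi>: "continuous_on A (\<lambda>x. \<psi> (x + c))" for A c
    by (intro continuous_on_compose2[OF continuous_psi[of UNIV]] continuous_intros) auto
  have cD: "continuous_on A D" for A unfolding D_def by (intro continuous_intros cF continuous_F)
  have cQ: "continuous_on A Q" for A unfolding Qa[abs_def] by (intro continuous_intros c\<psi> continuous_psi)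
  define f where "f x = \<theta> \<bullet> (H x *v \<theta>)" for x
  have cf: "continuous_on A f" for A unfolding f_def
    by (intro continuous_intros continuous_on_matrix_vector continuous_H)
  have f0: "0 \<le> f x" for x by (simp add: f_def H_psd)
  have F\<theta>: "\<bar>F x \<bullet> \<theta>\<bar> \<le> R" for x
    using Cauchy_Schwarz_ineq2[of "F x" \<theta>] R(2)[of x] \<theta> by simp
  obtain C where C: "0 \<le> C" "\<And>N. N \<ge> 1 \<Longrightarrow> (\<integral>x. exp (- \<psi> x) * costar x (cutoff_grad N x) \<partial>lborel) \<le> C / N"
    using cutoff_energy by metis
  define w where "w x = exp (- \<psi> x)" for x
  have w0: "0 < w x" for x by (simp add: w_def)
  have cw: "continuous_on A w" for A unfolding w_def by (intro continuous_intros continuous_psi)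
  have iw: "integrable lborel w" unfolding w_def by (rule exp_psi_integrable)
  have wint: "(\<integral>x. w x \<partial>lborel) = 1" unfolding w_def by (rule exp_psi_integral)
  \<comment> \<open>Collects every cutoff error of the three estimates below. Its size is
    irrelevant, because it appears divided by \<open>N\<close>.\<close>
  define k where "k = 8 * C * B\<^sup>2 * R\<^sup>2 * 2 + 16 * B\<^sup>2 * R + 4 * B\<^sup>2 * C + 8 * B\<^sup>2"
  have main: "(\<integral>x. w x * ((cutoff N x)\<^sup>2 * Q x ^ 3) \<partial>lborel)
     \<le> \<epsilon>\<^sup>2 * R * ((10 * R\<^sup>2 + R + 2) * (\<integral>x. w x * ((cutoff N x)\<^sup>2 * (Q x)\<^sup>2) \<partial>lborel) + k / N)" if N: "N \<ge> 1" for N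
  proof -
    define \<zeta> where "\<zeta> = (cutoff N :: real^'n \<Rightarrow> real)"
    define \<gamma> where "\<gamma> = (cutoff_grad N :: real^'n \<Rightarrow> real^'n)"
    have \<zeta>01: "0 \<le> \<zeta> x" "\<zeta> x \<le> 1" for x by (auto simp: \<zeta>_def cutoff_nonneg cutoff_le_1)
    have \<gamma>N: "norm (\<gamma> x) \<le> 4 / N" for x using N by (simp add: \<gamma>_def norm_cutoff_grad_le)
    have d\<zeta>: "(\<zeta> has_derivative (\<lambda>h. \<gamma> x \<bullet> h)) (at x)" for x unfolding \<zeta>_def \<gamma>_def by (rule cutoff_has_derivative)
    have c\<zeta>: "continuous_on A \<zeta>" for A unfolding \<zeta>_def by (rule cutoff_continuous)
    have c\<gamma>: "continuous_on A \<gamma>" for A unfolding \<gamma>_def by (rule cutoff_grad_continuous)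
    have out: "\<zeta> x = 0" "\<gamma> x = 0" if "norm x > N" for x
      using that N by (auto simp: \<zeta>_def \<gamma>_def cutoff_outside)
    have I: "integrable lborel u" if "continuous_on UNIV u" "\<And>x. norm x > N \<Longrightarrow> u x = 0" for u :: "real^'n \<Rightarrow> real"
      using that by (rule integrable_compact_support)
    define AA where "AA = (\<integral>x. w x * ((\<zeta> x)\<^sup>2 * (Q x)\<^sup>2) \<partial>lborel)"
    define BB where "BB = (\<integral>x. w x * ((\<zeta> x)\<^sup>2 * costar x (D x)) \<partial>lborel)"
    define CC where "CC = (\<integral>x. w x * ((\<zeta> x)\<^sup>2 * ((Q x)\<^sup>2 * f x)) \<partial>lborel)"
    have iA: "integrable lborel (\<lambda>x. w x * ((\<zeta> x)\<^sup>2 * (Q x)\<^sup>2))"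
      by (rule I) (auto simp: out intro!: continuous_intros cw c\<zeta> cQ)
    have iB: "integrable lborel (\<lambda>x. w x * ((\<zeta> x)\<^sup>2 * costar x (D x)))"
      by (rule I) (auto simp: out intro!: continuous_intros cw c\<zeta> continuous_costar cD)
    have iC: "integrable lborel (\<lambda>x. w x * ((\<zeta> x)\<^sup>2 * ((Q x)\<^sup>2 * f x)))"
      by (rule I) (auto simp: out intro!: continuous_intros cw c\<zeta> cQ cf)
    have i\<gamma>: "integrable lborel (\<lambda>x. w x * costar x (\<gamma> x))"
      by (rule I) (auto simp: out costar_def intro!: continuous_intros cw continuous_on_matrix_vector continuous_G c\<gamma>)
    have BBle: "BB \<le> 2 * AA + 4 * B\<^sup>2 * C / N"
    proof -
      define \<eta> where "\<eta> x = (\<zeta> x)\<^sup>2 * Q x" for x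
      define e where "e x = (\<zeta> x)\<^sup>2 *\<^sub>R D x + (2 * \<zeta> x * Q x) *\<^sub>R \<gamma> x" for x
      have d\<eta>: "(\<eta> has_derivative (\<lambda>h. e x \<bullet> h)) (at x)" for x
      proof -
        have "(\<eta> has_derivative (\<lambda>h. (\<zeta> x)\<^sup>2 * (D x \<bullet> h) + ((2 * \<zeta> x) * (\<gamma> x \<bullet> h)) * Q x)) (at x)"
          unfolding \<eta>_def \<zeta>_def \<gamma>_def by (rule has_derivative_mult[OF cutoff_square_derivative dQ])
        then show ?thesis by (simp add: e_def inner_add_left mult_ac)
      qed
      have ce: "continuous_on UNIV e" unfolding e_def by (intro continuous_intros c\<zeta> cD cQ c\<gamma>)
      have \<eta>0: "0 \<le> \<eta> x" for x using Q0 by (simp add: \<eta>_def)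
      have \<eta>out: "\<eta> x = 0" "e x = 0" if "norm x > N" for x using out[OF that] by (auto simp: \<eta>_def e_def)
      note sub = shift_subsolution[OF d\<eta> ce \<eta>0 \<eta>out, folded w_def]
      have c1: "continuous_on UNIV (\<lambda>x. w x * (e x \<bullet> (G x *v (F (x + c) - F x))))" for c
        by (intro continuous_intros cw continuous_on_matrix_vector continuous_G cF continuous_F ce)
      have i1: "integrable lborel (\<lambda>x. w x * (e x \<bullet> (G x *v (F (x + c) - F x))))" for c
        by (rule I[OF c1]) (simp add: \<eta>out)
      have c2: "continuous_on UNIV (\<lambda>x. w x * (\<eta> x * (\<psi> (x + c) - \<psi> x)))" for c
        unfolding \<eta>_def by (intro continuous_intros cw c\<psi> continuous_psi c\<zeta> cQ)
      have i2: "integrable lborel (\<lambda>x. w x * (\<eta> x * (\<psi> (x + c) - \<psi> x)))" for c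
        by (rule I[OF c2]) (simp add: \<eta>out)
      have "(\<integral>x. w x * (e x \<bullet> (G x *v D x)) \<partial>lborel)
         = (\<integral>x. w x * (e x \<bullet> (G x *v (F (x + a) - F x))) + w x * (e x \<bullet> (G x *v (F (x + - a) - F x))) \<partial>lborel)"
        unfolding D_def by (simp only: matrix_vector_right_distrib inner_add_right distrib_left)
      also have "\<dots> = (\<integral>x. w x * (e x \<bullet> (G x *v (F (x + a) - F x))) \<partial>lborel) + (\<integral>x. w x * (e x \<bullet> (G x *v (F (x + - a) - F x))) \<partial>lborel)"
        by (rule Bochner_Integration.integral_add[OF i1 i1])
      also have "\<dots> \<le> (\<integral>x. w x * (\<eta> x * (\<psi> (x + a) - \<psi> x)) \<partial>lborel) + (\<integral>x. w x * (\<eta> x * (\<psi> (x + - a) - \<psi> x)) \<partial>lborel)"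
        by (intro add_mono sub)
      also have "\<dots> = (\<integral>x. w x * (\<eta> x * (\<psi> (x + a) - \<psi> x)) + w x * (\<eta> x * (\<psi> (x + - a) - \<psi> x)) \<partial>lborel)"
        by (rule Bochner_Integration.integral_add[OF i2 i2, symmetric])
      also have "\<dots> = AA"
        unfolding AA_def by (intro Bochner_Integration.integral_cong) (auto simp: \<eta>_def Qa power2_eq_square algebra_simps)
      finally have le: "(\<integral>x. w x * (e x \<bullet> (G x *v D x)) \<partial>lborel) \<le> AA" .
      have pt: "w x * ((\<zeta> x)\<^sup>2 * costar x (D x)) \<le> 2 * (w x * (e x \<bullet> (G x *v D x))) + 4 * B\<^sup>2 * (w x * costar x (\<gamma> x))" for x
      proof -
        have "e x \<bullet> (G x *v D x) = (\<zeta> x)\<^sup>2 * costar x (D x) + (2 * \<zeta> x * Q x) * (\<gamma> x \<bullet> (G x *v D x))"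
          by (simp add: e_def costar_def inner_add_left)
        \<comment> \<open>With weights \<open>\<zeta> x\<close> and \<open>2 * Q x\<close> the cross
          term costs half of the energy of \<open>D x\<close>; the other half is kept, which
          explains the factor 2 in the bound on \<open>BB\<close>.\<close>
        moreover have "0 \<le> (\<zeta> x)\<^sup>2 * costar x (D x) + 2 * \<zeta> x * (2 * Q x) * (D x \<bullet> (G x *v \<gamma> x)) + (2 * Q x)\<^sup>2 * costar x (\<gamma> x)"
          by (rule costar_mixed)
        moreover have "D x \<bullet> (G x *v \<gamma> x) = \<gamma> x \<bullet> (G x *v D x)"
          using symmetric_matrix_inner[OF G_transpose, of x "\<gamma> x" "D x"] by (simp add: inner_commute)
        moreover have "(2 * Q x)\<^sup>2 * costar x (\<gamma> x) \<le> 4 * B\<^sup>2 * costar x (\<gamma> x)"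
          using Q2B[of x] costar_nonneg by (intro mult_right_mono) (auto simp: power_mult_distrib)
        ultimately have "(\<zeta> x)\<^sup>2 * costar x (D x) \<le> 2 * (e x \<bullet> (G x *v D x)) + 4 * B\<^sup>2 * costar x (\<gamma> x)"
          by (simp add: algebra_simps)
        then have "w x * ((\<zeta> x)\<^sup>2 * costar x (D x)) \<le> w x * (2 * (e x \<bullet> (G x *v D x)) + 4 * B\<^sup>2 * costar x (\<gamma> x))"
          using w0[of x] by (intro mult_left_mono) auto
        then show ?thesis by (simp add: algebra_simps)
      qed
      have ie: "integrable lborel (\<lambda>x. w x * (e x \<bullet> (G x *v D x)))"
        by (rule I) (auto simp: \<eta>out intro!: continuous_intros cw continuous_on_matrix_vector continuous_G cD ce)
      have "BB \<le> (\<integral>x. 2 * (w x * (e x \<bullet> (G x *v D x))) + 4 * B\<^sup>2 * (w x * costar x (\<gamma> x)) \<partial>lborel)"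
        unfolding BB_def using iB ie i\<gamma> pt by (intro integral_mono) auto
      also have "\<dots> = 2 * (\<integral>x. w x * (e x \<bullet> (G x *v D x)) \<partial>lborel) + 4 * B\<^sup>2 * (\<integral>x. w x * costar x (\<gamma> x) \<partial>lborel)"
        using ie i\<gamma> by simp
      also have "\<dots> \<le> 2 * AA + 4 * B\<^sup>2 * (C / N)"
        using le C(2)[OF N] unfolding w_def \<gamma>_def by (intro add_mono mult_left_mono) auto
      finally show ?thesis by simp
    qed
    have CCle: "CC \<le> 2 * R\<^sup>2 * AA + 4 * R\<^sup>2 * BB + 16 * B\<^sup>2 * R / N"
    proof -
      define h where "h x = (\<zeta> x)\<^sup>2 * ((Q x)\<^sup>2 * (F x \<bullet> \<theta>))" for x
      define Dh where "Dh x v = (\<zeta> x)\<^sup>2 * ((Q x)\<^sup>2 * ((H x *v v) \<bullet> \<theta>) + (2 * Q x * (D x \<bullet> v)) * (F x \<bullet> \<theta>))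
          + ((2 * \<zeta> x) * (\<gamma> x \<bullet> v)) * ((Q x)\<^sup>2 * (F x \<bullet> \<theta>))" for x v
      have dh: "(h has_derivative Dh x) (at x)" for x
      proof -
        have q2: "((\<lambda>x. (Q x)\<^sup>2) has_derivative (\<lambda>v. 2 * Q x * (D x \<bullet> v))) (at x)"
          using has_derivative_power[OF dQ, where n = 2] by (simp add: mult_ac)
        show ?thesis
          unfolding h_def Dh_def[abs_def] \<zeta>_def \<gamma>_def
          by (rule has_derivative_mult[OF cutoff_square_derivative has_derivative_mult[OF q2 has_derivative_inner_left[OF F_has_derivative]]])
      qed
      have cDh: "continuous_on UNIV (\<lambda>x. Dh x \<theta>)" unfolding Dh_def
        by (intro continuous_intros c\<zeta> cQ cD c\<gamma> continuous_F continuous_on_matrix_vector continuous_H)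
      have ch: "continuous_on UNIV h" unfolding h_def by (intro continuous_intros c\<zeta> cQ continuous_F)
      have hout: "h x = 0" "Dh x \<theta> = 0" if "norm x > N" for x using out[OF that] by (auto simp: h_def Dh_def)
      have ibp: "(\<integral>x. w x * Dh x \<theta> \<partial>lborel) = (\<integral>x. w x * (h x * (F x \<bullet> \<theta>)) \<partial>lborel)"
        unfolding w_def by (rule integration_by_parts[OF dh cDh hout])
      have iDh: "integrable lborel (\<lambda>x. w x * Dh x \<theta>)"
        by (rule I) (auto simp: hout intro!: continuous_intros cw cDh)
      have ih: "integrable lborel (\<lambda>x. w x * (h x * (F x \<bullet> \<theta>)))"
        by (rule I) (auto simp: hout intro!: continuous_intros cw ch continuous_F)
      have F2: "(F x \<bullet> \<theta>)\<^sup>2 \<le> R\<^sup>2" for x using F\<theta>[of x] by (simp add: abs_le_square_iff[symmetric])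
      have hle: "(\<integral>x. w x * (h x * (F x \<bullet> \<theta>)) \<partial>lborel) \<le> R\<^sup>2 * AA"
      proof -
        have "(\<integral>x. w x * (h x * (F x \<bullet> \<theta>)) \<partial>lborel) \<le> (\<integral>x. R\<^sup>2 * (w x * ((\<zeta> x)\<^sup>2 * (Q x)\<^sup>2)) \<partial>lborel)"
        proof (rule integral_mono[OF ih])
          fix x
          have "(F x \<bullet> \<theta>)\<^sup>2 * (w x * ((\<zeta> x)\<^sup>2 * (Q x)\<^sup>2)) \<le> R\<^sup>2 * (w x * ((\<zeta> x)\<^sup>2 * (Q x)\<^sup>2))"
            using F2 w0[of x] by (intro mult_right_mono) auto
          then show "w x * (h x * (F x \<bullet> \<theta>)) \<le> R\<^sup>2 * (w x * ((\<zeta> x)\<^sup>2 * (Q x)\<^sup>2))"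
            by (simp add: h_def power2_eq_square mult_ac)
        qed (use iA in simp)
        then show ?thesis by (simp add: AA_def)
      qed
      have pt: "w x * ((\<zeta> x)\<^sup>2 * ((Q x)\<^sup>2 * f x))
          \<le> 2 * (w x * Dh x \<theta>) + 4 * R\<^sup>2 * (w x * ((\<zeta> x)\<^sup>2 * costar x (D x))) + 16 * B\<^sup>2 * R / N * w x" for x
      proof -
        define p where "p = F x \<bullet> \<theta>"
        \<comment> \<open>With weights \<open>Q x\<close> and \<open>2 * p\<close> the cross term is
          absorbed by half of the Hessian term and a multiple of the energy of \<open>Q\<close>;
          this is why \<open>BB\<close> enters the bound on \<open>CC\<close>.\<close>
        have "0 \<le> (Q x)\<^sup>2 * (\<theta> \<bullet> (H x *v \<theta>)) + 2 * Q x * (2 * p) * (\<theta> \<bullet> D x) + (2 * p)\<^sup>2 * costar x (D x)"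
          by (rule costar_mixed_H)
        moreover have "(2 * p)\<^sup>2 * costar x (D x) \<le> 4 * R\<^sup>2 * costar x (D x)"
          using F2[of x] costar_nonneg by (intro mult_right_mono) (auto simp: power_mult_distrib p_def)
        ultimately have *: "(Q x)\<^sup>2 * f x \<le> 2 * ((Q x)\<^sup>2 * f x + (2 * Q x * (D x \<bullet> \<theta>)) * p) + 4 * R\<^sup>2 * costar x (D x)"
          by (simp add: f_def inner_commute algebra_simps)
        define X1 where "X1 = (2 * Q x * (D x \<bullet> \<theta>)) * p"
        define Y1 where "Y1 = ((2 * \<zeta> x) * (\<gamma> x \<bullet> \<theta>)) * ((Q x)\<^sup>2 * p)"
        have "(\<zeta> x)\<^sup>2 * ((Q x)\<^sup>2 * f x) \<le> (\<zeta> x)\<^sup>2 * (2 * ((Q x)\<^sup>2 * f x + X1) + 4 * R\<^sup>2 * costar x (D x))"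
          unfolding X1_def by (rule mult_left_mono[OF *]) simp
        also have "\<dots> = 2 * ((\<zeta> x)\<^sup>2 * ((Q x)\<^sup>2 * f x + X1)) + 4 * R\<^sup>2 * ((\<zeta> x)\<^sup>2 * costar x (D x))"
          by (simp add: algebra_simps)
        finally have a1: "(\<zeta> x)\<^sup>2 * ((Q x)\<^sup>2 * f x) \<le> \<dots>" .
        have "\<bar>Y1\<bar> \<le> ((2 * 1) * (4 / N)) * (B\<^sup>2 * R)"
        proof -
          have "\<bar>\<gamma> x \<bullet> \<theta>\<bar> \<le> 4 / N" using Cauchy_Schwarz_ineq2[of "\<gamma> x" \<theta>] \<gamma>N[of x] \<theta> by simp
          then show ?thesis unfolding Y1_def abs_mult p_def using \<zeta>01[of x] N Q2B[of x] F\<theta>[of x] B0 R(1)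
            by (intro mult_mono) auto
        qed
        also have "\<dots> = 8 * B\<^sup>2 * R / N" by simp
        finally have a2: "\<bar>Y1\<bar> \<le> 8 * B\<^sup>2 * R / N" .
        have a3: "Dh x \<theta> = (\<zeta> x)\<^sup>2 * ((Q x)\<^sup>2 * f x + X1) + Y1"
          by (simp add: Dh_def f_def p_def X1_def Y1_def inner_commute)
        have "16 * B\<^sup>2 * R / N = 2 * (8 * B\<^sup>2 * R / N)" by simp
        then have "(\<zeta> x)\<^sup>2 * ((Q x)\<^sup>2 * f x) \<le> 2 * Dh x \<theta> + 4 * R\<^sup>2 * ((\<zeta> x)\<^sup>2 * costar x (D x)) + 16 * B\<^sup>2 * R / N"
          using a1 a2 a3 by linarith
        then have "w x * ((\<zeta> x)\<^sup>2 * ((Q x)\<^sup>2 * f x)) \<le> w x * (2 * Dh x \<theta> + 4 * R\<^sup>2 * ((\<zeta> x)\<^sup>2 * costar x (D x)) + 16 * B\<^sup>2 * R / N)"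
          using w0[of x] by (intro mult_left_mono) auto
        then show ?thesis by (simp add: algebra_simps)
      qed
      have "CC \<le> (\<integral>x. 2 * (w x * Dh x \<theta>) + 4 * R\<^sup>2 * (w x * ((\<zeta> x)\<^sup>2 * costar x (D x))) + 16 * B\<^sup>2 * R / N * w x \<partial>lborel)"
        unfolding CC_def using iC iDh iB iw pt by (intro integral_mono) auto
      also have "\<dots> = 2 * (\<integral>x. w x * Dh x \<theta> \<partial>lborel) + 4 * R\<^sup>2 * BB + 16 * B\<^sup>2 * R / N"
        using iDh iB iw wint by (simp add: BB_def)
      also have "\<dots> \<le> 2 * (R\<^sup>2 * AA) + 4 * R\<^sup>2 * BB + 16 * B\<^sup>2 * R / N" unfolding ibp using hle by simp
      finally show ?thesis by simp
    qed
    have QQ: "(\<integral>x. w x * ((\<zeta> x)\<^sup>2 * Q x ^ 3) \<partial>lborel) \<le> \<epsilon>\<^sup>2 * R * (CC + BB + R * AA + 8 * B\<^sup>2 / N)"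
    proof -
      define W where "W x = w x * ((\<zeta> x)\<^sup>2 * (Q x)\<^sup>2)" for x
      define DW where "DW x v = w x * ((\<zeta> x)\<^sup>2 * (2 * Q x * (D x \<bullet> v)) + ((2 * \<zeta> x) * (\<gamma> x \<bullet> v)) * (Q x)\<^sup>2)
          + (- (F x \<bullet> v) * w x) * ((\<zeta> x)\<^sup>2 * (Q x)\<^sup>2)" for x v
      have dW: "(W has_derivative DW x) (at x)" for x
      proof -
        have q2: "((\<lambda>x. (Q x)\<^sup>2) has_derivative (\<lambda>v. 2 * Q x * (D x \<bullet> v))) (at x)"
          using has_derivative_power[OF dQ, where n = 2] by (simp add: mult_ac)
        have dw: "(w has_derivative (\<lambda>v. - (F x \<bullet> v) * w x)) (at x)"
          unfolding w_def using psi_has_derivative[of x] by (auto intro!: derivative_eq_intros)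
        show ?thesis
          unfolding W_def DW_def[abs_def] \<zeta>_def \<gamma>_def
          by (rule has_derivative_mult[OF dw has_derivative_mult[OF cutoff_square_derivative q2]])
      qed
      have cDW: "continuous_on UNIV (\<lambda>x. DW x v)" for v unfolding DW_def
        by (intro continuous_intros cw c\<zeta> cQ cD c\<gamma> continuous_F)
      have cW: "continuous_on UNIV W" unfolding W_def by (intro continuous_intros cw c\<zeta> cQ)
      have Wout: "W x = 0" "DW x v = 0" if "norm x > N" for x v using out[OF that] by (auto simp: W_def DW_def)
      have iW: "integrable lborel W" by (rule I[OF cW Wout(1)])
      have iDW: "integrable lborel (\<lambda>x. DW x v)" for v by (rule I[OF cDW Wout(2)])
      have cps: "continuous_on UNIV (\<lambda>x. (\<psi> (x + c) - \<psi> x) * W x)" for c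
        by (intro continuous_intros c\<psi> continuous_psi cW)
      have ips: "integrable lborel (\<lambda>x. (\<psi> (x + c) - \<psi> x) * W x)" for c
        by (rule I[OF cps]) (simp add: Wout)
      have mps [measurable]: "(\<lambda>x. (\<psi> (x + c) - \<psi> x) * W x) \<in> borel_measurable borel" for c
        by (rule borel_measurable_continuous_onI[OF cps])
      have [measurable]: "W \<in> borel_measurable borel" by (rule borel_measurable_continuous_onI[OF cW])
      have iWa: "integrable lborel (\<lambda>x. W (x + a))" using iW lborel_integral_translation(1)[of W a] by simp
      \<comment> \<open>A discrete integration by parts: translating the backward difference by
        \<open>a\<close> turns the second difference against \<open>W\<close> into a product of two
        first differences. Each of them yields one factor \<epsilon>.\<close>
      have shift: "(\<integral>x. (\<psi> (x + - a) - \<psi> x) * W x \<partial>lborel) = (\<integral>x. (\<psi> x - \<psi> (x + a)) * W (x + a) \<partial>lborel)"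
        using lborel_integral_translation(2)[OF mps[of "- a"], of a] by simp
      have ishift: "integrable lborel (\<lambda>x. (\<psi> x - \<psi> (x + a)) * W (x + a))"
        using lborel_integral_translation(1)[OF mps[of "- a"], of a] ips[of "- a"] by simp
      have "(\<integral>x. w x * ((\<zeta> x)\<^sup>2 * Q x ^ 3) \<partial>lborel)
         = (\<integral>x. (\<psi> (x + a) - \<psi> x) * W x + (\<psi> (x + - a) - \<psi> x) * W x \<partial>lborel)"
      proof (rule Bochner_Integration.integral_cong)
        fix x :: "real^'n"
        have "w x * ((\<zeta> x)\<^sup>2 * Q x ^ 3) = Q x * W x" by (simp add: W_def power2_eq_square power3_eq_cube)
        then show "w x * ((\<zeta> x)\<^sup>2 * Q x ^ 3) = (\<psi> (x + a) - \<psi> x) * W x + (\<psi> (x + - a) - \<psi> x) * W x"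
          by (simp only: Qa distrib_right)
      qed simp
      also have "\<dots> = (\<integral>x. (\<psi> (x + a) - \<psi> x) * W x \<partial>lborel) + (\<integral>x. (\<psi> x - \<psi> (x + a)) * W (x + a) \<partial>lborel)"
        unfolding shift[symmetric] by (rule Bochner_Integration.integral_add[OF ips ips])
      also have "\<dots> = (\<integral>x. (\<psi> (x + a) - \<psi> x) * W x + (\<psi> x - \<psi> (x + a)) * W (x + a) \<partial>lborel)"
        by (rule Bochner_Integration.integral_add[OF ips ishift, symmetric])
      also have "\<dots> \<le> (\<integral>x. (R * \<epsilon>) * \<bar>W (x + a) - W x\<bar> \<partial>lborel)"
      proof (rule integral_mono[OF Bochner_Integration.integrable_add[OF ips ishift]])
        show "integrable lborel (\<lambda>x. (R * \<epsilon>) * \<bar>W (x + a) - W x\<bar>)" using iWa iW by simp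
        fix x
        have "(\<psi> (x + a) - \<psi> x) * W x + (\<psi> x - \<psi> (x + a)) * W (x + a) = - ((\<psi> (x + a) - \<psi> x) * (W (x + a) - W x))"
          by (simp add: algebra_simps)
        also have "\<dots> \<le> \<bar>\<psi> (x + a) - \<psi> x\<bar> * \<bar>W (x + a) - W x\<bar>" by (simp add: abs_mult[symmetric] abs_ge_minus_self)
        also have "\<dots> \<le> (R * \<epsilon>) * \<bar>W (x + a) - W x\<bar>" using lip[of x a] na by (intro mult_right_mono) auto
        finally show "(\<psi> (x + a) - \<psi> x) * W x + (\<psi> x - \<psi> (x + a)) * W (x + a) \<le> (R * \<epsilon>) * \<bar>W (x + a) - W x\<bar>" .
      qed
      also have "\<dots> = (R * \<epsilon>) * (\<integral>x. \<bar>W (x + a) - W x\<bar> \<partial>lborel)" by simp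
      also have "\<dots> \<le> (R * \<epsilon>) * (\<integral>x. \<bar>DW x a\<bar> \<partial>lborel)"
        using R \<epsilon> by (intro mult_left_mono integral_translation_difference_le[OF dW cDW iW iDW]) auto
      also have "(\<integral>x. \<bar>DW x a\<bar> \<partial>lborel) = (\<integral>x. \<epsilon> * \<bar>DW x \<theta>\<bar> \<partial>lborel)"
      proof (rule Bochner_Integration.integral_cong)
        fix x
        have "DW x a = \<epsilon> * DW x \<theta>" by (simp add: DW_def a_def algebra_simps)
        then show "\<bar>DW x a\<bar> = \<epsilon> * \<bar>DW x \<theta>\<bar>" using \<epsilon> by (simp add: abs_mult)
      qed simp
      also have "\<dots> = \<epsilon> * (\<integral>x. \<bar>DW x \<theta>\<bar> \<partial>lborel)" by simp
      also have "(\<integral>x. \<bar>DW x \<theta>\<bar> \<partial>lborel) \<le> CC + BB + R * AA + 8 * B\<^sup>2 / N"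
      proof -
        have pt: "\<bar>DW x \<theta>\<bar> \<le> w x * ((\<zeta> x)\<^sup>2 * ((Q x)\<^sup>2 * f x)) + w x * ((\<zeta> x)\<^sup>2 * costar x (D x))
            + R * (w x * ((\<zeta> x)\<^sup>2 * (Q x)\<^sup>2)) + 8 * B\<^sup>2 / N * w x" for x
        proof -
          have m: "0 \<le> (Q x)\<^sup>2 * (\<theta> \<bullet> (H x *v \<theta>)) + 2 * Q x * s * (\<theta> \<bullet> D x) + s\<^sup>2 * costar x (D x)" for s
            by (rule costar_mixed_H)
          have 1: "\<bar>2 * Q x * (D x \<bullet> \<theta>)\<bar> \<le> (Q x)\<^sup>2 * f x + costar x (D x)"
            using m[of 1] m[of "-1"] by (simp add: f_def inner_commute abs_le_iff)
          have 2: "\<bar>((2 * \<zeta> x) * (\<gamma> x \<bullet> \<theta>)) * (Q x)\<^sup>2\<bar> \<le> ((2 * 1) * (4 / N)) * B\<^sup>2"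
          proof -
            have "\<bar>\<gamma> x \<bullet> \<theta>\<bar> \<le> 4 / N" using Cauchy_Schwarz_ineq2[of "\<gamma> x" \<theta>] \<gamma>N[of x] \<theta> by simp
            then show ?thesis unfolding abs_mult using \<zeta>01[of x] N Q2B[of x] by (intro mult_mono) auto
          qed
          have 3: "\<bar>(F x \<bullet> \<theta>) * ((\<zeta> x)\<^sup>2 * (Q x)\<^sup>2)\<bar> \<le> R * ((\<zeta> x)\<^sup>2 * (Q x)\<^sup>2)"
            unfolding abs_mult using F\<theta>[of x] by (auto intro!: mult_right_mono)
          have one: "\<bar>(\<zeta> x)\<^sup>2 * (2 * Q x * (D x \<bullet> \<theta>))\<bar> \<le> (\<zeta> x)\<^sup>2 * ((Q x)\<^sup>2 * f x + costar x (D x))"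
            unfolding abs_mult[of "(\<zeta> x)\<^sup>2"] using 1 by (auto intro!: mult_left_mono)
          have "DW x \<theta> = w x * ((\<zeta> x)\<^sup>2 * (2 * Q x * (D x \<bullet> \<theta>)) + ((2 * \<zeta> x) * (\<gamma> x \<bullet> \<theta>)) * (Q x)\<^sup>2
              - (F x \<bullet> \<theta>) * ((\<zeta> x)\<^sup>2 * (Q x)\<^sup>2))"
            by (simp add: DW_def algebra_simps)
          then have "\<bar>DW x \<theta>\<bar> = w x * \<bar>(\<zeta> x)\<^sup>2 * (2 * Q x * (D x \<bullet> \<theta>)) + ((2 * \<zeta> x) * (\<gamma> x \<bullet> \<theta>)) * (Q x)\<^sup>2
              - (F x \<bullet> \<theta>) * ((\<zeta> x)\<^sup>2 * (Q x)\<^sup>2)\<bar>"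
            using w0[of x] by (simp add: abs_mult)
          also have "\<dots> \<le> w x * ((\<zeta> x)\<^sup>2 * ((Q x)\<^sup>2 * f x + costar x (D x)) + ((2 * 1) * (4 / N)) * B\<^sup>2 + R * ((\<zeta> x)\<^sup>2 * (Q x)\<^sup>2))"
            using one 2 3 w0[of x] by (intro mult_left_mono) linarith+
          finally show ?thesis by (simp add: algebra_simps)
        qed
        have "(\<integral>x. \<bar>DW x \<theta>\<bar> \<partial>lborel) \<le> (\<integral>x. w x * ((\<zeta> x)\<^sup>2 * ((Q x)\<^sup>2 * f x)) + w x * ((\<zeta> x)\<^sup>2 * costar x (D x))
            + R * (w x * ((\<zeta> x)\<^sup>2 * (Q x)\<^sup>2)) + 8 * B\<^sup>2 / N * w x \<partial>lborel)"
          using iDW[of \<theta>] iC iB iA iw pt by (intro integral_mono) auto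
        also have "\<dots> = CC + BB + R * AA + 8 * B\<^sup>2 / N"
          using iC iB iA iw wint by (simp add: AA_def BB_def CC_def)
        finally show ?thesis .
      qed
      finally show ?thesis using R \<epsilon> by (simp add: power2_eq_square mult_ac mult_left_mono)
    qed
    \<comment> \<open>The bound on \<open>BB\<close> is inserted into that on \<open>CC\<close>:
      \<open>2 * R\<^sup>2\<close> and four times \<open>R\<^sup>2\<close> times 2 make
      \<open>10 * R\<^sup>2\<close>, while \<open>BB\<close> itself contributes the 2 and the drift
      of the weight the \<open>R\<close>.\<close>
    have "CC + BB + R * AA + 8 * B\<^sup>2 / N \<le> (10 * R\<^sup>2 + R + 2) * AA + k / N"
    proof -
      have "4 * R\<^sup>2 * BB \<le> 4 * R\<^sup>2 * (2 * AA + 4 * B\<^sup>2 * C / N)" by (rule mult_left_mono[OF BBle]) simp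
      with CCle BBle have "CC + BB + R * AA + 8 * B\<^sup>2 / N \<le> 2 * R\<^sup>2 * AA + 4 * R\<^sup>2 * (2 * AA + 4 * B\<^sup>2 * C / N)
         + 16 * B\<^sup>2 * R / N + (2 * AA + 4 * B\<^sup>2 * C / N) + R * AA + 8 * B\<^sup>2 / N" by linarith
      also have "\<dots> = (10 * R\<^sup>2 + R + 2) * AA + k / N"
        using N by (simp add: k_def field_simps)
      finally show ?thesis .
    qed
    then have "\<epsilon>\<^sup>2 * R * (CC + BB + R * AA + 8 * B\<^sup>2 / N) \<le> \<epsilon>\<^sup>2 * R * ((10 * R\<^sup>2 + R + 2) * AA + k / N)"
      using R by (intro mult_left_mono) auto
    with QQ show ?thesis unfolding AA_def \<zeta>_def by linarith
  qed
  \<comment> \<open>The cutoff is removed by dominated convergence, which applies since powers of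
    \<open>Q\<close> are bounded for a fixed step and the weight has total mass 1.\<close>
  have lim: "(\<lambda>n. \<integral>x. w x * ((cutoff (real (Suc n)) x)\<^sup>2 * u x) \<partial>lborel) \<longlonglongrightarrow> (\<integral>x. w x * u x \<partial>lborel)"
    if u: "continuous_on UNIV u" "\<And>x. \<bar>u x\<bar> \<le> b" for u :: "real^'n \<Rightarrow> real" and b
  proof (rule integral_dominated_convergence[where w = "\<lambda>x. b * w x"])
    show "(\<lambda>x. w x * u x) \<in> borel_measurable lborel"
      using borel_measurable_continuous_onI[OF continuous_on_mult[OF cw u(1)]] by simp
    show "(\<lambda>x. w x * ((cutoff (real (Suc n)) x)\<^sup>2 * u x)) \<in> borel_measurable lborel" for n
      using borel_measurable_continuous_onI[OF continuous_on_mult[OF cw continuous_on_mult[OF continuous_on_power[OF cutoff_continuous] u(1)]], of "real (Suc n)" 2] by simp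
    show "integrable lborel (\<lambda>x. b * w x)" using iw by simp
    have "(\<lambda>n. w x * ((cutoff (real (Suc n)) x)\<^sup>2 * u x)) \<longlonglongrightarrow> w x * (1\<^sup>2 * u x)" for x
      by (intro tendsto_intros cutoff_tendsto_1)
    then show "AE x in lborel. (\<lambda>n. w x * ((cutoff (real (Suc n)) x)\<^sup>2 * u x)) \<longlonglongrightarrow> w x * u x"
      by (intro AE_I2) simp
    show "AE x in lborel. norm (w x * ((cutoff (real (Suc n)) x)\<^sup>2 * u x)) \<le> b * w x" for n
    proof (rule AE_I2)
      fix x :: "real^'n"
      have "(cutoff (real (Suc n)) x)\<^sup>2 \<le> 1" by (intro power_le_one cutoff_nonneg cutoff_le_1)
      then have "(cutoff (real (Suc n)) x)\<^sup>2 * \<bar>u x\<bar> \<le> 1 * b" using u(2)[of x] by (intro mult_mono) auto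
      then have "w x * ((cutoff (real (Suc n)) x)\<^sup>2 * \<bar>u x\<bar>) \<le> w x * b" using w0[of x] by (intro mult_left_mono) auto
      then show "norm (w x * ((cutoff (real (Suc n)) x)\<^sup>2 * u x)) \<le> b * w x"
        using w0[of x] by (simp add: abs_mult mult_ac)
    qed
  qed
  have l3: "(\<lambda>n. \<integral>x. w x * ((cutoff (real (Suc n)) x)\<^sup>2 * Q x ^ 3) \<partial>lborel) \<longlonglongrightarrow> (\<integral>x. w x * Q x ^ 3 \<partial>lborel)"
  proof (rule lim)
    show "\<bar>Q x ^ 3\<bar> \<le> B ^ 3" for x using Q0 QB by (auto simp: B_def power_abs intro!: power_mono)
  qed (intro continuous_intros cQ)
  have l2: "(\<lambda>n. \<integral>x. w x * ((cutoff (real (Suc n)) x)\<^sup>2 * (Q x)\<^sup>2) \<partial>lborel) \<longlonglongrightarrow> (\<integral>x. w x * (Q x)\<^sup>2 \<partial>lborel)"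
  proof (rule lim)
    show "\<bar>(Q x)\<^sup>2\<bar> \<le> B\<^sup>2" for x using Q2B by simp
  qed (intro continuous_intros cQ)
  have lk: "(\<lambda>n. k / real (Suc n)) \<longlonglongrightarrow> 0"
    using tendsto_mult[OF tendsto_const[of k] LIMSEQ_inverse_real_of_nat] by (simp add: divide_inverse)
  have "(\<integral>x. w x * Q x ^ 3 \<partial>lborel) \<le> \<epsilon>\<^sup>2 * R * ((10 * R\<^sup>2 + R + 2) * (\<integral>x. w x * (Q x)\<^sup>2 \<partial>lborel) + 0)"
  proof (rule tendsto_le[OF _ _ l3])
    show "(\<lambda>n. \<epsilon>\<^sup>2 * R * ((10 * R\<^sup>2 + R + 2) * (\<integral>x. w x * ((cutoff (real (Suc n)) x)\<^sup>2 * (Q x)\<^sup>2) \<partial>lborel) + k / real (Suc n)))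
       \<longlonglongrightarrow> \<epsilon>\<^sup>2 * R * ((10 * R\<^sup>2 + R + 2) * (\<integral>x. w x * (Q x)\<^sup>2 \<partial>lborel) + 0)"
      by (intro tendsto_intros l2 lk)
    show "\<forall>\<^sub>F n in sequentially. (\<integral>x. w x * ((cutoff (real (Suc n)) x)\<^sup>2 * Q x ^ 3) \<partial>lborel)
      \<le> \<epsilon>\<^sup>2 * R * ((10 * R\<^sup>2 + R + 2) * (\<integral>x. w x * ((cutoff (real (Suc n)) x)\<^sup>2 * (Q x)\<^sup>2) \<partial>lborel) + k / real (Suc n))"
      by (intro always_eventually allI main) simp
  qed simp
  then show "(\<integral>x. exp (- \<psi> x) * Q x ^ 3 \<partial>lborel) \<le> R * (10 * R\<^sup>2 + R + 2) * \<epsilon>\<^sup>2 * (\<integral>x. exp (- \<psi> x) * (Q x)\<^sup>2 \<partial>lborel)"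
    unfolding w_def by (simp add: mult_ac)
qed

end

section \<open>Passage from difference quotients to the Hessian\<close>

context moment_map
begin

definition w :: "real^'n \<Rightarrow> real" where "w x = exp (- \<psi> x)"

lemma w_pos: "0 < w x" by (simp add: w_def)

lemma w_integrable: "integrable lborel w" and w_integral: "(\<integral>x. w x \<partial>lborel) = 1"
  unfolding w_def using exp_psi_integrable exp_psi_integral by auto

lemma continuous_w: "continuous_on S w"
  unfolding w_def by (intro continuous_intros continuous_psi)

lemma w_integrable_bounded:
  fixes u :: "real^'n \<Rightarrow> real"
  assumes "continuous_on UNIV u" "\<And>x. \<bar>u x\<bar> \<le> b"
  shows "integrable lborel (\<lambda>x. w x * u x)"
proof (rule Bochner_Integration.integrable_bound[of _ "\<lambda>x. b * w x"])
  show "(\<lambda>x. w x * u x) \<in> borel_measurable lborel"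
    using borel_measurable_continuous_onI[OF continuous_on_mult[OF continuous_w assms(1)]] by simp
  show "AE x in lborel. norm (w x * u x) \<le> norm (b * w x)"
  proof (rule AE_I2)
    fix x
    have "\<bar>u x\<bar> \<le> \<bar>b\<bar>" using assms(2)[of x] by linarith
    then have "w x * \<bar>u x\<bar> \<le> w x * \<bar>b\<bar>" using w_pos[of x] by (intro mult_left_mono) auto
    then show "norm (w x * u x) \<le> norm (b * w x)" using w_pos[of x] by (simp add: abs_mult mult.commute)
  qed
qed (use w_integrable in simp)

text \<open>With \<open>s = c * \<epsilon>\<^sup>2\<close> the previous estimate reads E Q^3 \<le> s
  E Q^2. Where Q is at least 2 s, half of Q^3 dominates s Q^2; elsewhere s Q^2 is at most 4 s^3.
  Absorbing the half, which is legitimate because E Q^3 is finite, leaves 8 s^3, and this scales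
  like the sixth power of the step.\<close>

lemma second_difference_quotient_cube_bound:
  assumes R: "R > 0" "\<And>x. norm (F x) \<le> R" and \<theta>: "norm \<theta> = 1" and \<epsilon>: "0 < \<epsilon>"
    and c: "c = R * (10 * R\<^sup>2 + R + 2)"
  shows "(\<integral>\<^sup>+x. ennreal (w x * ((\<psi> (x + \<epsilon> *\<^sub>R \<theta>) + \<psi> (x - \<epsilon> *\<^sub>R \<theta>) - 2 * \<psi> x) / \<epsilon>\<^sup>2) ^ 3) \<partial>lborel) \<le> ennreal (8 * c ^ 3)"
proof -
  define Q where "Q = (\<lambda>x. \<psi> (x + \<epsilon> *\<^sub>R \<theta>) + \<psi> (x - \<epsilon> *\<^sub>R \<theta>) - 2 * \<psi> x)"
  note base = second_difference_cube_le[OF R \<theta> \<epsilon> Q_def, folded w_def c]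
  have c0: "0 \<le> c" using R(1) unfolding c by (intro mult_nonneg_nonneg add_nonneg_nonneg) auto
  have cQ: "continuous_on UNIV Q" unfolding Q_def
    by (intro continuous_intros continuous_psi continuous_on_compose2[OF continuous_psi[of UNIV]]) auto
  have i2: "integrable lborel (\<lambda>x. w x * (Q x)\<^sup>2)"
  proof (rule w_integrable_bounded)
    show "\<bar>(Q x)\<^sup>2\<bar> \<le> (2 * R * \<epsilon>)\<^sup>2" for x using base(2,3)[of x] by (auto intro!: power_mono)
  qed (intro continuous_intros cQ)
  have i3: "integrable lborel (\<lambda>x. w x * Q x ^ 3)"
  proof (rule w_integrable_bounded)
    show "\<bar>Q x ^ 3\<bar> \<le> (2 * R * \<epsilon>) ^ 3" for x using base(2,3)[of x] by (auto simp: power_abs intro!: power_mono)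
  qed (intro continuous_intros cQ)
  have "(\<integral>x. w x * Q x ^ 3 \<partial>lborel) \<le> (\<integral>x. c * \<epsilon>\<^sup>2 * (w x * (Q x)\<^sup>2) \<partial>lborel)"
    using base(1) by simp
  also have "\<dots> \<le> (\<integral>x. 1/2 * (w x * Q x ^ 3) + 4 * c ^ 3 * \<epsilon> ^ 6 * w x \<partial>lborel)"
  proof (rule integral_mono)
    show "integrable lborel (\<lambda>x. c * \<epsilon>\<^sup>2 * (w x * (Q x)\<^sup>2))" using i2 by simp
    show "integrable lborel (\<lambda>x. 1/2 * (w x * Q x ^ 3) + 4 * c ^ 3 * \<epsilon> ^ 6 * w x)" using i3 w_integrable by simp
    fix x
    define s where "s = c * \<epsilon>\<^sup>2"
    have s0: "0 \<le> s" using c0 by (simp add: s_def)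
    have "s * (Q x)\<^sup>2 \<le> 1/2 * Q x ^ 3 + 4 * s ^ 3"
    proof (cases "2 * s \<le> Q x")
      case True
      then have "s * (Q x)\<^sup>2 \<le> (Q x / 2) * (Q x)\<^sup>2" by (intro mult_right_mono) auto
      moreover have "0 \<le> s ^ 3" using s0 by simp
      ultimately show ?thesis by (simp add: power2_eq_square power3_eq_cube)
    next
      case False
      then have "(Q x)\<^sup>2 \<le> (2 * s)\<^sup>2" using base(2)[of x] by (intro power_mono) auto
      then have "s * (Q x)\<^sup>2 \<le> s * (2 * s)\<^sup>2" using s0 by (rule mult_left_mono)
      moreover have "0 \<le> Q x ^ 3" using base(2)[of x] by simp
      ultimately show ?thesis by (simp add: power2_eq_square power3_eq_cube)
    qed
    then have "w x * (s * (Q x)\<^sup>2) \<le> w x * (1/2 * Q x ^ 3 + 4 * s ^ 3)" using w_pos[of x] by (intro mult_left_mono) auto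
    moreover have "s ^ 3 = c ^ 3 * \<epsilon> ^ 6" by (simp add: s_def power_mult_distrib power_mult[symmetric])
    ultimately show "c * \<epsilon>\<^sup>2 * (w x * (Q x)\<^sup>2) \<le> 1/2 * (w x * Q x ^ 3) + 4 * c ^ 3 * \<epsilon> ^ 6 * w x"
      by (simp add: s_def algebra_simps)
  qed
  also have "\<dots> = 1/2 * (\<integral>x. w x * Q x ^ 3 \<partial>lborel) + 4 * c ^ 3 * \<epsilon> ^ 6"
    using i3 w_integrable by (simp add: w_integral)
  finally have le: "(\<integral>x. w x * Q x ^ 3 \<partial>lborel) \<le> 8 * c ^ 3 * \<epsilon> ^ 6" by simp
  have eq: "w x * (Q x / \<epsilon>\<^sup>2) ^ 3 = (1 / \<epsilon> ^ 6) * (w x * Q x ^ 3)" for x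
    by (simp add: power_divide power_mult[symmetric])
  have i4: "integrable lborel (\<lambda>x. w x * (Q x / \<epsilon>\<^sup>2) ^ 3)" unfolding eq using i3 by simp
  have nn: "0 \<le> w x * (Q x / \<epsilon>\<^sup>2) ^ 3" for x using w_pos[of x] base(2)[of x] by simp
  have "(\<integral>\<^sup>+x. ennreal (w x * (Q x / \<epsilon>\<^sup>2) ^ 3) \<partial>lborel) = ennreal (\<integral>x. w x * (Q x / \<epsilon>\<^sup>2) ^ 3 \<partial>lborel)"
    by (rule nn_integral_eq_integral[OF i4]) (simp add: nn)
  also have "(\<integral>x. w x * (Q x / \<epsilon>\<^sup>2) ^ 3 \<partial>lborel) = (1 / \<epsilon> ^ 6) * (\<integral>x. w x * Q x ^ 3 \<partial>lborel)"
    unfolding eq by simp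
  also have "\<dots> \<le> (1 / \<epsilon> ^ 6) * (8 * c ^ 3 * \<epsilon> ^ 6)" using le by (intro mult_left_mono) auto
  also have "\<dots> = 8 * c ^ 3" using \<epsilon> by simp
  finally show ?thesis unfolding Q_def by (simp add: ennreal_leI)
qed

lemma second_difference_quotient_tendsto:
  "(\<lambda>n. (\<psi> (x + inverse (real (Suc n)) *\<^sub>R \<theta>) + \<psi> (x - inverse (real (Suc n)) *\<^sub>R \<theta>) - 2 * \<psi> x) / (inverse (real (Suc n)))\<^sup>2)
     \<longlonglongrightarrow> \<theta> \<bullet> (H x *v \<theta>)"
proof -
  define e where "e n = inverse (real (Suc n))" for n
  have e: "0 < e n" for n by (simp add: e_def)
  have "\<forall>n. \<exists>b. \<bar>b\<bar> < e n \<and> \<psi> (x + e n *\<^sub>R \<theta>) + \<psi> (x - e n *\<^sub>R \<theta>) - 2 * \<psi> x = e n * e n * (\<theta> \<bullet> (H (x + b *\<^sub>R \<theta>) *v \<theta>))"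
    using second_difference_eq[OF e] by blast
  from choice[OF this] obtain b where b: "\<And>n. \<bar>b n\<bar> < e n"
    "\<And>n. \<psi> (x + e n *\<^sub>R \<theta>) + \<psi> (x - e n *\<^sub>R \<theta>) - 2 * \<psi> x = e n * e n * (\<theta> \<bullet> (H (x + b n *\<^sub>R \<theta>) *v \<theta>))"
    by blast
  have "e \<longlonglongrightarrow> 0" unfolding e_def[abs_def] by (rule LIMSEQ_inverse_real_of_nat)
  then have "b \<longlonglongrightarrow> 0"
    by (rule Lim_null_comparison[rotated]) (use b(1) in \<open>auto intro!: always_eventually less_imp_le\<close>)
  then have "(\<lambda>n. x + b n *\<^sub>R \<theta>) \<longlonglongrightarrow> x + 0 *\<^sub>R \<theta>" by (intro tendsto_intros)
  moreover have "isCont (\<lambda>y. \<theta> \<bullet> (H y *v \<theta>)) x"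
  proof -
    have "continuous_on UNIV (\<lambda>y. \<theta> \<bullet> (H y *v \<theta>))"
      by (intro continuous_intros continuous_on_matrix_vector continuous_H)
    then show ?thesis by (simp add: continuous_on_eq_continuous_at)
  qed
  ultimately have "(\<lambda>n. \<theta> \<bullet> (H (x + b n *\<^sub>R \<theta>) *v \<theta>)) \<longlonglongrightarrow> \<theta> \<bullet> (H x *v \<theta>)"
    by (intro isCont_tendsto_compose[of _ "\<lambda>y. \<theta> \<bullet> (H y *v \<theta>)"]) auto
  moreover have "(\<psi> (x + e n *\<^sub>R \<theta>) + \<psi> (x - e n *\<^sub>R \<theta>) - 2 * \<psi> x) / (e n)\<^sup>2 = \<theta> \<bullet> (H (x + b n *\<^sub>R \<theta>) *v \<theta>)" for n
    unfolding b(2) using e[of n] by (simp add: power2_eq_square)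
  ultimately show ?thesis by (simp add: e_def)
qed

text \<open>The difference quotients are nonnegative by convexity, so Fatou applies without a
  dominating function and the limit inherits the bound on the third moment. For a nonnegative number
  the square is at most 1 plus the cube, which gives the second moment.\<close>

lemma hessian_form_square_integrable:
  assumes \<theta>: "norm \<theta> = 1"
  shows "integrable lborel (\<lambda>x. w x * (\<theta> \<bullet> (H x *v \<theta>))\<^sup>2)"
proof -
  obtain R where R: "R > 0" "\<And>x. norm (F x) \<le> R" using F_bounded by metis
  define c where "c = R * (10 * R\<^sup>2 + R + 2)"
  define f where "f x = \<theta> \<bullet> (H x *v \<theta>)" for x
  have cf: "continuous_on UNIV f" unfolding f_def
    by (intro continuous_intros continuous_on_matrix_vector continuous_H)
  have f0: "0 \<le> f x" for x by (simp add: f_def H_psd)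
  define q where "q n x = (\<psi> (x + inverse (real (Suc n)) *\<^sub>R \<theta>) + \<psi> (x - inverse (real (Suc n)) *\<^sub>R \<theta>) - 2 * \<psi> x) / (inverse (real (Suc n)))\<^sup>2" for n x
  have [measurable]: "q n \<in> borel_measurable borel" for n
    unfolding q_def[abs_def] divide_inverse
    by (intro borel_measurable_continuous_onI continuous_intros continuous_psi continuous_on_compose2[OF continuous_psi[of UNIV]]) auto
  have [measurable]: "w \<in> borel_measurable borel" by (rule borel_measurable_continuous_onI[OF continuous_w])
  have lim: "(\<lambda>n. ennreal (w x * q n x ^ 3)) \<longlonglongrightarrow> ennreal (w x * f x ^ 3)" for x
    unfolding q_def f_def by (intro tendsto_ennrealI tendsto_intros second_difference_quotient_tendsto)
  have "(\<integral>\<^sup>+x. ennreal (w x * f x ^ 3) \<partial>lborel) = (\<integral>\<^sup>+x. liminf (\<lambda>n. ennreal (w x * q n x ^ 3)) \<partial>lborel)"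
    by (intro nn_integral_cong lim_imp_Liminf[symmetric] lim) simp
  also have "\<dots> \<le> liminf (\<lambda>n. \<integral>\<^sup>+x. ennreal (w x * q n x ^ 3) \<partial>lborel)"
    by (rule nn_integral_liminf) measurable
  also have "\<dots> \<le> liminf (\<lambda>n::nat. ennreal (8 * c ^ 3))"
    by (rule Liminf_mono) (auto intro!: always_eventually second_difference_quotient_cube_bound[OF R \<theta> _ c_def] simp: q_def)
  also have "\<dots> = ennreal (8 * c ^ 3)" by (simp add: Liminf_const)
  finally have fin: "(\<integral>\<^sup>+x. ennreal (w x * f x ^ 3) \<partial>lborel) < \<infinity>" by (simp add: le_less_trans ennreal_less_top)
  have m3: "(\<lambda>x. w x * f x ^ 3) \<in> borel_measurable lborel"
    using borel_measurable_continuous_onI[OF continuous_on_mult[OF continuous_w continuous_on_power[OF cf]]] by simp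
  have m2: "(\<lambda>x. w x * (f x)\<^sup>2) \<in> borel_measurable lborel"
    using borel_measurable_continuous_onI[OF continuous_on_mult[OF continuous_w continuous_on_power[OF cf]]] by simp
  have i3: "integrable lborel (\<lambda>x. w x * f x ^ 3)"
    by (rule integrableI_nonneg[OF m3 _ fin]) (intro AE_I2 mult_nonneg_nonneg zero_le_power less_imp_le[OF w_pos] f0)
  have "integrable lborel (\<lambda>x. w x * (f x)\<^sup>2)"
  proof (rule Bochner_Integration.integrable_bound[OF _ m2])
    show "integrable lborel (\<lambda>x. w x + w x * f x ^ 3)" using i3 w_integrable by simp
    show "AE x in lborel. norm (w x * (f x)\<^sup>2) \<le> norm (w x + w x * f x ^ 3)"
    proof (rule AE_I2)
      fix x
      have "(f x)\<^sup>2 \<le> 1 + f x ^ 3"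
      proof (cases "f x \<le> 1")
        case True
        then have "(f x)\<^sup>2 \<le> 1" using f0[of x] by (intro power_le_one) auto
        moreover have "0 \<le> f x ^ 3" using f0[of x] by simp
        ultimately show ?thesis by linarith
      next
        case False
        then have "(f x)\<^sup>2 \<le> f x ^ 3" by (intro power_increasing) auto
        then show ?thesis by simp
      qed
      then have "w x * (f x)\<^sup>2 \<le> w x * (1 + f x ^ 3)" using w_pos[of x] by (intro mult_left_mono) auto
      then show "norm (w x * (f x)\<^sup>2) \<le> norm (w x + w x * f x ^ 3)"
        using w_pos[of x] f0[of x] by (simp add: distrib_left abs_of_nonneg)
    qed
  qed
  then show ?thesis by (simp add: f_def)
qed

text \<open>A single integrable majorant for all products of two entries of \<open>H\<close>: the
  entries of a positive semidefinite matrix are controlled by its diagonal.\<close>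

definition diag_square :: "real^'n \<Rightarrow> real" where
  "diag_square x = (\<Sum>i\<in>UNIV. (H x $ i $ i)\<^sup>2)"

lemma axis_H_axis: "axis i 1 \<bullet> (H x *v axis j 1) = H x $ i $ j"
  by (simp add: matrix_vector_mult_basis column_def inner_axis')

lemma diag_square_integrable: "integrable lborel (\<lambda>x. w x * diag_square x)"
  unfolding diag_square_def sum_distrib_left
  by (intro Bochner_Integration.integrable_sum)
    (use hessian_form_square_integrable[of "axis _ 1"] in \<open>simp add: axis_H_axis\<close>)

text \<open>Testing the nonnegative form on the sum and on the difference of two basis vectors
  bounds an off-diagonal entry by the mean of two diagonal ones.\<close>

lemma H_entry_square_le: "(H x $ i $ j)\<^sup>2 \<le> diag_square x"
proof -
  let ?u = "axis i 1 :: real^'n" and ?v = "axis j 1 :: real^'n"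
  have s: "H x $ j $ i = H x $ i $ j" by (rule symmetric_matrix_entry[OF H_transpose])
  have "0 \<le> (?u + ?v) \<bullet> (H x *v (?u + ?v))" "0 \<le> (?u - ?v) \<bullet> (H x *v (?u - ?v))" by (rule H_psd)+
  then have "\<bar>H x $ i $ j\<bar> \<le> (H x $ i $ i + H x $ j $ j) / 2"
    by (simp add: matrix_vector_right_distrib matrix_vector_mult_diff_distrib inner_add_left inner_add_right
        inner_diff_left inner_diff_right axis_H_axis s abs_le_iff)
  then have "\<bar>H x $ i $ j\<bar> \<le> \<bar>(H x $ i $ i + H x $ j $ j) / 2\<bar>" by (rule order_trans[OF _ abs_ge_self])
  then have "(H x $ i $ j)\<^sup>2 \<le> ((H x $ i $ i + H x $ j $ j) / 2)\<^sup>2" by (simp only: abs_le_square_iff)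
  also have "\<dots> \<le> ((H x $ i $ i)\<^sup>2 + (H x $ j $ j)\<^sup>2) / 2"
    using zero_le_power2[of "H x $ i $ i - H x $ j $ j"] by (simp add: power2_eq_square field_simps)
  also have "\<dots> \<le> diag_square x"
  proof -
    have "(H x $ k $ k)\<^sup>2 \<le> diag_square x" for k
      unfolding diag_square_def by (rule member_le_sum) auto
    from this[of i] this[of j] show ?thesis by simp
  qed
  finally show ?thesis .
qed

lemma w_integrable_quadratic_growth:
  fixes u :: "real^'n \<Rightarrow> real"
  assumes cu: "continuous_on UNIV u" and le: "\<And>x. \<bar>u x\<bar> \<le> C * (1 + diag_square x)"
  shows "integrable lborel (\<lambda>x. w x * u x)"
proof (rule Bochner_Integration.integrable_bound)
  show "integrable lborel (\<lambda>x. C * (w x + w x * diag_square x))" using w_integrable diag_square_integrable by simp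
  show "(\<lambda>x. w x * u x) \<in> borel_measurable lborel"
    using borel_measurable_continuous_onI[OF continuous_on_mult[OF continuous_w cu]] by simp
  show "AE x in lborel. norm (w x * u x) \<le> norm (C * (w x + w x * diag_square x))"
  proof (rule AE_I2)
    fix x
    have "w x * \<bar>u x\<bar> \<le> w x * (C * (1 + diag_square x))" using le w_pos[of x] by (intro mult_left_mono) auto
    then show "norm (w x * u x) \<le> norm (C * (w x + w x * diag_square x))"
      using w_pos[of x] by (simp add: abs_mult algebra_simps)
  qed
qed

lemma H_entry_abs_le: "\<bar>H x $ i $ j\<bar> \<le> 1 + diag_square x"
proof -
  have "\<bar>H x $ i $ j\<bar> \<le> 1 + (H x $ i $ j)\<^sup>2"
    using zero_le_power2[of "\<bar>H x $ i $ j\<bar> - 1"] by (simp add: power2_eq_square algebra_simps abs_mult_self_eq)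
  then show ?thesis using H_entry_square_le[of x i j] by linarith
qed

lemma H_entry_product_abs_le: "\<bar>H x $ i $ j * H x $ k $ l\<bar> \<le> 1 + diag_square x"
proof -
  have "\<bar>H x $ i $ j * H x $ k $ l\<bar> \<le> ((H x $ i $ j)\<^sup>2 + (H x $ k $ l)\<^sup>2) / 2"
    using zero_le_power2[of "\<bar>H x $ i $ j\<bar> - \<bar>H x $ k $ l\<bar>"]
    by (simp add: abs_mult power2_eq_square algebra_simps abs_mult_self_eq)
  also have "\<dots> \<le> diag_square x"
    using add_mono[OF H_entry_square_le[of x i j] H_entry_square_le[of x k l]] by simp
  finally show ?thesis by simp
qed

lemma F_component_bounded: obtains R where "R > 0" "\<And>x i. \<bar>F x $ i\<bar> \<le> R" "\<And>x. norm (F x) \<le> R"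
proof -
  obtain R where R: "R > 0" "\<And>x. norm (F x) \<le> R" using F_bounded by metis
  show ?thesis by (rule that[of R]) (use R component_le_norm_cart order_trans in blast)+
qed

lemma integrable_w_H_H: "integrable lborel (\<lambda>x. w x * (H x $ i $ j * H x $ k $ l))"
  by (rule w_integrable_quadratic_growth[of _ 1])
    (use H_entry_product_abs_le in \<open>auto intro!: continuous_intros continuous_H\<close>)

lemma integrable_w_H_times_bounded:
  fixes u :: "real^'n \<Rightarrow> real"
  assumes "continuous_on UNIV u" "\<And>x. \<bar>u x\<bar> \<le> b"
  shows "integrable lborel (\<lambda>x. w x * (u x * H x $ i $ j))"
proof (rule w_integrable_quadratic_growth[of _ b])
  show "continuous_on UNIV (\<lambda>x. u x * H x $ i $ j)" by (intro continuous_intros assms continuous_H)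
  show "\<bar>u x * H x $ i $ j\<bar> \<le> b * (1 + diag_square x)" for x
    unfolding abs_mult using assms(2)[of x] by (intro mult_mono assms(2) H_entry_abs_le) auto
qed

end

section \<open>The Brascamp-Lieb inequality\<close>

text \<open>The Taylor remainder carries the factor \<open>exp s / 6\<close>, and
  \<open>exp s\<close> is at most 3 on the unit interval.\<close>

lemma exp_quadratic_lower:
  fixes x :: real
  assumes "\<bar>x\<bar> \<le> 1"
  shows "1 + x + x\<^sup>2 / 2 - \<bar>x\<bar> ^ 3 / 2 \<le> exp x"
proof -
  obtain s where s: "\<bar>s\<bar> \<le> \<bar>x\<bar>" "exp x = (\<Sum>m<3. x ^ m / fact m) + exp s / fact 3 * x ^ 3"
    using Maclaurin_exp_le[of x 3] by blast
  have "exp s \<le> exp 1" using s(1) assms by simp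
  also have "\<dots> \<le> 3" by (rule exp_le)
  finally have e: "exp s / 6 \<le> 1 / 2" by simp
  have "\<bar>exp s / 6 * x ^ 3\<bar> \<le> 1 / 2 * \<bar>x\<bar> ^ 3"
    unfolding abs_mult power_abs using e by (intro mult_right_mono) auto
  then have "- (\<bar>x\<bar> ^ 3 / 2) \<le> exp s / 6 * x ^ 3" by linarith
  moreover have "exp x = 1 + x + x\<^sup>2 / 2 + exp s / 6 * x ^ 3"
    using s(2) by (simp add: numeral_3_eq_3 fact_numeral power2_eq_square eval_nat_numeral)
  ultimately show ?thesis by linarith
qed

text \<open>The two sides agree through first order, so their difference is \<open>t\<^sup>2\<close>
  times a polynomial \<open>p\<close> that is nonnegative for small positive \<open>t\<close>. Its
  value at 0 is \<open>2 * (b - a) + m\<^sup>2\<close>.\<close>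

lemma variance_of_product_expansion:
  fixes a b d l m :: real
  assumes le: "\<forall>\<^sub>F t in at_right 0. (1 + t * m + a * t\<^sup>2 - l * t ^ 3) * (1 - t * m + a * t\<^sup>2 - l * t ^ 3) \<le> (1 + b * t\<^sup>2 + d * t ^ 4)\<^sup>2"
  shows "2 * a - m\<^sup>2 \<le> 2 * b"
proof -
  define p where "p t = (b + d * t\<^sup>2 - a + l * t) * (2 + b * t\<^sup>2 + d * t ^ 4 + a * t\<^sup>2 - l * t ^ 3) + m\<^sup>2" for t
  have "(p \<longlongrightarrow> (b + d * 0\<^sup>2 - a + l * 0) * (2 + b * 0\<^sup>2 + d * 0 ^ 4 + a * 0\<^sup>2 - l * 0 ^ 3) + m\<^sup>2) (at_right 0)"
    unfolding p_def[abs_def] by (intro tendsto_intros)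
  moreover have "\<forall>\<^sub>F t in at_right 0. 0 \<le> p t"
    using le eventually_at_right_less[of "0::real"]
  proof eventually_elim
    fix t :: real assume t: "(1 + t * m + a * t\<^sup>2 - l * t ^ 3) * (1 - t * m + a * t\<^sup>2 - l * t ^ 3) \<le> (1 + b * t\<^sup>2 + d * t ^ 4)\<^sup>2" "0 < t"
    have "(1 + b * t\<^sup>2 + d * t ^ 4)\<^sup>2 - (1 + t * m + a * t\<^sup>2 - l * t ^ 3) * (1 - t * m + a * t\<^sup>2 - l * t ^ 3) = t\<^sup>2 * p t"
      unfolding p_def by algebra
    then have "0 \<le> t\<^sup>2 * p t" using t(1) by simp
    then show "0 \<le> p t" using t(2) by (simp add: zero_le_mult_iff)
  qed
  ultimately have "0 \<le> (b + d * 0\<^sup>2 - a + l * 0) * (2 + b * 0\<^sup>2 + d * 0 ^ 4 + a * 0\<^sup>2 - l * 0 ^ 3) + m\<^sup>2"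
    by (rule tendsto_lowerbound) simp
  then show ?thesis by (simp add: algebra_simps)
qed

lemma compact_support_bounded:
  fixes u :: "real^'n \<Rightarrow> 'b::real_normed_vector"
  assumes "continuous_on UNIV u" "\<And>x. norm x > r \<Longrightarrow> u x = 0"
  obtains L where "0 < L" "\<And>x. norm (u x) \<le> L"
proof -
  have "compact (u ` cball 0 r)" by (intro compact_continuous_image continuous_on_subset[OF assms(1)]) auto
  then obtain L where L: "0 < L" "\<And>x. x \<in> cball 0 r \<Longrightarrow> norm (u x) \<le> L"
    using compact_imp_bounded bounded_pos by (metis imageI)
  have "norm (u x) \<le> L" for x
    using L assms(2)[of x] by (cases "norm x > r") auto
  with L(1) that show ?thesis by blast
qed

context moment_map
begin

lemma midpoint_gap_local:
  assumes unit: "norm u = 1" and s: "0 < s"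
  shows "\<exists>\<xi>. norm (\<xi> - m) \<le> s \<and> (\<psi> (m + s *\<^sub>R u) + \<psi> (m - s *\<^sub>R u)) / 2 - \<psi> m = s\<^sup>2 / 2 * (u \<bullet> (H \<xi> *v u))"
proof -
  obtain b where b: "\<bar>b\<bar> < s" "\<psi> (m + s *\<^sub>R u) + \<psi> (m - s *\<^sub>R u) - 2 * \<psi> m = s * s * (u \<bullet> (H (m + b *\<^sub>R u) *v u))"
    using second_difference_eq[OF s] by blast
  show ?thesis
  proof (rule exI[of _ "m + b *\<^sub>R u"], intro conjI)
    show "norm (m + b *\<^sub>R u - m) \<le> s" using b(1) unit by simp
    have "(\<psi> (m + s *\<^sub>R u) + \<psi> (m - s *\<^sub>R u)) / 2 - \<psi> m = (\<psi> (m + s *\<^sub>R u) + \<psi> (m - s *\<^sub>R u) - 2 * \<psi> m) / 2"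
      by (simp only: diff_divide_distrib)
    then show "(\<psi> (m + s *\<^sub>R u) + \<psi> (m - s *\<^sub>R u)) / 2 - \<psi> m = s\<^sup>2 / 2 * (u \<bullet> (H (m + b *\<^sub>R u) *v u))"
      unfolding b(2) by (simp add: power2_eq_square)
  qed
qed

text \<open>With the endpoint \<open>p\<close> fixed, the derivative of the convexity gap in the
  length is a difference of slopes along the ray, nonnegative by monotonicity of \<open>F\<close>. A
  long segment with one end in the support can thus be replaced by a segment of fixed length with
  the same end.\<close>

lemma midpoint_gap_increasing:
  assumes "s \<le> t" and s0: "0 \<le> s"
  shows "(\<psi> p + \<psi> (p - (2 * s) *\<^sub>R u)) / 2 - \<psi> (p - s *\<^sub>R u) \<le> (\<psi> p + \<psi> (p - (2 * t) *\<^sub>R u)) / 2 - \<psi> (p - t *\<^sub>R u)"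
proof (rule DERIV_nonneg_imp_nondecreasing[OF assms(1)])
  fix x :: real assume x: "s \<le> x" "x \<le> t"
  have d: "((\<lambda>x. \<psi> (p - (c * x) *\<^sub>R u)) has_real_derivative - c * (F (p - (c * x) *\<^sub>R u) \<bullet> u)) (at x)" for c
  proof (rule has_real_derivative_of_scaled)
    have "((\<lambda>x. \<psi> (p - (c * x) *\<^sub>R u)) has_derivative (\<lambda>h. F (p - (c * x) *\<^sub>R u) \<bullet> (- (c * h) *\<^sub>R u))) (at x)"
      by (rule has_derivative_compose[OF _ psi_has_derivative]) (auto intro!: derivative_eq_intros)
    then show "((\<lambda>x. \<psi> (p - (c * x) *\<^sub>R u)) has_derivative (\<lambda>h. h * (- c * (F (p - (c * x) *\<^sub>R u) \<bullet> u)))) (at x)"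
      by (simp add: mult_ac)
  qed
  have d1: "((\<lambda>x. \<psi> (p - x *\<^sub>R u)) has_real_derivative - (F (p - x *\<^sub>R u) \<bullet> u)) (at x)" using d[of 1] by simp
  have "((\<lambda>x. (\<psi> p + \<psi> (p - (2 * x) *\<^sub>R u)) / 2 - \<psi> (p - x *\<^sub>R u)) has_real_derivative
      (F (p - x *\<^sub>R u) \<bullet> u - F (p - (2 * x) *\<^sub>R u) \<bullet> u)) (at x)"
    by (auto intro!: derivative_eq_intros d[of 2] d1)
  moreover have "0 \<le> F (p - x *\<^sub>R u) \<bullet> u - F (p - (2 * x) *\<^sub>R u) \<bullet> u"
  proof (cases "x = 0")
    case False
    have "0 \<le> (F (p - x *\<^sub>R u) - F (p - (2 * x) *\<^sub>R u)) \<bullet> ((p - x *\<^sub>R u) - (p - (2 * x) *\<^sub>R u))" by (rule F_monotone)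
    moreover have "(p - x *\<^sub>R u) - (p - (2 * x) *\<^sub>R u) = x *\<^sub>R u" by (simp add: algebra_simps flip: scaleR_2)
    ultimately have "0 \<le> x * (F (p - x *\<^sub>R u) \<bullet> u - F (p - (2 * x) *\<^sub>R u) \<bullet> u)" by (simp add: inner_diff_left)
    then show ?thesis using False x s0 by (simp add: zero_le_mult_iff)
  qed simp
  ultimately show "\<exists>y. ((\<lambda>x. (\<psi> p + \<psi> (p - (2 * x) *\<^sub>R u)) / 2 - \<psi> (p - x *\<^sub>R u)) has_real_derivative y) (at x) \<and> 0 \<le> y"
    by blast
qed

text \<open>The midpoint inequality behind the Prekopa-Leindler application: to second order in \<open>t\<close> the
  maximum over \<open>z\<close> of \<open>t e(m) \<bullet> z - z \<bullet> \<nabla>\<^sup>2\<psi>(m) z / 2\<close> is \<open>t\<^sup>2/2\<close> times the squared dual norm of \<open>e(m)\<close>.\<close>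

lemma perturbed_midpoint_gap:
  assumes \<eta>: "\<And>x. (\<eta> has_derivative (\<lambda>h. e x \<bullet> h)) (at x)" and e: "continuous_on UNIV e"
    and supp: "\<And>x. norm x > r \<Longrightarrow> \<eta> x = 0" "\<And>x. norm x > r \<Longrightarrow> e x = 0" and r: "0 \<le> r" and \<delta>: "0 < \<delta>"
  shows "\<forall>\<^sub>F t in at_right 0. \<forall>m z. t * (\<eta> (m + z) - \<eta> (m - z)) / 2 - ((\<psi> (m + z) + \<psi> (m - z)) / 2 - \<psi> m)
      \<le> t\<^sup>2 / 2 * (costar m (e m) + \<delta>)"
proof -
  have c\<eta>: "continuous_on UNIV \<eta>" using \<eta> by (meson continuous_at_imp_continuous_on has_derivative_continuous)
  obtain L where L: "0 < L" "\<And>x. norm (\<eta> x) \<le> L" using compact_support_bounded[OF c\<eta> supp(1)] by metis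
  obtain Le where Le: "0 < Le" "\<And>x. norm (e x) \<le> Le" using compact_support_bounded[OF e supp(2)] by metis
  \<comment> \<open>The radius leaves room for every intermediate point: those at distance at most 1
    from a centre whose own distance to the support ball is at most 1.\<close>
  define S where "S = cball (0 :: real^'n) (r + 2)"
  define \<Phi> where "\<Phi> = (\<lambda>(x, u). u \<bullet> (H x *v u))"
  define T where "T = S \<times> sphere (0 :: real^'n) 1"
  have cT: "compact T" unfolding T_def S_def by (intro compact_Times compact_cball compact_sphere)
  have c\<Phi>: "continuous_on T \<Phi>" unfolding \<Phi>_def case_prod_beta
    by (intro continuous_intros continuous_on_matrix_vector continuous_on_compose2[OF continuous_H[of UNIV]]) auto
  obtain c where c: "0 < c" "\<And>x u. norm x \<le> r + 2 \<Longrightarrow> norm u = 1 \<Longrightarrow> c \<le> u \<bullet> (H x *v u)"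
  proof -
    have "axis undefined 1 \<in> sphere (0 :: real^'n) 1" by simp
    then have "T \<noteq> {}" using r by (auto simp: T_def S_def intro!: exI[of _ 0])
    from continuous_attains_inf[OF cT this c\<Phi>] obtain x0 u0 where
      xu: "(x0, u0) \<in> T" "\<And>y. y \<in> T \<Longrightarrow> \<Phi> (x0, u0) \<le> \<Phi> y" by (metis surj_pair)
    have "u0 \<noteq> 0" using xu(1) by (auto simp: T_def)
    then have "0 < \<Phi> (x0, u0)" using H_pos_def by (simp add: \<Phi>_def pos_def_def)
    moreover have "\<Phi> (x0, u0) \<le> u \<bullet> (H x *v u)" if "norm x \<le> r + 2" "norm u = 1" for x u
      using xu(2)[of "(x, u)"] that by (simp add: T_def S_def \<Phi>_def)
    ultimately show ?thesis by (rule that)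
  qed
  \<comment> \<open>From \<open>s = t * \<kappa>\<close> on, the convexity gap of at least
    \<open>c / 2 * s\<^sup>2\<close> outweighs the perturbation of at most
    \<open>t * Le * s\<close>.\<close>
  define \<kappa> where "\<kappa> = 2 * Le / c"
  have \<kappa>0: "0 < \<kappa>" using Le c by (simp add: \<kappa>_def)
  \<comment> \<open>Chosen so that replacing \<open>e\<close> and the Hessian form by their values
    at \<open>m\<close> costs at most \<open>t\<^sup>2 / 2 * \<delta>\<close> for displacements up
    to \<open>t * \<kappa>\<close>.\<close>
  define \<omega> where "\<omega> = \<delta> / (2 * \<kappa> + \<kappa>\<^sup>2)"
  have \<omega>0: "0 < \<omega>" using \<delta> \<kappa>0 by (simp add: \<omega>_def add_pos_pos)
  have \<omega>\<kappa>: "2 * \<omega> * \<kappa> + \<omega> * \<kappa>\<^sup>2 = \<delta>"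
  proof -
    have "2 * \<kappa> + \<kappa>\<^sup>2 > 0" using \<kappa>0 by (simp add: add_pos_pos)
    then have "\<omega> * (2 * \<kappa> + \<kappa>\<^sup>2) = \<delta>" by (simp add: \<omega>_def)
    then show ?thesis by (simp add: algebra_simps)
  qed
  obtain \<rho>1 where \<rho>1: "0 < \<rho>1" "\<And>y y'. y \<in> T \<Longrightarrow> y' \<in> T \<Longrightarrow> dist y' y < \<rho>1 \<Longrightarrow> dist (\<Phi> y') (\<Phi> y) < \<omega>"
    using compact_uniformly_continuous[OF c\<Phi> cT] \<omega>0 unfolding uniformly_continuous_on_def by metis
  have cS: "compact S" by (simp add: S_def)
  have "continuous_on S e" using e continuous_on_subset by blast
  from compact_uniformly_continuous[OF this cS]
  obtain \<rho>2 where \<rho>2: "0 < \<rho>2" "\<And>y y'. y \<in> S \<Longrightarrow> y' \<in> S \<Longrightarrow> dist y' y < \<rho>2 \<Longrightarrow> dist (e y') (e y) < \<omega>"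
    using \<omega>0 unfolding uniformly_continuous_on_def by metis
  define \<rho> where "\<rho> = min \<rho>1 \<rho>2"
  have \<rho>0: "0 < \<rho>" using \<rho>1 \<rho>2 by (simp add: \<rho>_def)
  \<comment> \<open>The first condition handles displacements longer than 1, the second brings the
    critical range of displacements within the moduli of uniform continuity.\<close>
  have small: "\<forall>\<^sub>F t in at_right 0. t * L < c / 2" "\<forall>\<^sub>F t in at_right 0. t * \<kappa> < \<rho>"
  proof -
    have t1: "((\<lambda>t. t * L) \<longlongrightarrow> 0 * L) (at_right 0)" and t2: "((\<lambda>t. t * \<kappa>) \<longlongrightarrow> 0 * \<kappa>) (at_right 0)"
      by (intro tendsto_intros)+
    show "\<forall>\<^sub>F t in at_right 0. t * L < c / 2" by (rule order_tendstoD(2)[OF t1]) (use c in simp)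
    show "\<forall>\<^sub>F t in at_right 0. t * \<kappa> < \<rho>" by (rule order_tendstoD(2)[OF t2]) (use \<rho>0 in simp)
  qed
  show ?thesis
    using small eventually_at_right_less[of "0::real"]
  proof eventually_elim
    fix t :: real assume t: "t * L < c / 2" "t * \<kappa> < \<rho>" "0 < t"
    show "\<forall>m z. t * (\<eta> (m + z) - \<eta> (m - z)) / 2 - ((\<psi> (m + z) + \<psi> (m - z)) / 2 - \<psi> m) \<le> t\<^sup>2 / 2 * (costar m (e m) + \<delta>)"
    proof (intro allI)
      fix m z
      let ?A = "(\<psi> (m + z) + \<psi> (m - z)) / 2 - \<psi> m"
      let ?d = "(\<eta> (m + z) - \<eta> (m - z)) / 2"
      have A0: "0 \<le> ?A" using psi_tangent[of m "m + z"] psi_tangent[of m "m - z"] by simp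
      have rhs0: "0 \<le> t\<^sup>2 / 2 * (costar m (e m) + \<delta>)" using costar_nonneg[of m "e m"] \<delta> by simp
      have enough: "t * (\<eta> (m + z) - \<eta> (m - z)) / 2 - ?A \<le> t\<^sup>2 / 2 * (costar m (e m) + \<delta>)" if "t * ?d \<le> ?A"
        using that rhs0 by simp
      show "t * (\<eta> (m + z) - \<eta> (m - z)) / 2 - ?A \<le> t\<^sup>2 / 2 * (costar m (e m) + \<delta>)"
      \<comment> \<open>If both endpoints lie outside the support, the perturbation vanishes and
        convexity suffices. Otherwise one endpoint has norm at most \<open>r\<close>, which bounds
        \<open>m\<close> in terms of \<open>s\<close>.\<close>
      proof (cases "norm (m + z) > r \<and> norm (m - z) > r \<or> z = 0")
        case True
        then have "?d = 0" using supp(1) by auto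
        then show ?thesis using A0 by (intro enough) simp
      next
        case False
        define s where "s = norm z"
        define u where "u = (1 / s) *\<^sub>R z"
        have s0: "0 < s" using False by (simp add: s_def)
        have nu: "norm u = 1" using s0 by (simp add: u_def s_def)
        have zu: "z = s *\<^sub>R u" using s0 by (simp add: u_def)
        have nm: "norm m \<le> r + s"
          using False norm_triangle_ineq4[of "m + z" z] norm_triangle_ineq[of "m - z" z] by (auto simp: s_def)
        show ?thesis
        proof (cases "1 < s")
          case True
          \<comment> \<open>\<open>p\<close> is the endpoint in the support ball and
            \<open>v\<close> points from the midpoint to it, so that the segment can be shortened
            towards \<open>p\<close>.\<close>
          obtain p v where pv: "norm p \<le> r" "norm v = 1" "m = p - s *\<^sub>R v"
            "?A = (\<psi> p + \<psi> (p - (2 * s) *\<^sub>R v)) / 2 - \<psi> (p - s *\<^sub>R v)"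
          proof -
            have zz: "(2 * s) *\<^sub>R u = z + z" unfolding zu mult_2 scaleR_add_left ..
            have e1: "m + z - s *\<^sub>R u = m" "m + z - (2 * s) *\<^sub>R u = m - z"
              unfolding zz zu[symmetric] by simp_all
            have e2: "m - z - s *\<^sub>R (- u) = m" "m - z - (2 * s) *\<^sub>R (- u) = m + z"
              unfolding scaleR_minus_right zz zu[symmetric] by simp_all
            show ?thesis
            proof (cases "norm (m + z) \<le> r")
              case True
              show ?thesis
              proof (rule that[OF True nu])
                show "m = m + z - s *\<^sub>R u" unfolding e1 ..
                show "?A = (\<psi> (m + z) + \<psi> (m + z - (2 * s) *\<^sub>R u)) / 2 - \<psi> (m + z - s *\<^sub>R u)"
                  unfolding e1 ..
              qed
            next
              case F2: False
              then have n: "norm (m - z) \<le> r" using False by auto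
              show ?thesis
              proof (rule that[OF n])
                show "norm (- u) = 1" using nu by simp
                show "m = m - z - s *\<^sub>R (- u)" unfolding e2 ..
                show "?A = (\<psi> (m - z) + \<psi> (m - z - (2 * s) *\<^sub>R (- u))) / 2 - \<psi> (m - z - s *\<^sub>R (- u))"
                  unfolding e2 by (simp only: add.commute)
              qed
            qed
          qed
          have gap: "(\<psi> p + \<psi> (p - (2 * 1) *\<^sub>R v)) / 2 - \<psi> (p - 1 *\<^sub>R v) \<le> ?A"
            unfolding pv(4) by (rule midpoint_gap_increasing) (use True in auto)
          obtain \<xi> where \<xi>: "norm (\<xi> - (p - v)) \<le> 1"
            "(\<psi> ((p - v) + 1 *\<^sub>R v) + \<psi> ((p - v) - 1 *\<^sub>R v)) / 2 - \<psi> (p - v) = 1\<^sup>2 / 2 * (v \<bullet> (H \<xi> *v v))"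
            using midpoint_gap_local[OF pv(2), of 1 "p - v"] by auto
          have "norm \<xi> \<le> r + 2"
            using \<xi>(1) pv(1,2) norm_triangle_ineq[of "\<xi> - (p - v)" "p - v"] norm_triangle_ineq4[of p v] by simp
          then have "c \<le> v \<bullet> (H \<xi> *v v)" using c(2) pv(2) by blast
          then have cv: "c / 2 \<le> 1\<^sup>2 / 2 * (v \<bullet> (H \<xi> *v v))" by simp
          have x1: "p - v + 1 *\<^sub>R v = p" "p - v - 1 *\<^sub>R v = p - (2 * 1) *\<^sub>R v" "p - 1 *\<^sub>R v = p - v"
            by (simp_all add: scaleR_2)
          have "c / 2 \<le> ?A" using gap \<xi>(2) cv unfolding x1 by linarith
          moreover have "t * ?d \<le> t * L"
          proof (rule mult_left_mono)
            show "?d \<le> L" using L(2)[of "m + z"] L(2)[of "m - z"] by (simp add: abs_le_iff)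
          qed (use t in simp)
          ultimately show ?thesis using t(1) by (intro enough) linarith
        next
          case False
          obtain \<xi> where \<xi>: "norm (\<xi> - m) \<le> s" "?A = s\<^sup>2 / 2 * (u \<bullet> (H \<xi> *v u))"
            using midpoint_gap_local[OF nu s0, of m] zu by auto
          have n\<xi>: "norm \<xi> \<le> r + 2" using \<xi>(1) nm False norm_triangle_ineq[of "\<xi> - m" m] by simp
          have A: "s\<^sup>2 / 2 * c \<le> ?A" unfolding \<xi>(2) by (intro mult_left_mono c(2) n\<xi> nu) auto
          obtain \<zeta> where \<zeta>: "norm (\<zeta> - m) \<le> s" "?d = e \<zeta> \<bullet> z"
          proof -
            have d: "((\<lambda>b. \<eta> (m + b *\<^sub>R z)) has_real_derivative e (m + b *\<^sub>R z) \<bullet> z) (at b)" for b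
            proof (rule has_real_derivative_of_scaled)
              have "((\<lambda>b. \<eta> (m + b *\<^sub>R z)) has_derivative (\<lambda>h. e (m + b *\<^sub>R z) \<bullet> (h *\<^sub>R z))) (at b)"
                by (rule has_derivative_compose[OF _ \<eta>]) (auto intro!: derivative_eq_intros)
              then show "((\<lambda>b. \<eta> (m + b *\<^sub>R z)) has_derivative (\<lambda>h. h * (e (m + b *\<^sub>R z) \<bullet> z))) (at b)" by simp
            qed
            obtain b where b: "-1 < b" "b < 1" "\<eta> (m + 1 *\<^sub>R z) - \<eta> (m + (-1) *\<^sub>R z) = (1 - (-1)) * (e (m + b *\<^sub>R z) \<bullet> z)"
              using MVT2[of "-1" 1, OF _ d] by auto
            show ?thesis
            proof (rule that[of "m + b *\<^sub>R z"])
              have "\<bar>b\<bar> * norm z \<le> 1 * norm z" using b by (intro mult_right_mono) auto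
              then show "norm (m + b *\<^sub>R z - m) \<le> s" by (simp add: s_def)
              show "?d = e (m + b *\<^sub>R z) \<bullet> z" using b(3) by simp
            qed
          qed
          show ?thesis
          \<comment> \<open>For the longer displacements the gap absorbs the perturbation outright;
            only the shorter ones need a second-order comparison.\<close>
          proof (cases "t * \<kappa> \<le> s")
            case True
            have "?d \<le> Le * s" unfolding \<zeta>(2) s_def
              by (rule order_trans[OF norm_cauchy_schwarz]) (intro mult_right_mono Le norm_ge_zero)
            then have "t * ?d \<le> t * (Le * s)" using t by (intro mult_left_mono) auto
            also have "\<dots> = (t * \<kappa>) * (c / 2 * s)" using c by (simp add: \<kappa>_def)
            also have "\<dots> \<le> s * (c / 2 * s)" using True c s0 by (intro mult_right_mono) auto
            also have "\<dots> \<le> ?A" using A by (simp add: power2_eq_square mult_ac)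
            finally show ?thesis by (rule enough)
          next
            case small: False
            \<comment> \<open>In this range \<open>e\<close> and the Hessian form differ by less
              than \<open>\<omega>\<close> between the intermediate points and
              \<open>m\<close>.\<close>
            then have s\<rho>: "s < \<rho>" using t(2) by simp
            have mS: "m \<in> S" using nm False by (simp add: S_def)
            have "norm \<zeta> \<le> r + 2" using \<zeta>(1) nm False norm_triangle_ineq[of "\<zeta> - m" m] by simp
            then have \<zeta>S: "\<zeta> \<in> S" by (simp add: S_def)
            have "dist (e \<zeta>) (e m) < \<omega>"
              by (rule \<rho>2(2)[OF mS \<zeta>S]) (use \<zeta>(1) s\<rho> in \<open>simp add: \<rho>_def dist_norm\<close>)
            then have "(e \<zeta> - e m) \<bullet> z \<le> \<omega> * s" unfolding s_def
              by (intro order_trans[OF norm_cauchy_schwarz] mult_right_mono) (auto simp: dist_norm)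
            then have d: "?d \<le> e m \<bullet> z + \<omega> * s" by (simp add: \<zeta>(2) inner_diff_left)
            have "dist (\<Phi> (\<xi>, u)) (\<Phi> (m, u)) < \<omega>"
              by (rule \<rho>1(2)) (use \<xi>(1) s\<rho> n\<xi> mS nu in \<open>auto simp: T_def S_def \<rho>_def dist_norm norm_Pair\<close>)
            then have "u \<bullet> (H m *v u) - \<omega> \<le> u \<bullet> (H \<xi> *v u)" by (simp add: \<Phi>_def dist_real_def)
            then have "s\<^sup>2 / 2 * (u \<bullet> (H m *v u) - \<omega>) \<le> ?A" unfolding \<xi>(2) by (intro mult_left_mono) auto
            moreover have "z \<bullet> (H m *v z) = s\<^sup>2 * (u \<bullet> (H m *v u))"
              by (simp add: zu matrix_vector_mult_scaleR power2_eq_square)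
            moreover have "s\<^sup>2 / 2 * (u \<bullet> (H m *v u) - \<omega>) = 1/2 * (s\<^sup>2 * (u \<bullet> (H m *v u))) - \<omega> / 2 * s\<^sup>2"
              by (simp add: right_diff_distrib)
            ultimately have A': "1/2 * (z \<bullet> (H m *v z)) - \<omega> / 2 * s\<^sup>2 \<le> ?A" by linarith
            \<comment> \<open>Completing the square in \<open>z\<close>: a linear form minus half of
              the Hessian form is at most half of the squared dual norm.\<close>
            have "0 \<le> 1\<^sup>2 * (z \<bullet> (H m *v z)) + 2 * 1 * (- t) * (z \<bullet> e m) + (- t)\<^sup>2 * costar m (e m)"
              by (rule costar_mixed_H)
            then have Q: "t * (e m \<bullet> z) - 1/2 * (z \<bullet> (H m *v z)) \<le> t\<^sup>2 / 2 * costar m (e m)"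
              by (simp add: inner_commute)
            have st: "s \<le> t * \<kappa>" using small by simp
            have "t * ?d \<le> t * (e m \<bullet> z) + t * (\<omega> * s)" using mult_left_mono[OF d, of t] t by (simp add: distrib_left)
            moreover have "t * (\<omega> * s) \<le> t * (\<omega> * (t * \<kappa>))" using st t \<omega>0 by (intro mult_left_mono) auto
            moreover have "\<omega> / 2 * s\<^sup>2 \<le> \<omega> / 2 * (t * \<kappa>)\<^sup>2" using st s0 \<omega>0 by (intro mult_left_mono power_mono) auto
            moreover have "t * (\<omega> * (t * \<kappa>)) + \<omega> / 2 * (t * \<kappa>)\<^sup>2 = t\<^sup>2 / 2 * \<delta>"
              unfolding \<omega>\<kappa>[symmetric] by (simp add: power2_eq_square algebra_simps)
            moreover have "t\<^sup>2 / 2 * (costar m (e m) + \<delta>) = t\<^sup>2 / 2 * costar m (e m) + t\<^sup>2 / 2 * \<delta>" by (simp add: distrib_left)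
            moreover have "t * (\<eta> (m + z) - \<eta> (m - z)) / 2 = t * ?d" by simp
            ultimately show ?thesis using A' Q by linarith
          qed
        qed
      qed
    qed
  qed
qed

text \<open>Prekopa-Leindler is applied to \<open>w x * exp (t * \<eta> x)\<close> and
  \<open>w x * exp ((- t) * \<eta> x)\<close>, with
  \<open>w x * exp (t\<^sup>2 / 2 * (k x + \<delta>))\<close> at the midpoint. The opposite signs
  cancel the terms linear in \<open>t\<close>. In second order the product on the left has the
  variance as its coefficient, and the square on the right has the dual energy plus
  \<delta>.\<close>

theorem brascamp_lieb_compact_support:
  assumes \<eta>: "\<And>x. (\<eta> has_derivative (\<lambda>h. e x \<bullet> h)) (at x)" and e: "continuous_on UNIV e"
    and supp: "\<And>x. norm x > r \<Longrightarrow> \<eta> x = 0" "\<And>x. norm x > r \<Longrightarrow> e x = 0" and r: "0 \<le> r"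
  shows "(\<integral>x. w x * (\<eta> x)\<^sup>2 \<partial>lborel) - (\<integral>x. w x * \<eta> x \<partial>lborel)\<^sup>2 \<le> (\<integral>x. w x * costar x (e x) \<partial>lborel)"
proof (rule field_le_epsilon)
  fix \<delta> :: real assume \<delta>: "0 < \<delta>"
  have c\<eta>: "continuous_on A \<eta>" for A using \<eta> by (meson continuous_at_imp_continuous_on has_derivative_continuous)
  obtain L where L: "0 < L" "\<And>x. \<bar>\<eta> x\<bar> \<le> L" using compact_support_bounded[OF c\<eta> supp(1)] by auto
  define k where "k x = costar x (e x)" for x
  have ck: "continuous_on A k" for A unfolding k_def
    by (rule continuous_costar) (use e continuous_on_subset in blast)
  obtain M0 where M0: "0 < M0" "\<And>x. \<bar>k x\<bar> \<le> M0"
    using compact_support_bounded[OF ck, of r] supp(2) by (auto simp: k_def costar_def)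
  define M where "M = M0 + \<delta>"
  have k0: "0 \<le> k x" for x by (simp add: k_def costar_nonneg)
  have kM: "0 < k x + \<delta>" "k x + \<delta> \<le> M" for x using k0[of x] M0(2)[of x] \<delta> by (auto simp: M_def)
  have i1: "integrable lborel (\<lambda>x. w x * \<eta> x)" by (rule w_integrable_bounded[OF c\<eta> L(2)])
  have i2: "integrable lborel (\<lambda>x. w x * (\<eta> x)\<^sup>2)"
  proof (rule w_integrable_bounded)
    show "\<bar>(\<eta> x)\<^sup>2\<bar> \<le> L\<^sup>2" for x using L(2)[of x] L(1) by (simp add: abs_le_square_iff[symmetric])
  qed (intro continuous_intros c\<eta>)
  have ik: "integrable lborel (\<lambda>x. w x * k x)" by (rule w_integrable_bounded[OF ck M0(2)])
  define m where "m = (\<integral>x. w x * \<eta> x \<partial>lborel)"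
  define E2 where "E2 = (\<integral>x. w x * (\<eta> x)\<^sup>2 \<partial>lborel)"
  define Ek where "Ek = (\<integral>x. w x * k x \<partial>lborel)"
  have lower: "1 + t * m + E2 / 2 * t\<^sup>2 - L ^ 3 / 2 * \<bar>t\<bar> ^ 3 \<le> (\<integral>x. w x * exp (t * \<eta> x) \<partial>lborel)"
    and intexp: "integrable lborel (\<lambda>x. w x * exp (t * \<eta> x))" if t: "\<bar>t\<bar> * L \<le> 1" for t
  proof -
    have t\<eta>: "\<bar>t * \<eta> x\<bar> \<le> \<bar>t\<bar> * L" for x unfolding abs_mult by (intro mult_left_mono L) auto
    show ie: "integrable lborel (\<lambda>x. w x * exp (t * \<eta> x))"
    proof (rule w_integrable_bounded)
      show "\<bar>exp (t * \<eta> x)\<bar> \<le> exp 1" for x using t\<eta>[of x] t by simp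
    qed (intro continuous_intros c\<eta>)
    have "1 + t * m + E2 / 2 * t\<^sup>2 - L ^ 3 / 2 * \<bar>t\<bar> ^ 3
       = (\<integral>x. w x + t * (w x * \<eta> x) + t\<^sup>2 / 2 * (w x * (\<eta> x)\<^sup>2) - L ^ 3 / 2 * \<bar>t\<bar> ^ 3 * w x \<partial>lborel)"
      using i1 i2 w_integrable by (simp add: w_integral m_def E2_def)
    also have "\<dots> \<le> (\<integral>x. w x * exp (t * \<eta> x) \<partial>lborel)"
    proof (rule integral_mono[OF _ ie])
      show "integrable lborel (\<lambda>x. w x + t * (w x * \<eta> x) + t\<^sup>2 / 2 * (w x * (\<eta> x)\<^sup>2) - L ^ 3 / 2 * \<bar>t\<bar> ^ 3 * w x)"
        using i1 i2 w_integrable by simp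
      fix x
      have "\<bar>t * \<eta> x\<bar> ^ 3 \<le> (\<bar>t\<bar> * L) ^ 3" by (intro power_mono t\<eta>) auto
      moreover have "1 + t * \<eta> x + (t * \<eta> x)\<^sup>2 / 2 - \<bar>t * \<eta> x\<bar> ^ 3 / 2 \<le> exp (t * \<eta> x)"
        by (rule exp_quadratic_lower) (use t\<eta>[of x] t in linarith)
      ultimately have "1 + t * \<eta> x + (t * \<eta> x)\<^sup>2 / 2 - (\<bar>t\<bar> * L) ^ 3 / 2 \<le> exp (t * \<eta> x)" by linarith
      then have "w x * (1 + t * \<eta> x + (t * \<eta> x)\<^sup>2 / 2 - (\<bar>t\<bar> * L) ^ 3 / 2) \<le> w x * exp (t * \<eta> x)"
        using w_pos[of x] by (intro mult_left_mono) auto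
      then show "w x + t * (w x * \<eta> x) + t\<^sup>2 / 2 * (w x * (\<eta> x)\<^sup>2) - L ^ 3 / 2 * \<bar>t\<bar> ^ 3 * w x \<le> w x * exp (t * \<eta> x)"
        by (simp add: algebra_simps power_mult_distrib)
    qed
    finally show "1 + t * m + E2 / 2 * t\<^sup>2 - L ^ 3 / 2 * \<bar>t\<bar> ^ 3 \<le> (\<integral>x. w x * exp (t * \<eta> x) \<partial>lborel)" .
  qed
  have upper: "(\<integral>x. w x * exp (t\<^sup>2 / 2 * (k x + \<delta>)) \<partial>lborel) \<le> 1 + (Ek + \<delta>) / 2 * t\<^sup>2 + M\<^sup>2 / 4 * t ^ 4"
    and intk: "integrable lborel (\<lambda>x. w x * exp (t\<^sup>2 / 2 * (k x + \<delta>)))" if t: "t\<^sup>2 / 2 * M \<le> 1" for t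
  proof -
    have s: "0 \<le> t\<^sup>2 / 2 * (k x + \<delta>)" "t\<^sup>2 / 2 * (k x + \<delta>) \<le> t\<^sup>2 / 2 * M" for x
      using kM[of x] by (auto intro!: mult_left_mono mult_nonneg_nonneg)
    show ie: "integrable lborel (\<lambda>x. w x * exp (t\<^sup>2 / 2 * (k x + \<delta>)))"
    proof (rule w_integrable_bounded)
      show "\<bar>exp (t\<^sup>2 / 2 * (k x + \<delta>))\<bar> \<le> exp 1" for x using s(2)[of x] t by simp
    qed (intro continuous_intros ck; simp)
    have "(\<integral>x. w x * exp (t\<^sup>2 / 2 * (k x + \<delta>)) \<partial>lborel)
      \<le> (\<integral>x. w x + t\<^sup>2 / 2 * (w x * k x) + (t\<^sup>2 / 2 * \<delta>) * w x + (t\<^sup>2 / 2 * M)\<^sup>2 * w x \<partial>lborel)"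
    proof (rule integral_mono[OF ie])
      show "integrable lborel (\<lambda>x. w x + t\<^sup>2 / 2 * (w x * k x) + (t\<^sup>2 / 2 * \<delta>) * w x + (t\<^sup>2 / 2 * M)\<^sup>2 * w x)"
        using ik w_integrable by simp
      fix x
      have "exp (t\<^sup>2 / 2 * (k x + \<delta>)) \<le> 1 + t\<^sup>2 / 2 * (k x + \<delta>) + (t\<^sup>2 / 2 * (k x + \<delta>))\<^sup>2"
        using s[of x] t by (intro exp_bound) auto
      moreover have "(t\<^sup>2 / 2 * (k x + \<delta>))\<^sup>2 \<le> (t\<^sup>2 / 2 * M)\<^sup>2" by (intro power_mono s)
      ultimately have "exp (t\<^sup>2 / 2 * (k x + \<delta>)) \<le> 1 + t\<^sup>2 / 2 * (k x + \<delta>) + (t\<^sup>2 / 2 * M)\<^sup>2" by linarith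
      then have "w x * exp (t\<^sup>2 / 2 * (k x + \<delta>)) \<le> w x * (1 + t\<^sup>2 / 2 * (k x + \<delta>) + (t\<^sup>2 / 2 * M)\<^sup>2)"
        using w_pos[of x] by (intro mult_left_mono) auto
      then show "w x * exp (t\<^sup>2 / 2 * (k x + \<delta>)) \<le> w x + t\<^sup>2 / 2 * (w x * k x) + (t\<^sup>2 / 2 * \<delta>) * w x + (t\<^sup>2 / 2 * M)\<^sup>2 * w x"
        by (simp add: algebra_simps add_divide_distrib)
    qed
    also have "\<dots> = 1 + t\<^sup>2 / 2 * Ek + t\<^sup>2 / 2 * \<delta> + (t\<^sup>2 / 2 * M)\<^sup>2"
      using ik w_integrable by (simp add: w_integral Ek_def)
    also have "\<dots> = 1 + (Ek + \<delta>) / 2 * t\<^sup>2 + M\<^sup>2 / 4 * t ^ 4"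
      by (simp add: power2_eq_square eval_nat_numeral field_simps)
    finally show "(\<integral>x. w x * exp (t\<^sup>2 / 2 * (k x + \<delta>)) \<partial>lborel) \<le> 1 + (Ek + \<delta>) / 2 * t\<^sup>2 + M\<^sup>2 / 4 * t ^ 4" .
  qed
  have ev1: "\<forall>\<^sub>F t in at_right 0. \<bar>t\<bar> * L < 1"
  proof -
    have "((\<lambda>t. \<bar>t\<bar> * L) \<longlongrightarrow> \<bar>0\<bar> * L) (at_right 0)" by (intro tendsto_intros)
    then show ?thesis by (rule order_tendstoD) simp
  qed
  have ev2: "\<forall>\<^sub>F t in at_right 0. t\<^sup>2 / 2 * M < 1"
  proof -
    have "((\<lambda>t::real. t\<^sup>2 / 2 * M) \<longlongrightarrow> 0\<^sup>2 / 2 * M) (at_right 0)" by (intro tendsto_intros) auto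
    then show ?thesis by (rule order_tendstoD) simp
  qed
  \<comment> \<open>The lower bounds on the two integrals must be positive before they can be
    multiplied.\<close>
  have ev3: "\<forall>\<^sub>F t in at_right 0. 0 < 1 + t * s + E2 / 2 * t\<^sup>2 - L ^ 3 / 2 * t ^ 3" for s
  proof -
    have "((\<lambda>t. 1 + t * s + E2 / 2 * t\<^sup>2 - L ^ 3 / 2 * t ^ 3) \<longlongrightarrow> 1 + 0 * s + E2 / 2 * 0\<^sup>2 - L ^ 3 / 2 * 0 ^ 3) (at_right 0)"
      by (intro tendsto_intros)
    then show ?thesis by (rule order_tendstoD) simp
  qed
  have gap: "\<forall>\<^sub>F t in at_right 0. \<forall>p z. t * (\<eta> (p + z) - \<eta> (p - z)) / 2 - ((\<psi> (p + z) + \<psi> (p - z)) / 2 - \<psi> p)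
      \<le> t\<^sup>2 / 2 * (costar p (e p) + \<delta>)"
    by (rule perturbed_midpoint_gap[OF \<eta> e _ _ r \<delta>]) (rule supp, assumption)+
  have "2 * (E2 / 2) - m\<^sup>2 \<le> 2 * ((Ek + \<delta>) / 2)"
  proof (rule variance_of_product_expansion[where d = "M\<^sup>2 / 4" and l = "L ^ 3 / 2"])
    show "\<forall>\<^sub>F t in at_right 0. (1 + t * m + E2 / 2 * t\<^sup>2 - L ^ 3 / 2 * t ^ 3) * (1 - t * m + E2 / 2 * t\<^sup>2 - L ^ 3 / 2 * t ^ 3)
        \<le> (1 + (Ek + \<delta>) / 2 * t\<^sup>2 + M\<^sup>2 / 4 * t ^ 4)\<^sup>2"
      using ev1 ev2 ev3[of m] ev3[of "- m"] gap eventually_at_right_less[of "0::real"]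
    proof eventually_elim
      fix t :: real
      assume t: "\<bar>t\<bar> * L < 1" "t\<^sup>2 / 2 * M < 1" "0 < 1 + t * m + E2 / 2 * t\<^sup>2 - L ^ 3 / 2 * t ^ 3"
        "0 < 1 + t * - m + E2 / 2 * t\<^sup>2 - L ^ 3 / 2 * t ^ 3"
        "\<forall>p z. t * (\<eta> (p + z) - \<eta> (p - z)) / 2 - ((\<psi> (p + z) + \<psi> (p - z)) / 2 - \<psi> p) \<le> t\<^sup>2 / 2 * (costar p (e p) + \<delta>)"
        "0 < t"
      define I1 where "I1 = (\<integral>x. w x * exp (t * \<eta> x) \<partial>lborel)"
      define I2 where "I2 = (\<integral>x. w x * exp ((- t) * \<eta> x) \<partial>lborel)"
      define I3 where "I3 = (\<integral>x. w x * exp (t\<^sup>2 / 2 * (k x + \<delta>)) \<partial>lborel)"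
      have l1: "1 + t * m + E2 / 2 * t\<^sup>2 - L ^ 3 / 2 * t ^ 3 \<le> I1"
        using lower[of t] t(1,6) by (simp add: I1_def)
      have l2: "1 - t * m + E2 / 2 * t\<^sup>2 - L ^ 3 / 2 * t ^ 3 \<le> I2"
        using lower[of "- t"] t(1,6) by (simp add: I2_def)
      have u3: "I3 \<le> 1 + (Ek + \<delta>) / 2 * t\<^sup>2 + M\<^sup>2 / 4 * t ^ 4"
        using upper[of t] t(2) by (simp add: I3_def)
      have n1: "(\<integral>\<^sup>+x. ennreal (w x * exp (t * \<eta> x)) \<partial>lborel) = ennreal I1"
        unfolding I1_def using intexp[of t] t(1) w_pos by (intro nn_integral_eq_integral) (auto intro!: AE_I2 mult_nonneg_nonneg less_imp_le)
      have n2: "(\<integral>\<^sup>+x. ennreal (w x * exp ((- t) * \<eta> x)) \<partial>lborel) = ennreal I2"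
        unfolding I2_def using intexp[of "- t"] t(1) w_pos by (intro nn_integral_eq_integral) (auto intro!: AE_I2 mult_nonneg_nonneg less_imp_le)
      have n3: "(\<integral>\<^sup>+x. ennreal (w x * exp (t\<^sup>2 / 2 * (k x + \<delta>))) \<partial>lborel) = ennreal I3"
        unfolding I3_def using intk[of t] t(2) w_pos by (intro nn_integral_eq_integral) (auto intro!: AE_I2 mult_nonneg_nonneg less_imp_le)
      have pos: "0 \<le> I1" "0 \<le> I2" "0 \<le> I3"
        unfolding I1_def I2_def I3_def by (intro integral_nonneg_AE AE_I2 mult_nonneg_nonneg less_imp_le[OF w_pos]; simp)+
      have "ennreal I1 * ennreal I2 \<le> (ennreal I3)\<^sup>2"
        unfolding n1[symmetric] n2[symmetric] n3[symmetric]
      proof (rule prekopa_leindler)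
        fix x y :: "real^'n"
        define p where "p = (1/2) *\<^sub>R (x + y)"
        define z where "z = (1/2) *\<^sub>R (x - y)"
        have xy: "p + z = x" "p - z = y"
          by (simp_all add: p_def z_def scaleR_add_right[symmetric] scaleR_diff_right[symmetric] flip: scaleR_2)
        have "t * (\<eta> x - \<eta> y) / 2 - ((\<psi> x + \<psi> y) / 2 - \<psi> p) \<le> t\<^sup>2 / 2 * (k p + \<delta>)"
          using t(5)[rule_format, of p z] by (simp add: xy k_def)
        then have "(t * \<eta> x - t * \<eta> y) / 2 - ((\<psi> x + \<psi> y) / 2 - \<psi> p) \<le> t\<^sup>2 / 2 * (k p + \<delta>)"
          by (simp only: right_diff_distrib)
        moreover have "- b + a + (- c - d) \<le> 2 * (- q + s)" if "(a - d) / 2 - ((b + c) / 2 - q) \<le> s" for a b c d q s :: real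
          using that by (simp add: field_simps)
        ultimately have "- \<psi> x + t * \<eta> x + (- \<psi> y - t * \<eta> y) \<le> 2 * (- \<psi> p + t\<^sup>2 / 2 * (k p + \<delta>))"
          by blast
        then have "- \<psi> x + t * \<eta> x + (- \<psi> y + (- t) * \<eta> y) \<le> 2 * (- \<psi> p + t\<^sup>2 / 2 * (k p + \<delta>))"
          by simp
        then have "exp (- \<psi> x + t * \<eta> x + (- \<psi> y + (- t) * \<eta> y)) \<le> exp (2 * (- \<psi> p + t\<^sup>2 / 2 * (k p + \<delta>)))"
          by simp
        then have "(w x * exp (t * \<eta> x)) * (w y * exp ((- t) * \<eta> y)) \<le> (w p * exp (t\<^sup>2 / 2 * (k p + \<delta>)))\<^sup>2"
          unfolding w_def by (simp only: exp_add exp_double power_mult_distrib)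
        then have "ennreal ((w x * exp (t * \<eta> x)) * (w y * exp ((- t) * \<eta> y))) \<le> ennreal ((w p * exp (t\<^sup>2 / 2 * (k p + \<delta>)))\<^sup>2)"
          by (rule ennreal_leI)
        then show "ennreal (w x * exp (t * \<eta> x)) * ennreal (w y * exp ((- t) * \<eta> y))
            \<le> (ennreal (w ((1/2) *\<^sub>R (x + y)) * exp (t\<^sup>2 / 2 * (k ((1/2) *\<^sub>R (x + y)) + \<delta>))))\<^sup>2"
          unfolding p_def[symmetric] using w_pos less_imp_le
          by (simp add: ennreal_mult'[symmetric] ennreal_power mult_nonneg_nonneg less_imp_le)
      qed (intro measurable_compose[OF borel_measurable_continuous_onI measurable_ennreal] continuous_intros continuous_w c\<eta> ck; simp)+
      then have "I1 * I2 \<le> I3\<^sup>2" using pos by (simp add: ennreal_mult'[symmetric] ennreal_power ennreal_le_iff)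
      moreover have "(1 + t * m + E2 / 2 * t\<^sup>2 - L ^ 3 / 2 * t ^ 3) * (1 - t * m + E2 / 2 * t\<^sup>2 - L ^ 3 / 2 * t ^ 3) \<le> I1 * I2"
        using l1 l2 t(3,4) pos by (intro mult_mono) auto
      moreover have "I3\<^sup>2 \<le> (1 + (Ek + \<delta>) / 2 * t\<^sup>2 + M\<^sup>2 / 4 * t ^ 4)\<^sup>2" using u3 pos by (intro power_mono)
      ultimately show "(1 + t * m + E2 / 2 * t\<^sup>2 - L ^ 3 / 2 * t ^ 3) * (1 - t * m + E2 / 2 * t\<^sup>2 - L ^ 3 / 2 * t ^ 3)
        \<le> (1 + (Ek + \<delta>) / 2 * t\<^sup>2 + M\<^sup>2 / 4 * t ^ 4)\<^sup>2" by linarith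
    qed
  qed
  then show "(\<integral>x. w x * (\<eta> x)\<^sup>2 \<partial>lborel) - (\<integral>x. w x * \<eta> x \<partial>lborel)\<^sup>2 \<le> (\<integral>x. w x * costar x (e x) \<partial>lborel) + \<delta>"
    by (simp add: E2_def m_def Ek_def k_def)
qed

end

section \<open>The covariance identity\<close>

lemma trace_mult_sum: "trace (A ** B) = (\<Sum>i\<in>UNIV. \<Sum>j\<in>UNIV. A $ i $ j * B $ j $ i)" for A B :: "real^'n^'n"
  by (simp add: trace_def matrix_matrix_mult_def)

lemma inner_matrix_sum: "u \<bullet> (A *v v) = (\<Sum>i\<in>UNIV. \<Sum>j\<in>UNIV. A $ i $ j * (u $ i * v $ j))" for A :: "real^'n^'n"
  by (simp add: inner_vec_def matrix_vector_mult_def sum_distrib_left mult_ac)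

lemma covariance_expand:
  assumes "prob_space M" "integrable M X" "integrable M Z" "integrable M (\<lambda>w. X w * Z w)"
  shows "covariance M X Z = (\<integral>w. X w * Z w \<partial>M) - (\<integral>w. X w \<partial>M) * (\<integral>w. Z w \<partial>M)"
proof -
  interpret prob_space M by fact
  define a b where "a = (\<integral>w. X w \<partial>M)" and "b = (\<integral>w. Z w \<partial>M)"
  have "covariance M X Z = (\<integral>w. X w * Z w - b * X w - a * Z w + a * b \<partial>M)"
    unfolding covariance_def a_def b_def by (intro Bochner_Integration.integral_cong) (auto simp: algebra_simps)
  also have "\<dots> = (\<integral>w. X w * Z w \<partial>M) - b * a - a * b + a * b"
    using assms by (simp add: a_def b_def prob_space)
  finally show ?thesis by (simp add: a_def b_def)
qed

context moment_map
begin

definition E :: "(real^'n \<Rightarrow> real) \<Rightarrow> real" where "E u = (\<integral>x. w x * u x \<partial>lborel)"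

abbreviation "L1 u \<equiv> integrable lborel (\<lambda>x. w x * u x)"

lemma L1_sum: "(\<And>i. i \<in> I \<Longrightarrow> L1 (u i)) \<Longrightarrow> L1 (\<lambda>x. \<Sum>i\<in>I. c i * u i x)"
  and E_sum: "(\<And>i. i \<in> I \<Longrightarrow> L1 (u i)) \<Longrightarrow> E (\<lambda>x. \<Sum>i\<in>I. c i * u i x) = (\<Sum>i\<in>I. c i * E (u i))"
proof -
  assume u: "\<And>i. i \<in> I \<Longrightarrow> L1 (u i)"
  have eq: "w x * (\<Sum>i\<in>I. c i * u i x) = (\<Sum>i\<in>I. c i * (w x * u i x))" for x
    by (simp add: sum_distrib_left mult_ac)
  show "L1 (\<lambda>x. \<Sum>i\<in>I. c i * u i x)" unfolding eq using u by auto
  show "E (\<lambda>x. \<Sum>i\<in>I. c i * u i x) = (\<Sum>i\<in>I. c i * E (u i))" unfolding E_def eq using u by simp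
qed

lemma L1_sum2: "(\<And>i j. L1 (u i j)) \<Longrightarrow> L1 (\<lambda>x. \<Sum>i\<in>UNIV. \<Sum>j\<in>UNIV. c i j * u i j x)"
  for u :: "'n \<Rightarrow> 'n \<Rightarrow> real^'n \<Rightarrow> real"
  using L1_sum[of UNIV "\<lambda>i x. \<Sum>j\<in>UNIV. c i j * u i j x" "\<lambda>_. 1"] L1_sum[of UNIV "u _" "c _"] by simp

lemma E_sum2: "(\<And>i j. L1 (u i j)) \<Longrightarrow> E (\<lambda>x. \<Sum>i\<in>UNIV. \<Sum>j\<in>UNIV. c i j * u i j x) = (\<Sum>i\<in>UNIV. \<Sum>j\<in>UNIV. c i j * E (u i j))"
  for u :: "'n \<Rightarrow> 'n \<Rightarrow> real^'n \<Rightarrow> real"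
  using E_sum[of UNIV "\<lambda>i x. \<Sum>j\<in>UNIV. c i j * u i j x" "\<lambda>_. 1"] L1_sum[of UNIV "u _" "c _"] E_sum[of UNIV "u _" "c _"] by simp

lemma E_add: "L1 u \<Longrightarrow> L1 v \<Longrightarrow> E (\<lambda>x. u x + v x) = E u + E v"
  by (simp add: E_def distrib_left)

lemma E_diff: "L1 u \<Longrightarrow> L1 v \<Longrightarrow> E (\<lambda>x. u x - v x) = E u - E v"
  by (simp add: E_def right_diff_distrib)

lemma L1_F4: "L1 (\<lambda>x. F x $ i * F x $ j * (F x $ k * F x $ l))"
proof -
  obtain R where R: "R > 0" "\<And>x i. \<bar>F x $ i\<bar> \<le> R" using F_component_bounded by metis
  have "\<bar>F x $ i * F x $ j * (F x $ k * F x $ l)\<bar> \<le> R * R * (R * R)" for x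
    unfolding abs_mult using R by (intro mult_mono) auto
  then show ?thesis by (intro w_integrable_bounded continuous_intros continuous_F)
qed

lemma L1_F2: "L1 (\<lambda>x. F x $ i * F x $ j)"
proof -
  obtain R where R: "R > 0" "\<And>x i. \<bar>F x $ i\<bar> \<le> R" using F_component_bounded by metis
  have "\<bar>F x $ i * F x $ j\<bar> \<le> R * R" for x
    unfolding abs_mult using R by (intro mult_mono) auto
  then show ?thesis by (intro w_integrable_bounded continuous_intros continuous_F)
qed

lemma L1_H: "L1 (\<lambda>x. H x $ i $ j)"
  using integrable_w_H_times_bounded[of "\<lambda>_. 1" 1] by simp

lemma L1_F2_H: "L1 (\<lambda>x. F x $ i * F x $ j * H x $ k $ l)"
proof -
  obtain R where R: "R > 0" "\<And>x i. \<bar>F x $ i\<bar> \<le> R" using F_component_bounded by metis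
  have "\<bar>F x $ i * F x $ j\<bar> \<le> R * R" for x
    unfolding abs_mult using R by (intro mult_mono) auto
  then show ?thesis by (intro integrable_w_H_times_bounded continuous_intros continuous_F)
qed

lemma L1_F_H: "L1 (\<lambda>x. F x $ i * H x $ k $ l)"
proof -
  obtain R where R: "R > 0" "\<And>x i. \<bar>F x $ i\<bar> \<le> R" using F_component_bounded by metis
  then show ?thesis by (intro integrable_w_H_times_bounded continuous_intros continuous_F)
qed

lemma L1_F3: "L1 (\<lambda>x. F x $ i * F x $ j * F x $ k)"
proof -
  obtain R where R: "R > 0" "\<And>x i. \<bar>F x $ i\<bar> \<le> R" using F_component_bounded by metis
  have "\<bar>F x $ i * F x $ j * F x $ k\<bar> \<le> R * R * R" for x
    unfolding abs_mult using R by (intro mult_mono) auto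
  then show ?thesis by (intro w_integrable_bounded continuous_intros continuous_F)
qed

lemma L1_F1: "L1 (\<lambda>x. F x $ i)"
proof -
  obtain R where R: "R > 0" "\<And>x i. \<bar>F x $ i\<bar> \<le> R" using F_component_bounded by metis
  then show ?thesis by (intro w_integrable_bounded continuous_intros continuous_F)
qed

lemma L1_H_H: "L1 (\<lambda>x. H x $ i $ j * H x $ k $ l)"
  by (rule integrable_w_H_H)

lemma F_component_has_derivative: "((\<lambda>x. F x $ i) has_derivative (\<lambda>h. \<Sum>j\<in>UNIV. H x $ i $ j * h $ j)) (at x)"
  using bounded_linear.has_derivative[OF bounded_linear_vec_nth F_has_derivative, of i x]
  by (simp add: matrix_vector_mult_def)

lemma H_component_has_derivative:
  "((\<lambda>x. H x $ i $ j) has_derivative (\<lambda>h. \<Sum>k\<in>UNIV. third_derivative \<psi> x i j k * h $ k)) (at x)"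
  by (rule hessian_has_derivative[OF smooth_psi])

lemma w_has_derivative: "(w has_derivative (\<lambda>h. - (F x \<bullet> h) * w x)) (at x)"
  unfolding w_def using psi_has_derivative[of x] by (auto intro!: derivative_eq_intros)

lemma sum_axis: "(\<Sum>k\<in>UNIV. f k * axis j 1 $ k) = (f j :: real)"
  by (simp add: axis_def if_distrib[of "\<lambda>x. _ * x"] sum.delta' cong: if_cong)

text \<open>Integration by parts against the weight for functions without compact support:
  integrability of the three terms takes the place of the support, and \<open>F x $ j\<close> is the
  logarithmic derivative of the weight with its sign changed.\<close>

lemma E_F_derivative:
  assumes v: "\<And>x. (v has_derivative Dv x) (at x)" and c: "continuous_on UNIV (\<lambda>x. Dv x (axis j 1))"
    and L: "L1 v" "L1 (\<lambda>x. Dv x (axis j 1))" "L1 (\<lambda>x. v x * F x $ j)"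
  shows "E (\<lambda>x. Dv x (axis j 1)) = E (\<lambda>x. v x * F x $ j)"
proof -
  have cv: "continuous_on UNIV v" using v by (meson continuous_at_imp_continuous_on has_derivative_continuous)
  have d: "((\<lambda>x. w x * v x) has_derivative (\<lambda>h. w x * Dv x h + (- (F x \<bullet> h) * w x) * v x)) (at x)" for x
    by (rule has_derivative_mult[OF w_has_derivative v])
  have i: "integrable lborel (\<lambda>x. w x * Dv x (axis j 1) + (- (F x \<bullet> axis j 1) * w x) * v x)"
    using Bochner_Integration.integrable_diff[OF L(2,3)] by (simp add: inner_axis mult_ac)
  have "(\<integral>x. w x * Dv x (axis j 1) + (- (F x \<bullet> axis j 1) * w x) * v x \<partial>lborel) = 0"
    by (rule integral_directional_derivative_zero[OF d _ L(1) i])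
      (intro continuous_intros continuous_w c continuous_F cv)
  moreover have "(\<integral>x. w x * Dv x (axis j 1) + (- (F x \<bullet> axis j 1) * w x) * v x \<partial>lborel)
     = (\<integral>x. w x * Dv x (axis j 1) - w x * (v x * F x $ j) \<partial>lborel)"
    by (simp add: inner_axis mult_ac)
  ultimately show ?thesis using L by (simp add: E_def)
qed

lemma E_H: "E (\<lambda>x. H x $ i $ j) = E (\<lambda>x. F x $ i * F x $ j)"
  using E_F_derivative[OF F_component_has_derivative, of i j] L1_F1 L1_H L1_F2 by (simp add: sum_axis continuous_H)

text \<open>Integration by parts in direction \<open>l\<close> of a cubic monomial in the components
  of \<open>F\<close>. Its derivative is a sum of three terms with one entry of \<open>H\<close>
  each, one of which is the left side.\<close>

lemma E_F2_H:
  "E (\<lambda>x. F x $ i * F x $ j * H x $ k $ l) = E (\<lambda>x. F x $ i * F x $ j * (F x $ k * F x $ l))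
     - E (\<lambda>x. F x $ j * F x $ k * H x $ i $ l) - E (\<lambda>x. F x $ i * F x $ k * H x $ j $ l)"
proof -
  have d: "((\<lambda>x. F x $ i * F x $ j * F x $ k) has_derivative
     (\<lambda>h. F x $ i * F x $ j * (\<Sum>l\<in>UNIV. H x $ k $ l * h $ l) + (F x $ i * (\<Sum>l\<in>UNIV. H x $ j $ l * h $ l)
        + (\<Sum>l\<in>UNIV. H x $ i $ l * h $ l) * F x $ j) * F x $ k)) (at x)" for x
    by (intro has_derivative_mult F_component_has_derivative)
  have eq: "F x $ i * F x $ j * H x $ k $ l + (F x $ i * H x $ j $ l + H x $ i $ l * F x $ j) * F x $ k
     = F x $ i * F x $ j * H x $ k $ l + (F x $ j * F x $ k * H x $ i $ l + F x $ i * F x $ k * H x $ j $ l)" for x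
    by (simp add: algebra_simps)
  have L3: "L1 (\<lambda>x. F x $ j * F x $ k * H x $ i $ l + F x $ i * F x $ k * H x $ j $ l)"
    using Bochner_Integration.integrable_add[OF L1_F2_H L1_F2_H] by (simp add: distrib_left)
  have Ld: "L1 (\<lambda>x. F x $ i * F x $ j * H x $ k $ l + (F x $ j * F x $ k * H x $ i $ l + F x $ i * F x $ k * H x $ j $ l))"
    using Bochner_Integration.integrable_add[OF L1_F2_H L3] by (simp add: distrib_left)
  have "E (\<lambda>x. F x $ i * F x $ j * H x $ k $ l + (F x $ j * F x $ k * H x $ i $ l + F x $ i * F x $ k * H x $ j $ l))
     = E (\<lambda>x. F x $ i * F x $ j * F x $ k * F x $ l)"
    using E_F_derivative[OF d, of l] unfolding sum_axis eq
    using L1_F3 Ld L1_F4[of i j k l] by (simp add: continuous_intros continuous_F continuous_H mult.assoc)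
  then show ?thesis
    unfolding E_add[OF L1_F2_H L3] E_add[OF L1_F2_H L1_F2_H] by (simp add: mult.assoc)
qed

text \<open>The third derivatives cancel in the divergence of
  \<open>e\<^sup>-\<^sup>\<psi> (\<psi>\<^sub>i \<psi>\<^sub>k\<^sub>l e\<^sub>j - \<psi>\<^sub>i \<psi>\<^sub>j\<^sub>k e\<^sub>l)\<close>.\<close>

lemma E_H_H:
  "E (\<lambda>x. H x $ i $ j * H x $ k $ l) = E (\<lambda>x. H x $ i $ l * H x $ j $ k)
    + E (\<lambda>x. F x $ i * F x $ j * H x $ k $ l) - E (\<lambda>x. F x $ i * F x $ l * H x $ j $ k)"
proof -
  \<comment> \<open>A boolean indexes the two fields so that the divergence theorem treats them
    together: the terms with third derivatives cancel only in the sum and are not known to be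
    integrable one by one.\<close>
  define X where "X s x = (if s then w x * (F x $ i * H x $ k $ l) else - (w x * (F x $ i * H x $ j $ k)))" for s x
  define v where "v s = (if s then axis j 1 else axis l 1 :: real^'n)" for s
  define DX where "DX s x h = (if s
      then w x * (F x $ i * (\<Sum>m\<in>UNIV. third_derivative \<psi> x k l m * h $ m) + (\<Sum>m\<in>UNIV. H x $ i $ m * h $ m) * H x $ k $ l)
        + (- (F x \<bullet> h) * w x) * (F x $ i * H x $ k $ l)
      else - (w x * (F x $ i * (\<Sum>m\<in>UNIV. third_derivative \<psi> x j k m * h $ m) + (\<Sum>m\<in>UNIV. H x $ i $ m * h $ m) * H x $ j $ k)
        + (- (F x \<bullet> h) * w x) * (F x $ i * H x $ j $ k)))" for s x h
  have d: "(X s has_derivative DX s x) (at x)" for s x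
  proof (cases s)
    case True
    show ?thesis unfolding X_def DX_def[abs_def] if_P[OF True]
      by (intro has_derivative_mult w_has_derivative F_component_has_derivative H_component_has_derivative)
  next
    case False
    show ?thesis unfolding X_def DX_def[abs_def] if_not_P[OF False]
      by (intro has_derivative_minus has_derivative_mult w_has_derivative F_component_has_derivative H_component_has_derivative)
  qed
  have c3: "continuous_on UNIV (\<lambda>x. third_derivative \<psi> x a b c)" for a b c
    by (rule continuous_third_derivative[OF smooth_psi])
  have c: "continuous_on UNIV (\<lambda>x. DX s x h)" for s h
  proof (cases s)
    case True
    show ?thesis unfolding DX_def if_P[OF True]
      by (intro continuous_intros continuous_w continuous_F continuous_H c3)
  next
    case False
    show ?thesis unfolding DX_def if_not_P[OF False]
      by (intro continuous_intros continuous_w continuous_F continuous_H c3)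
  qed
  have iX: "integrable lborel (X s)" for s
  proof (cases s)
    case True
    show ?thesis unfolding X_def[abs_def] if_P[OF True] by (rule L1_F_H)
  next
    case False
    show ?thesis unfolding X_def[abs_def] if_not_P[OF False] by (intro Bochner_Integration.integrable_minus L1_F_H)
  qed
  \<comment> \<open>Full symmetry of the third derivative makes the two terms that must cancel
    literally equal.\<close>
  have T: "third_derivative \<psi> x k l j = third_derivative \<psi> x j k l" for x
  proof -
    have s: "(\<lambda>x. H x $ k $ j) = (\<lambda>x. H x $ j $ k)" using hessian_symmetric[OF smooth_psi] by blast
    have "third_derivative \<psi> x k l j = third_derivative \<psi> x k j l" by (rule third_derivative_symmetric[OF smooth_psi])
    then show ?thesis using s by (simp add: third_derivative_def)
  qed
  have div: "(\<Sum>s\<in>UNIV. DX s x (v s)) = w x * ((H x $ i $ j * H x $ k $ l - H x $ i $ l * H x $ j $ k)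
      - (F x $ i * F x $ j * H x $ k $ l - F x $ i * F x $ l * H x $ j $ k))" for x
    by (simp add: UNIV_bool DX_def v_def sum_axis inner_axis T) (simp add: algebra_simps)
  have L12: "L1 (\<lambda>x. H x $ i $ j * H x $ k $ l - H x $ i $ l * H x $ j $ k)"
    using Bochner_Integration.integrable_diff[OF L1_H_H L1_H_H] by (simp add: right_diff_distrib)
  have L34: "L1 (\<lambda>x. F x $ i * F x $ j * H x $ k $ l - F x $ i * F x $ l * H x $ j $ k)"
    using Bochner_Integration.integrable_diff[OF L1_F2_H L1_F2_H] by (simp add: right_diff_distrib)
  have iD: "integrable lborel (\<lambda>x. \<Sum>s\<in>UNIV. DX s x (v s))"
    unfolding div using Bochner_Integration.integrable_diff[OF L12 L34] by (simp add: right_diff_distrib)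
  have "(\<integral>x. (\<Sum>s\<in>UNIV. DX s x (v s)) \<partial>lborel) = 0"
    by (rule integral_divergence_zero[OF finite_class.finite_UNIV d c iX iD])
  then have "E (\<lambda>x. (H x $ i $ j * H x $ k $ l - H x $ i $ l * H x $ j $ k)
      - (F x $ i * F x $ j * H x $ k $ l - F x $ i * F x $ l * H x $ j $ k)) = 0"
    unfolding div E_def .
  then show ?thesis
    unfolding E_diff[OF L12 L34] E_diff[OF L1_H_H L1_H_H] E_diff[OF L1_F2_H L1_F2_H] by simp
qed

end

section \<open>Contraction of four-index arrays with two matrices\<close>

lemma sum_rotate3: "(\<Sum>j\<in>J. \<Sum>k\<in>K. \<Sum>i\<in>I. f i j k) = (\<Sum>i\<in>I. \<Sum>j\<in>J. \<Sum>k\<in>K. f i j k)"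
proof -
  have "(\<Sum>j\<in>J. \<Sum>k\<in>K. \<Sum>i\<in>I. f i j k) = (\<Sum>j\<in>J. \<Sum>i\<in>I. \<Sum>k\<in>K. f i j k)"
    by (intro sum.cong refl sum.swap)
  also have "\<dots> = (\<Sum>i\<in>I. \<Sum>j\<in>J. \<Sum>k\<in>K. f i j k)" by (rule sum.swap)
  finally show ?thesis .
qed

lemma sum_reverse3: "(\<Sum>l\<in>L. \<Sum>k\<in>K. \<Sum>j\<in>J. f j k l) = (\<Sum>j\<in>J. \<Sum>k\<in>K. \<Sum>l\<in>L. f j k l)"
proof -
  have "(\<Sum>l\<in>L. \<Sum>k\<in>K. \<Sum>j\<in>J. f j k l) = (\<Sum>j\<in>J. \<Sum>l\<in>L. \<Sum>k\<in>K. f j k l)"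
    by (rule sum_rotate3)
  also have "\<dots> = (\<Sum>j\<in>J. \<Sum>k\<in>K. \<Sum>l\<in>L. f j k l)" by (intro sum.cong refl sum.swap)
  finally show ?thesis .
qed

text \<open>The contraction of a four-index array with the tensor product of \<open>A\<close> and
  \<open>B\<close>. The integrands of all the second-moment terms have this shape, so an identity
  between entries becomes one between bilinear forms; symmetry of \<open>A\<close> or
  \<open>B\<close> then identifies arrays that differ by exchanging indices within a pair.\<close>

definition sum4 :: "real^'n^'n \<Rightarrow> real^'n^'n \<Rightarrow> ('n \<Rightarrow> 'n \<Rightarrow> 'n \<Rightarrow> 'n \<Rightarrow> real) \<Rightarrow> real" where
  "sum4 A B u = (\<Sum>i\<in>UNIV. \<Sum>j\<in>UNIV. \<Sum>k\<in>UNIV. \<Sum>l\<in>UNIV. (A $ i $ j * B $ k $ l) * u i j k l)"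

lemma sum4_swap_left:
  assumes "transpose A = A"
  shows "sum4 A B (\<lambda>i j k l. u j i k l) = sum4 A B u"
proof -
  have s: "A $ j $ i = A $ i $ j" for i j by (rule symmetric_matrix_entry[OF assms])
  have "sum4 A B (\<lambda>i j k l. u j i k l)
      = (\<Sum>i\<in>UNIV. \<Sum>j\<in>UNIV. \<Sum>k\<in>UNIV. \<Sum>l\<in>UNIV. (A $ j $ i * B $ k $ l) * u i j k l)"
    unfolding sum4_def by (rule sum.swap)
  also have "\<dots> = sum4 A B u"
    unfolding sum4_def by (intro sum.cong refl arg_cong2[where f = "(*)"] s)
  finally show ?thesis .
qed

lemma sum4_swap_right:
  assumes "transpose B = B"
  shows "sum4 A B (\<lambda>i j k l. u i j l k) = sum4 A B u"
proof -
  have s: "B $ i $ j = B $ j $ i" for i j by (rule symmetric_matrix_entry[OF assms])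
  have "(\<Sum>k\<in>UNIV. \<Sum>l\<in>UNIV. (A $ i $ j * B $ k $ l) * u i j l k) = (\<Sum>k\<in>UNIV. \<Sum>l\<in>UNIV. (A $ i $ j * B $ k $ l) * u i j k l)" for i j
  proof -
    have eq: "(A $ i $ j * B $ l $ k) * u i j k l = (A $ i $ j * B $ k $ l) * u i j k l" for k l
      by (simp only: s[of l k])
    have "(\<Sum>k\<in>UNIV. \<Sum>l\<in>UNIV. (A $ i $ j * B $ k $ l) * u i j l k) = (\<Sum>k\<in>UNIV. \<Sum>l\<in>UNIV. (A $ i $ j * B $ l $ k) * u i j k l)"
      by (rule sum.swap)
    also have "\<dots> = (\<Sum>k\<in>UNIV. \<Sum>l\<in>UNIV. (A $ i $ j * B $ k $ l) * u i j k l)"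
      by (intro sum.cong refl) (rule eq)
    finally show ?thesis .
  qed
  then show ?thesis unfolding sum4_def by simp
qed

lemma sum4_add: "sum4 A B (\<lambda>i j k l. u i j k l + v i j k l) = sum4 A B u + sum4 A B v"
  by (simp add: sum4_def distrib_left sum.distrib)

lemma sum4_diff: "sum4 A B (\<lambda>i j k l. u i j k l - v i j k l) = sum4 A B u - sum4 A B v"
  by (simp add: sum4_def right_diff_distrib sum_subtractf)

lemma sum4_product:
  "(\<Sum>i\<in>UNIV. \<Sum>j\<in>UNIV. A $ i $ j * p i j) * (\<Sum>k\<in>UNIV. \<Sum>l\<in>UNIV. B $ k $ l * q k l)
    = sum4 A B (\<lambda>i j k l. p i j * q k l)"
proof -
  have "(\<Sum>i\<in>UNIV. \<Sum>j\<in>UNIV. A $ i $ j * p i j) * X = (\<Sum>i\<in>UNIV. \<Sum>j\<in>UNIV. (A $ i $ j * p i j) * X)" for X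
    by (simp only: sum_distrib_right)
  moreover have "(A $ i $ j * p i j) * (\<Sum>k\<in>UNIV. \<Sum>l\<in>UNIV. B $ k $ l * q k l)
      = (\<Sum>k\<in>UNIV. \<Sum>l\<in>UNIV. (A $ i $ j * B $ k $ l) * (p i j * q k l))" for i j
    by (simp only: sum_distrib_left mult_ac)
  ultimately show ?thesis unfolding sum4_def by simp
qed

text \<open>The indices are arranged so that \<open>y\<close> carries the outer pair and
  \<open>P\<close> the inner pair, the pattern of the last term in \<open>E_H_H\<close>.\<close>

lemma transport_form_sum4:
  fixes A B P :: "real^'n^'n" and y :: "real^'n"
  assumes "transpose A = A"
  shows "(A *v y) \<bullet> (P *v (B *v y)) = sum4 A B (\<lambda>i j k l. y $ i * y $ l * P $ j $ k)"
proof -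
  have s: "A $ j $ i = A $ i $ j" for i j by (rule symmetric_matrix_entry[OF assms])
  have "(A *v y) \<bullet> (P *v (B *v y)) = (\<Sum>j\<in>UNIV. \<Sum>k\<in>UNIV. P $ j $ k * ((\<Sum>i\<in>UNIV. A $ i $ j * y $ i) * (\<Sum>l\<in>UNIV. B $ k $ l * y $ l)))"
    unfolding inner_matrix_sum by (simp add: matrix_vector_mult_def s)
  also have "\<dots> = (\<Sum>j\<in>UNIV. \<Sum>k\<in>UNIV. \<Sum>i\<in>UNIV. \<Sum>l\<in>UNIV. (A $ i $ j * B $ k $ l) * (y $ i * y $ l * P $ j $ k))"
    by (intro sum.cong refl) (unfold sum_product, unfold sum_distrib_left, intro sum.cong refl, simp only: mult_ac)
  also have "\<dots> = sum4 A B (\<lambda>i j k l. y $ i * y $ l * P $ j $ k)"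
    unfolding sum4_def by (rule sum_rotate3)
  finally show ?thesis .
qed

text \<open>Symmetry of \<open>P\<close> lets the index cycle of the trace be read as outer pair
  times inner pair, the pattern of the first term on the right of \<open>E_H_H\<close>.\<close>

lemma trace_form_sum4:
  fixes A B P :: "real^'n^'n"
  assumes P: "transpose P = P"
  shows "trace (A ** P ** B ** P) = sum4 A B (\<lambda>i j k l. P $ i $ l * P $ j $ k)"
proof -
  have s: "P $ j $ i = P $ i $ j" for i j by (rule symmetric_matrix_entry[OF P])
  have "trace (A ** P ** B ** P) = (\<Sum>i\<in>UNIV. \<Sum>l\<in>UNIV. (\<Sum>k\<in>UNIV. (\<Sum>j\<in>UNIV. A $ i $ j * P $ j $ k) * B $ k $ l) * P $ l $ i)"
    by (simp add: trace_def matrix_matrix_mult_def)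
  also have "\<dots> = (\<Sum>i\<in>UNIV. \<Sum>l\<in>UNIV. \<Sum>k\<in>UNIV. \<Sum>j\<in>UNIV. (A $ i $ j * B $ k $ l) * (P $ l $ i * P $ j $ k))"
    unfolding sum_distrib_right by (intro sum.cong refl) (simp only: mult_ac)
  also have "\<dots> = (\<Sum>i\<in>UNIV. \<Sum>l\<in>UNIV. \<Sum>k\<in>UNIV. \<Sum>j\<in>UNIV. (A $ i $ j * B $ k $ l) * (P $ i $ l * P $ j $ k))"
    by (intro sum.cong refl arg_cong2[where f = "(*)"] s)
  also have "\<dots> = sum4 A B (\<lambda>i j k l. P $ i $ l * P $ j $ k)"
    unfolding sum4_def by (intro sum.cong refl sum_reverse3)
  finally show ?thesis .
qed

context moment_map
begin

lemma L1_sum4: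
  assumes u: "\<And>i j k l. L1 (\<lambda>x. u x i j k l)"
  shows "L1 (\<lambda>x. sum4 A B (u x))"
proof -
  have eq: "w x * sum4 A B (u x) = (\<Sum>i\<in>UNIV. \<Sum>j\<in>UNIV. \<Sum>k\<in>UNIV. \<Sum>l\<in>UNIV. (A $ i $ j * B $ k $ l) * (w x * u x i j k l))" for x
    unfolding sum4_def by (simp add: sum_distrib_left mult_ac)
  show ?thesis unfolding eq by (intro Bochner_Integration.integrable_sum integrable_mult_right u)
qed

lemma E_sum4:
  assumes u: "\<And>i j k l. L1 (\<lambda>x. u x i j k l)"
  shows "E (\<lambda>x. sum4 A B (u x)) = sum4 A B (\<lambda>i j k l. E (\<lambda>x. u x i j k l))"
proof -
  have eq: "w x * sum4 A B (u x) = (\<Sum>i\<in>UNIV. \<Sum>j\<in>UNIV. \<Sum>k\<in>UNIV. \<Sum>l\<in>UNIV. (A $ i $ j * B $ k $ l) * (w x * u x i j k l))" for x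
    unfolding sum4_def by (simp add: sum_distrib_left mult_ac)
  show ?thesis unfolding E_def eq
    by (simp add: Bochner_Integration.integral_sum Bochner_Integration.integrable_sum u sum4_def)
qed

definition trH :: "real^'n^'n \<Rightarrow> real^'n \<Rightarrow> real" where "trH A x = trace (A ** H x)"
definition quad :: "real^'n^'n \<Rightarrow> real^'n \<Rightarrow> real" where "quad A x = F x \<bullet> (A *v F x)"
definition transport :: "real^'n^'n \<Rightarrow> real^'n^'n \<Rightarrow> real^'n \<Rightarrow> real" where
  "transport A B x = (A *v F x) \<bullet> (H x *v (B *v F x))"
definition trHH :: "real^'n^'n \<Rightarrow> real^'n^'n \<Rightarrow> real^'n \<Rightarrow> real" where "trHH A B x = trace (A ** H x ** B ** H x)"

lemma trH_sum: "trH A x = (\<Sum>i\<in>UNIV. \<Sum>j\<in>UNIV. A $ i $ j * H x $ i $ j)"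
  unfolding trH_def trace_mult_sum using hessian_symmetric[OF smooth_psi, of x] by (metis (no_types, lifting) sum.cong)

lemma quad_sum: "quad A x = (\<Sum>i\<in>UNIV. \<Sum>j\<in>UNIV. A $ i $ j * (F x $ i * F x $ j))"
  unfolding quad_def by (rule inner_matrix_sum)

lemma trH_trH_sum4: "trH A x * trH B x = sum4 A B (\<lambda>i j k l. H x $ i $ j * H x $ k $ l)"
  unfolding trH_sum by (rule sum4_product)

lemma quad_quad_sum4: "quad A x * quad B x = sum4 A B (\<lambda>i j k l. F x $ i * F x $ j * (F x $ k * F x $ l))"
  unfolding quad_sum by (rule sum4_product)

lemma transport_sum4: "transpose A = A \<Longrightarrow> transport A B x = sum4 A B (\<lambda>i j k l. F x $ i * F x $ l * H x $ j $ k)"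
  unfolding transport_def by (rule transport_form_sum4)

lemma trHH_sum4: "trHH A B x = sum4 A B (\<lambda>i j k l. H x $ i $ l * H x $ j $ k)"
  unfolding trHH_def by (rule trace_form_sum4[OF H_transpose])

lemma L1_trH: "L1 (trH A)"
  unfolding trH_sum[abs_def] by (rule L1_sum2[OF L1_H])

lemma L1_quad: "L1 (quad A)"
  unfolding quad_sum[abs_def] by (rule L1_sum2[OF L1_F2])

lemma L1_trH_trH: "L1 (\<lambda>x. trH A x * trH B x)"
  unfolding trH_trH_sum4 by (rule L1_sum4[OF L1_H_H])

lemma L1_quad_quad: "L1 (\<lambda>x. quad A x * quad B x)"
  unfolding quad_quad_sum4 by (rule L1_sum4[OF L1_F4])

lemma L1_transport:
  assumes "transpose A = A" shows "L1 (transport A B)"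
  unfolding transport_sum4[OF assms, abs_def] by (rule L1_sum4[OF L1_F2_H])

lemma L1_trHH: "L1 (trHH A B)"
  unfolding trHH_sum4[abs_def] by (rule L1_sum4[OF L1_H_H])

lemma E_trH: "E (trH A) = E (quad A)"
  unfolding trH_sum[abs_def] quad_sum[abs_def] E_sum2[OF L1_H] E_sum2[OF L1_F2] E_H ..

text \<open>The coefficient 3 counts transport terms: one comes directly from \<open>E_H_H\<close>,
  and two arise when \<open>E_F2_H\<close> reduces the remaining term with a single entry of
  \<open>H\<close>. The latter two have their indices permuted and become the same form by symmetry
  of \<open>A\<close> and \<open>B\<close>.\<close>

lemma E_trH_trH:
  assumes A: "transpose A = A" and B: "transpose B = B"
  shows "E (\<lambda>x. trH A x * trH B x) = E (\<lambda>x. quad A x * quad B x) - 3 * E (transport A B) + E (trHH A B)"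
proof -
  have T: "E (transport A B) = sum4 A B (\<lambda>i j k l. E (\<lambda>x. F x $ i * F x $ l * H x $ j $ k))"
    unfolding transport_sum4[OF A, abs_def] by (rule E_sum4[OF L1_F2_H])
  have T1: "sum4 A B (\<lambda>i j k l. E (\<lambda>x. F x $ i * F x $ k * H x $ j $ l)) = E (transport A B)"
    unfolding T by (rule sum4_swap_right[OF B, of A "\<lambda>i j k l. E (\<lambda>x. F x $ i * F x $ l * H x $ j $ k)"])
  have T2: "sum4 A B (\<lambda>i j k l. E (\<lambda>x. F x $ j * F x $ k * H x $ i $ l)) = E (transport A B)"
    unfolding T1[symmetric] by (rule sum4_swap_left[OF A, of B "\<lambda>i j k l. E (\<lambda>x. F x $ i * F x $ k * H x $ j $ l)"])
  have "E (\<lambda>x. trH A x * trH B x) = sum4 A B (\<lambda>i j k l. E (\<lambda>x. H x $ i $ j * H x $ k $ l))"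
    unfolding trH_trH_sum4 by (rule E_sum4[OF L1_H_H])
  also have "\<dots> = sum4 A B (\<lambda>i j k l. E (\<lambda>x. H x $ i $ l * H x $ j $ k) + E (\<lambda>x. F x $ i * F x $ j * H x $ k $ l)
      - E (\<lambda>x. F x $ i * F x $ l * H x $ j $ k))"
    by (rule arg_cong[where f = "sum4 A B"]) (intro ext E_H_H)
  also have "\<dots> = sum4 A B (\<lambda>i j k l. E (\<lambda>x. H x $ i $ l * H x $ j $ k))
      + sum4 A B (\<lambda>i j k l. E (\<lambda>x. F x $ i * F x $ j * H x $ k $ l)) - E (transport A B)"
    unfolding sum4_diff sum4_add T ..
  also have "sum4 A B (\<lambda>i j k l. E (\<lambda>x. F x $ i * F x $ j * H x $ k $ l))
      = sum4 A B (\<lambda>i j k l. E (\<lambda>x. F x $ i * F x $ j * (F x $ k * F x $ l))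
          - E (\<lambda>x. F x $ j * F x $ k * H x $ i $ l) - E (\<lambda>x. F x $ i * F x $ k * H x $ j $ l))"
    by (rule arg_cong[where f = "sum4 A B"]) (intro ext E_F2_H)
  also have "\<dots> = sum4 A B (\<lambda>i j k l. E (\<lambda>x. F x $ i * F x $ j * (F x $ k * F x $ l))) - E (transport A B) - E (transport A B)"
    unfolding sum4_diff T1 T2 ..
  also have "sum4 A B (\<lambda>i j k l. E (\<lambda>x. H x $ i $ l * H x $ j $ k)) = E (trHH A B)"
    unfolding trHH_sum4[abs_def] by (rule E_sum4[OF L1_H_H, symmetric])
  also have "sum4 A B (\<lambda>i j k l. E (\<lambda>x. F x $ i * F x $ j * (F x $ k * F x $ l))) = E (\<lambda>x. quad A x * quad B x)"
    unfolding quad_quad_sum4 by (rule E_sum4[OF L1_F4, symmetric])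
  finally show ?thesis by simp
qed

section \<open>Variance of quadratic forms of the moment map\<close>

lemma quad_has_derivative:
  assumes A: "transpose A = A"
  shows "(quad A has_derivative (\<lambda>h. (2 *\<^sub>R (H x *v (A *v F x))) \<bullet> h)) (at x)"
proof -
  have dA: "((\<lambda>x. A *v F x) has_derivative (\<lambda>h. A *v (H x *v h))) (at x)"
    by (rule bounded_linear.has_derivative[OF matrix_vector_mul_bounded_linear F_has_derivative])
  have "(quad A has_derivative (\<lambda>h. F x \<bullet> (A *v (H x *v h)) + (H x *v h) \<bullet> (A *v F x))) (at x)"
    unfolding quad_def[abs_def] by (rule has_derivative_inner[OF F_has_derivative dA])
  moreover have "F x \<bullet> (A *v (H x *v h)) + (H x *v h) \<bullet> (A *v F x) = (2 *\<^sub>R (H x *v (A *v F x))) \<bullet> h" for h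
    using symmetric_matrix_inner[OF A, of "F x" "H x *v h"] symmetric_matrix_inner[OF H_transpose, of x "A *v F x" h]
      symmetric_matrix_inner[OF H_transpose, of x h "A *v F x"]
    by (simp add: inner_commute)
  ultimately show ?thesis by simp
qed

lemma continuous_quad: "continuous_on S (quad A)"
  unfolding quad_def[abs_def] by (intro continuous_intros continuous_F continuous_on_matrix_vector)

lemma quad_bounded: obtains b where "0 < b" "\<And>x. \<bar>quad A x\<bar> \<le> b"
proof -
  obtain R where R: "R > 0" "\<And>x. norm (F x) \<le> R" using F_bounded by metis
  obtain k where k: "0 < k" "\<And>v. norm (A *v v) \<le> norm v * k"
    using bounded_linear.pos_bounded[OF matrix_vector_mul_bounded_linear, of A] by metis
  have "\<bar>quad A x\<bar> \<le> R * (R * k)" for x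
  proof -
    have "\<bar>quad A x\<bar> \<le> norm (F x) * norm (A *v F x)" unfolding quad_def by (rule Cauchy_Schwarz_ineq2)
    also have "\<dots> \<le> R * (norm (F x) * k)" using R k by (intro mult_mono) auto
    also have "\<dots> \<le> R * (R * k)" using R k by (intro mult_left_mono mult_right_mono) auto
    finally show ?thesis .
  qed
  then show ?thesis using that[of "R * (R * k)"] R k by simp
qed

lemma E_cutoff_tendsto:
  assumes u: "continuous_on UNIV u" "\<And>x. \<bar>u x\<bar> \<le> b"
  shows "(\<lambda>n. E (\<lambda>x. cutoff (real (Suc n)) x ^ p * u x)) \<longlonglongrightarrow> E u"
  unfolding E_def
proof (rule integral_dominated_convergence[where w = "\<lambda>x. b * w x"])
  show "(\<lambda>x. w x * u x) \<in> borel_measurable lborel"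
    using borel_measurable_continuous_onI[OF continuous_on_mult[OF continuous_w u(1)]] by simp
  show "(\<lambda>x. w x * (cutoff (real (Suc n)) x ^ p * u x)) \<in> borel_measurable lborel" for n
    using borel_measurable_continuous_onI[OF continuous_on_mult[OF continuous_w continuous_on_mult[OF continuous_on_power[OF cutoff_continuous] u(1)]], of "real (Suc n)" p] by simp
  show "integrable lborel (\<lambda>x. b * w x)" using w_integrable by simp
  have "(\<lambda>n. w x * (cutoff (real (Suc n)) x ^ p * u x)) \<longlonglongrightarrow> w x * (1 ^ p * u x)" for x
    by (intro tendsto_intros cutoff_tendsto_1)
  then show "AE x in lborel. (\<lambda>n. w x * (cutoff (real (Suc n)) x ^ p * u x)) \<longlonglongrightarrow> w x * u x"
    by (intro AE_I2) simp
  show "AE x in lborel. norm (w x * (cutoff (real (Suc n)) x ^ p * u x)) \<le> b * w x" for n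
  proof (rule AE_I2)
    fix x :: "real^'n"
    have "cutoff (real (Suc n)) x ^ p \<le> 1" by (intro power_le_one cutoff_nonneg cutoff_le_1)
    then have "cutoff (real (Suc n)) x ^ p * \<bar>u x\<bar> \<le> 1 * b" using u(2)[of x] by (intro mult_mono) auto
    then have "w x * (cutoff (real (Suc n)) x ^ p * \<bar>u x\<bar>) \<le> w x * b" using w_pos[of x] by (intro mult_left_mono) auto
    then show "norm (w x * (cutoff (real (Suc n)) x ^ p * u x)) \<le> b * w x"
      using w_pos[of x] cutoff_nonneg[of "real (Suc n)" x] by (simp add: abs_mult abs_of_nonneg mult_ac)
  qed
qed

text \<open>Young's inequality with a free weight, so that the main part of a gradient can be kept
  with a constant arbitrarily close to 1.\<close>

lemma costar_add_le:
  assumes "0 < \<kappa>"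
  shows "costar x (u + v) \<le> (1 + \<kappa>) * costar x u + (1 + 1 / \<kappa>) * costar x v"
proof -
  \<comment> \<open>Weights \<open>s\<close> and \<open>- (1 / s)\<close> make the mixed coefficient
    -2 while their squares are \<kappa> and its inverse.\<close>
  define s where "s = sqrt \<kappa>"
  have s: "0 < s" "s\<^sup>2 = \<kappa>" using assms by (auto simp: s_def)
  have "0 \<le> s\<^sup>2 * costar x u + 2 * s * (- (1 / s)) * (u \<bullet> (G x *v v)) + (- (1 / s))\<^sup>2 * costar x v" by (rule costar_mixed)
  then have "2 * (u \<bullet> (G x *v v)) \<le> \<kappa> * costar x u + 1 / \<kappa> * costar x v"
    using s by (simp add: power_divide)
  then show ?thesis unfolding costar_add by (simp add: distrib_right)
qed

text \<open>The gradient of \<open>quad A\<close> is \<open>2 *\<^sub>R (H x *v (A *v F x))\<close>,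
  whose squared dual norm is four times the transport integrand: the inverse Hessian meets two
  factors \<open>H\<close> and leaves one. The Brascamp-Lieb inequality is applied to
  \<open>quad A\<close> times a cutoff. The cutoff is removed first, for fixed \<kappa>, because its
  error carries the factor \<open>1 + 1 / \<kappa>\<close>; only then does \<kappa> tend to
  0.\<close>

theorem variance_quad_le:
  assumes A: "transpose A = A"
  shows "E (\<lambda>x. quad A x * quad A x) - (E (quad A))\<^sup>2 \<le> 4 * E (transport A A)"
proof -
  obtain b where b: "0 < b" "\<And>x. \<bar>quad A x\<bar> \<le> b" using quad_bounded by metis
  obtain C where C: "0 \<le> C" "\<And>N. N \<ge> 1 \<Longrightarrow> (\<integral>x. exp (- \<psi> x) * costar x (cutoff_grad N x) \<partial>lborel) \<le> C / N"
    using cutoff_energy by metis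
  define d where "d x = 2 *\<^sub>R (H x *v (A *v F x))" for x
  have cd: "continuous_on S d" for S unfolding d_def
    by (intro continuous_intros continuous_on_matrix_vector continuous_H continuous_F)
  have costar_d: "costar x (d x) = 4 * transport A A x" for x
    by (simp add: d_def costar_scale costar_H transport_def)
  have transport_nonneg: "0 \<le> transport A A x" for x by (simp add: transport_def H_psd)
  have bound: "E (\<lambda>x. cutoff (real (Suc n)) x ^ 2 * (quad A x * quad A x)) - (E (\<lambda>x. cutoff (real (Suc n)) x ^ 1 * quad A x))\<^sup>2
      \<le> (1 + \<kappa>) * (4 * E (transport A A)) + (1 + 1 / \<kappa>) * b\<^sup>2 * (C * inverse (real (Suc n)))" if \<kappa>: "0 < \<kappa>" for n \<kappa>
  proof -
    define N where "N = real (Suc n)"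
    have N: "N \<ge> 1" by (simp add: N_def)
    define e where "e x = cutoff N x *\<^sub>R d x + quad A x *\<^sub>R cutoff_grad N x" for x
    have de: "((\<lambda>x. cutoff N x * quad A x) has_derivative (\<lambda>h. e x \<bullet> h)) (at x)" for x
    proof -
      have "((\<lambda>x. cutoff N x * quad A x) has_derivative (\<lambda>h. cutoff N x * (d x \<bullet> h) + (cutoff_grad N x \<bullet> h) * quad A x)) (at x)"
        unfolding d_def by (rule has_derivative_mult[OF cutoff_has_derivative quad_has_derivative[OF A]])
      then show ?thesis by (simp add: e_def inner_add_left mult_ac)
    qed
    have ce: "continuous_on UNIV e" unfolding e_def
      by (intro continuous_intros cutoff_continuous cd continuous_quad cutoff_grad_continuous)
    have out: "cutoff N x * quad A x = 0" "e x = 0" if "norm x > N" for x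
      using that N by (auto simp: e_def cutoff_outside)
    have ie: "integrable lborel (\<lambda>x. w x * costar x (e x))"
      by (rule integrable_compact_support[where r = N])
        (auto simp: out costar_def intro!: continuous_intros continuous_w continuous_on_matrix_vector continuous_G ce)
    have ig: "integrable lborel (\<lambda>x. w x * costar x (cutoff_grad N x))"
      by (rule integrable_compact_support[where r = N])
        (use N in \<open>auto simp: cutoff_outside costar_def intro!: continuous_intros continuous_w continuous_on_matrix_vector continuous_G cutoff_grad_continuous\<close>)
    have "(\<integral>x. w x * (cutoff N x * quad A x)\<^sup>2 \<partial>lborel) - (\<integral>x. w x * (cutoff N x * quad A x) \<partial>lborel)\<^sup>2
       \<le> (\<integral>x. w x * costar x (e x) \<partial>lborel)"
      by (rule brascamp_lieb_compact_support[OF de ce]) (use out N in auto)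
    also have "\<dots> \<le> (\<integral>x. (1 + \<kappa>) * (4 * (w x * transport A A x)) + (1 + 1 / \<kappa>) * b\<^sup>2 * (w x * costar x (cutoff_grad N x)) \<partial>lborel)"
    proof (rule integral_mono[OF ie])
      show "integrable lborel (\<lambda>x. (1 + \<kappa>) * (4 * (w x * transport A A x)) + (1 + 1 / \<kappa>) * b\<^sup>2 * (w x * costar x (cutoff_grad N x)))"
        using L1_transport[OF A, of A] ig by (intro Bochner_Integration.integrable_add integrable_mult_right)
      fix x
      have "costar x (e x) \<le> (1 + \<kappa>) * costar x (cutoff N x *\<^sub>R d x) + (1 + 1 / \<kappa>) * costar x (quad A x *\<^sub>R cutoff_grad N x)"
        unfolding e_def by (rule costar_add_le[OF \<kappa>])
      also have "costar x (cutoff N x *\<^sub>R d x) \<le> 4 * transport A A x"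
      proof -
        have "(cutoff N x)\<^sup>2 \<le> 1" by (intro power_le_one cutoff_nonneg cutoff_le_1)
        then have "(cutoff N x)\<^sup>2 * (4 * transport A A x) \<le> 1 * (4 * transport A A x)"
          using transport_nonneg[of x] by (intro mult_right_mono) auto
        then show ?thesis by (simp add: costar_scale costar_d)
      qed
      also have "costar x (quad A x *\<^sub>R cutoff_grad N x) \<le> b\<^sup>2 * costar x (cutoff_grad N x)"
        unfolding costar_scale using b by (intro mult_right_mono costar_nonneg) (simp add: abs_le_square_iff[symmetric])
      finally have "costar x (e x) \<le> (1 + \<kappa>) * (4 * transport A A x) + (1 + 1 / \<kappa>) * (b\<^sup>2 * costar x (cutoff_grad N x))"
        using \<kappa> by (simp add: mult_left_mono)
      then have "w x * costar x (e x) \<le> w x * ((1 + \<kappa>) * (4 * transport A A x) + (1 + 1 / \<kappa>) * (b\<^sup>2 * costar x (cutoff_grad N x)))"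
        using w_pos[of x] by (intro mult_left_mono) auto
      also have "\<dots> = (1 + \<kappa>) * (4 * (w x * transport A A x)) + (1 + 1 / \<kappa>) * b\<^sup>2 * (w x * costar x (cutoff_grad N x))"
        by (simp only: distrib_left mult_ac)
      finally show "w x * costar x (e x) \<le> (1 + \<kappa>) * (4 * (w x * transport A A x)) + (1 + 1 / \<kappa>) * b\<^sup>2 * (w x * costar x (cutoff_grad N x))" .
    qed
    also have "\<dots> = (1 + \<kappa>) * (4 * E (transport A A)) + (1 + 1 / \<kappa>) * b\<^sup>2 * (\<integral>x. w x * costar x (cutoff_grad N x) \<partial>lborel)"
      using L1_transport[OF A, of A] ig by (simp add: E_def)
    also have "\<dots> \<le> (1 + \<kappa>) * (4 * E (transport A A)) + (1 + 1 / \<kappa>) * b\<^sup>2 * (C / N)"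
      using C(2)[OF N] \<kappa> unfolding w_def by (intro add_left_mono mult_left_mono) auto
    finally show ?thesis
      unfolding E_def N_def by (simp add: power2_eq_square mult_ac divide_inverse)
  qed
  have \<kappa>_bound: "E (\<lambda>x. quad A x * quad A x) - (E (quad A))\<^sup>2 \<le> (1 + \<kappa>) * (4 * E (transport A A))" if \<kappa>: "0 < \<kappa>" for \<kappa>
  proof -
    have "\<bar>quad A x * quad A x\<bar> \<le> b * b" for x unfolding abs_mult using b by (intro mult_mono) auto
    then have l2: "(\<lambda>n. E (\<lambda>x. cutoff (real (Suc n)) x ^ 2 * (quad A x * quad A x))) \<longlonglongrightarrow> E (\<lambda>x. quad A x * quad A x)"
      by (intro E_cutoff_tendsto continuous_intros continuous_quad)
    have l1: "(\<lambda>n. E (\<lambda>x. cutoff (real (Suc n)) x ^ 1 * quad A x)) \<longlonglongrightarrow> E (quad A)"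
      by (rule E_cutoff_tendsto[OF continuous_quad b(2)])
    have "E (\<lambda>x. quad A x * quad A x) - (E (quad A))\<^sup>2 \<le> (1 + \<kappa>) * (4 * E (transport A A)) + (1 + 1 / \<kappa>) * b\<^sup>2 * (C * 0)"
    proof (rule tendsto_le)
      show "(\<lambda>n. E (\<lambda>x. cutoff (real (Suc n)) x ^ 2 * (quad A x * quad A x)) - (E (\<lambda>x. cutoff (real (Suc n)) x ^ 1 * quad A x))\<^sup>2)
        \<longlonglongrightarrow> E (\<lambda>x. quad A x * quad A x) - (E (quad A))\<^sup>2"
        by (intro tendsto_intros l1 l2)
      show "(\<lambda>n. (1 + \<kappa>) * (4 * E (transport A A)) + (1 + 1 / \<kappa>) * b\<^sup>2 * (C * inverse (real (Suc n))))
        \<longlonglongrightarrow> (1 + \<kappa>) * (4 * E (transport A A)) + (1 + 1 / \<kappa>) * b\<^sup>2 * (C * 0)"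
        by (intro tendsto_intros LIMSEQ_inverse_real_of_nat)
    qed (use bound[OF \<kappa>] in \<open>auto intro!: always_eventually\<close>)
    then show ?thesis by simp
  qed
  have "((\<lambda>\<kappa>. (1 + \<kappa>) * (4 * E (transport A A))) \<longlongrightarrow> (1 + 0) * (4 * E (transport A A))) (at_right 0)"
    by (intro tendsto_intros)
  then have "E (\<lambda>x. quad A x * quad A x) - (E (quad A))\<^sup>2 \<le> (1 + 0) * (4 * E (transport A A))"
  proof (rule tendsto_lowerbound)
    show "\<forall>\<^sub>F \<kappa> in at_right 0. E (\<lambda>x. quad A x * quad A x) - (E (quad A))\<^sup>2 \<le> (1 + \<kappa>) * (4 * E (transport A A))"
      using eventually_at_right_less[of "0::real"] by eventually_elim (rule \<kappa>_bound)
  qed simp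
  then show ?thesis by simp
qed

lemma continuous_trH: "continuous_on S (trH A)"
  unfolding trH_sum[abs_def] by (intro continuous_intros continuous_H)

lemma continuous_transport: "continuous_on S (transport A B)"
  unfolding transport_def[abs_def] by (intro continuous_intros continuous_on_matrix_vector continuous_H continuous_F)

lemma continuous_trHH: "continuous_on S (trHH A B)"
  unfolding trHH_sum4[abs_def] sum4_def by (intro continuous_intros continuous_H)

end

theorem proposition3p2:
  fixes K :: "(real ^ 'n) set" and V \<psi> :: "real ^ 'n \<Rightarrow> real" and \<mu> :: "(real ^ 'n) measure"
    and M :: "'w measure" and U Y :: "'w \<Rightarrow> real ^ 'n" and H :: "'w \<Rightarrow> real ^ 'n ^ 'n"
  assumes "regular_isotropic_log_concave_target K V \<mu>"
    and "moment_potential K \<mu> \<psi>"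
    and "prob_space M"
    and "distributed M lborel U (\<lambda>u. ennreal (exp (- \<psi> u)))"
    and "Y = (\<lambda>w. grad \<psi> (U w))"
    and "H = (\<lambda>w. hessian \<psi> (U w))"
  shows "(\<forall>A\<in>sym_matrices. \<forall>B\<in>sym_matrices. forms_well_defined M Y H A B) \<and>
    (\<forall>A\<in>sym_matrices. \<forall>B\<in>sym_matrices.
       Gamma_tr M H A B = Gamma_quad M Y A B - 3 * T_form M Y H A B + U_form M H A B) \<and>
    (\<forall>A\<in>sym_matrices. D_form M Y H A A \<ge> 0) \<and>
    (\<forall>A\<in>sym_matrices. \<forall>B\<in>sym_matrices.
       Gamma_tr M H A B = 1/4 * Gamma_quad M Y A B + U_form M H A B - 3/4 * D_form M Y H A B)"
proof -
  interpret moment_map K V \<psi> \<mu> by standard (rule assms(1), rule assms(2))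
  \<comment> \<open>The law of \<open>U\<close> has density \<open>w\<close>, so expectations over
    the abstract probability space become weighted Lebesgue integrals.\<close>
  have tr: "integrable M (\<lambda>\<omega>. u (U \<omega>))" "(\<integral>\<omega>. u (U \<omega>) \<partial>M) = E u"
    if "continuous_on UNIV u" "L1 u" for u
  proof -
    have m: "u \<in> borel_measurable lborel" using borel_measurable_continuous_onI[OF that(1)] by simp
    show "integrable M (\<lambda>\<omega>. u (U \<omega>))"
      using distributed_integrable[OF assms(4) m] that(2) by (simp add: w_def)
    show "(\<integral>\<omega>. u (U \<omega>) \<partial>M) = E u"
      using distributed_integral[OF assms(4) m] by (simp add: E_def w_def)
  qed
  have eqs: "trace (A ** H \<omega>) = trH A (U \<omega>)" "Y \<omega> \<bullet> (A *v Y \<omega>) = quad A (U \<omega>)"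
    "(A *v Y \<omega>) \<bullet> (H \<omega> *v (B *v Y \<omega>)) = transport A B (U \<omega>)"
    "trace (A ** H \<omega> ** B ** H \<omega>) = trHH A B (U \<omega>)" for A B \<omega>
    unfolding assms(5,6) trH_def quad_def transport_def trHH_def by (rule refl)+
  note c = continuous_trH continuous_quad continuous_transport continuous_trHH
  have c2: "continuous_on UNIV (\<lambda>x. trH A x * trH B x)" "continuous_on UNIV (\<lambda>x. quad A x * quad B x)" for A B
    by (intro continuous_intros c)+
  have wd: "forms_well_defined M Y H A B" if "transpose A = A" for A B
    \<comment> \<open>\<open>eqs(4)\<close> comes first because its left side is also an instance of
      that of \<open>eqs(1)\<close>, with a product of three matrices in the role of
      \<open>A\<close>.\<close>
    unfolding forms_well_defined_def eqs(4) unfolding eqs(1-3)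
    using tr(1)[OF c(1) L1_trH] tr(1)[OF c(2) L1_quad] tr(1)[OF c(3) L1_transport[OF that]] tr(1)[OF c(4) L1_trHH]
      tr(1)[OF c2(1) L1_trH_trH] tr(1)[OF c2(2) L1_quad_quad] by blast
  have Gtr: "Gamma_tr M H A B = E (\<lambda>x. trH A x * trH B x) - E (trH A) * E (trH B)" for A B
    unfolding Gamma_tr_def eqs(1)
      covariance_expand[OF assms(3) tr(1)[OF c(1) L1_trH] tr(1)[OF c(1) L1_trH] tr(1)[OF c2(1) L1_trH_trH]]
      tr(2)[OF c(1) L1_trH] tr(2)[OF c2(1) L1_trH_trH] ..
  have Gq: "Gamma_quad M Y A B = E (\<lambda>x. quad A x * quad B x) - E (quad A) * E (quad B)" for A B
    unfolding Gamma_quad_def eqs(2)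
      covariance_expand[OF assms(3) tr(1)[OF c(2) L1_quad] tr(1)[OF c(2) L1_quad] tr(1)[OF c2(2) L1_quad_quad]]
      tr(2)[OF c(2) L1_quad] tr(2)[OF c2(2) L1_quad_quad] ..
  have T: "T_form M Y H A B = E (transport A B)" if "transpose A = A" for A B
    unfolding T_form_def eqs(3) by (rule tr(2)[OF c(3) L1_transport[OF that]])
  have U: "U_form M H A B = E (trHH A B)" for A B
    unfolding U_form_def eqs(4) by (rule tr(2)[OF c(4) L1_trHH])
  \<comment> \<open>\<open>E_trH\<close> says that the trace and the quadratic form have the same
    mean, so the products of means agree and the identity for second moments passes to the
    covariances.\<close>
  have main: "Gamma_tr M H A B = Gamma_quad M Y A B - 3 * T_form M Y H A B + U_form M H A B"
    if "transpose A = A" "transpose B = B" for A B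
    unfolding Gtr Gq T[OF that(1)] U E_trH_trH[OF that] E_trH by simp
  have D: "0 \<le> D_form M Y H A A" if "transpose A = A" for A
    unfolding D_form_def Gq T[OF that] using variance_quad_le[OF that] by (simp add: power2_eq_square)
  have "Gamma_tr M H A B = 1/4 * Gamma_quad M Y A B + U_form M H A B - 3/4 * D_form M Y H A B"
    if "transpose A = A" "transpose B = B" for A B
    using main[OF that] unfolding D_form_def right_diff_distrib by simp
  with wd main D show ?thesis unfolding sym_matrices_def by blast
qed

end
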